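(* Let $m\in\mathbb{N}$ and $1\le p\le\infty$, let $A_0,A_1$ be complex $m\times m$ matrices with $A_1\neq 0$, and suppose that there is a rational function $\phi$ (the characteristic function) such that $A_1R(\lambda,A_0)A_1=\phi(\lambda)A_1$ for all $\lambda\in\rho(A_0)$. Let $A$ be the bounded operator on $X=\ell^p(\mathbb{N},\mathbb{C}^m)$ given by $Ax=(A_0x_1,\,A_0x_2+A_1x_1,\,A_0x_3+A_1x_2,\dots)$ for $x=(x_k)_{k\ge1}\in X$, let $(T(t))_{t\ge0}$ be the $C_0$-semigroup generated by $A$, and for $x_0\in X$ write $x(t)=T(t)x_0$, $t\ge0$. Suppose that $\sigma(A_0)\subseteq\mathbb{C}_-$ and that $0\in\Omega_\phi^+\subseteq\mathbb{C}_-\cup\{0\}$, where $\Omega_\phi^+=\{\lambda\in\rho(A_0):|\phi(\lambda)|\ge1\}$. Assume further that $\phi$ is totally monotonic and that $\phi(\lambda)=p_0(0)/p_0(\lambda)$ for all $\lambda\in\rho(A_0)$, where $p_0(\lambda)=\det(\lambda-A_0)$ is the characteristic polynomial of $A_0$. Let $S\in\mathcal{B}(X)$ be the right shift $Sx=(0,x_1,x_2,\dots)$ and let $M\in\mathcal{B}(X)$ be given by $Mx=(A_1A_0^{-1}x_k)_{k\ge1}$. If $x_0\in X$ is such that $$\Big\|\frac1n\sum_{k=1}^n\phi(0)^kS^kMx_0\Big\|=O(n^{-1}),\quad n\to\infty,$$ then $\|x(t)\|=O(t^{-1/2})$ as $t\to\infty$. Moreover, for $1\le p\le\infty$ and all $x_0\in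 X$ we have $\|\dot{x}(t)\|=O(t^{-1/2})$ as $t\to\infty$. Both of these rates are sharp.
   Context: $\mathbb{C}_-=\{\lambda\in\mathbb{C}:\operatorname{Re}\lambda<0\}$. $\sigma$ and $\rho$ denote spectrum and resolvent set, $R(\lambda,A_0)=(\lambda-A_0)^{-1}$, and $\mathcal{B}(X)$ is the set of bounded linear operators on $X$. The space $\ell^p(\mathbb{N},\mathbb{C}^m)$ carries its natural norm, with the Euclidean norm on $\mathbb{C}^m$. A rational function $\phi$ is said to be totally monotonic if there exist $\varepsilon>0$ and a non-negative sequence $(a_n)_{n\ge0}\in\ell^1(\mathbb{Z}_+)$ such that the function $\psi_\varepsilon(\lambda)=\phi(\varepsilon^{-1}(\lambda-1))$ satisfies $\psi_\varepsilon(\lambda)=\sum_{n=0}^\infty a_n\lambda^{-(n+1)}$ for all $\lambda\in\mathbb{C}$ with $|\lambda|\ge1$. *)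

theory Defs
  imports
    "HOL-Analysis.Analysis"
    "HOL-Library.Landau_Symbols"
    "HOL-Computational_Algebra.Polynomial"
begin

text \<open>
  Sequences are indexed from 0, so the k-th term in the usual numbering from 1 is \<open>x (k - 1)\<close>.
  The exponent \<open>p\<close> is a value, not a type, so the space is a carrier set together with a norm
  function, and vector space operations on sequences are written pointwise.
  The norm on \<^typ>\<open>complex ^ 'm\<close> is the Euclidean one.
\<close>

type_synonym 'm cseq = "nat \<Rightarrow> complex ^ 'm"

definition lp_space :: "ennreal \<Rightarrow> ('m::finite) cseq set" where
  "lp_space p = (if p = \<infinity> then {x. bounded (range x)}
                 else {x. summable (\<lambda>k. norm (x k) powr enn2real p)})"

definition lp_norm :: "ennreal \<Rightarrow> ('m::finite) cseq \<Rightarrow> real" where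
  "lp_norm p x = (if p = \<infinity> then (SUP k. norm (x k))
                  else (\<Sum>k. norm (x k) powr enn2real p) powr (1 / enn2real p))"

definition lp_bounded_operator :: "ennreal \<Rightarrow> (('m::finite) cseq \<Rightarrow> 'm cseq) \<Rightarrow> bool" where
  "lp_bounded_operator p B \<longleftrightarrow>
     (\<forall>x\<in>lp_space p. B x \<in> lp_space p) \<and>
     (\<forall>x\<in>lp_space p. \<forall>y\<in>lp_space p. \<forall>a b.
        B (\<lambda>k. a *s x k + b *s y k) = (\<lambda>k. a *s B x k + b *s B y k)) \<and>
     (\<exists>C. \<forall>x\<in>lp_space p. lp_norm p (B x) \<le> C * lp_norm p x)"

text \<open>
  Only the values \<open>T t x\<close> for \<open>t \<ge> 0\<close> and \<open>x\<close> in the space are constrained or used.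
\<close>

definition lp_C0_semigroup :: "ennreal \<Rightarrow> (real \<Rightarrow> ('m::finite) cseq \<Rightarrow> 'm cseq) \<Rightarrow> bool" where
  "lp_C0_semigroup p T \<longleftrightarrow>
     (\<forall>t\<ge>0. lp_bounded_operator p (T t)) \<and>
     (\<forall>x\<in>lp_space p. T 0 x = x) \<and>
     (\<forall>s\<ge>0. \<forall>t\<ge>0. \<forall>x\<in>lp_space p. T (s + t) x = T s (T t x)) \<and>
     (\<forall>x\<in>lp_space p. ((\<lambda>h. lp_norm p (\<lambda>k. T h x k - x k)) \<longlongrightarrow> 0) (at_right 0))"

definition lp_generator ::
  "ennreal \<Rightarrow> (real \<Rightarrow> ('m::finite) cseq \<Rightarrow> 'm cseq) \<Rightarrow> ('m cseq \<times> 'm cseq) set" where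
  \<comment> \<open>the infinitesimal generator, as a graph\<close>
  "lp_generator p T = {(x, y). x \<in> lp_space p \<and> y \<in> lp_space p \<and>
     ((\<lambda>h. lp_norm p (\<lambda>k. (1 / h) *\<^sub>R (T h x k - x k) - y k)) \<longlongrightarrow> 0) (at_right 0)}"

definition lp_has_derivative ::
  "ennreal \<Rightarrow> (real \<Rightarrow> ('m::finite) cseq) \<Rightarrow> 'm cseq \<Rightarrow> real \<Rightarrow> bool" where
  \<comment> \<open>norm derivative at \<open>t\<close> of a curve on the half-line \<open>{0..}\<close>; one-sided at 0\<close>
  "lp_has_derivative p x v t \<longleftrightarrow> v \<in> lp_space p \<and>
     ((\<lambda>s. lp_norm p (\<lambda>k. (1 / (s - t)) *\<^sub>R (x s k - x t k) - v k)) \<longlongrightarrow> 0) (at t within {0..})"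

definition resolvent_set :: "complex ^ 'm ^ 'm \<Rightarrow> complex set" where
  "resolvent_set A = {z. invertible (mat z - A)}"

definition spectrum :: "complex ^ 'm ^ 'm \<Rightarrow> complex set" where
  "spectrum A = - resolvent_set A"

definition resolvent :: "complex \<Rightarrow> complex ^ 'm ^ 'm \<Rightarrow> complex ^ 'm ^ 'm" where
  "resolvent z A = matrix_inv (mat z - A)"

definition char_poly_fun :: "complex ^ 'm ^ 'm \<Rightarrow> complex \<Rightarrow> complex" where
  "char_poly_fun A z = det (mat z - A)"

definition rational_function :: "(complex \<Rightarrow> complex) \<Rightarrow> bool" where
  \<comment> \<open>lowest terms, so that zeros of \<open>Q\<close> are genuine poles; there \<open>f\<close> takes the value 0
     of division by zero. An identity of \<open>f\<close> with a continuous function near such a point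
     rules the pole out.\<close>
  "rational_function f \<longleftrightarrow> (\<exists>P Q. Q \<noteq> 0 \<and> coprime P Q \<and> (\<forall>z. f z = poly P z / poly Q z))"

definition totally_monotonic :: "(complex \<Rightarrow> complex) \<Rightarrow> bool" where
  "totally_monotonic f \<longleftrightarrow>
     (\<exists>\<epsilon>>0. \<exists>a :: nat \<Rightarrow> real. (\<forall>n. 0 \<le> a n) \<and> summable a \<and>
        (\<forall>z. norm z \<ge> 1 \<longrightarrow>
           (\<lambda>n. of_real (a n) / z ^ (n + 1)) sums f ((z - 1) / of_real \<epsilon>)))"

definition Omega_plus :: "complex ^ 'm ^ 'm \<Rightarrow> (complex \<Rightarrow> complex) \<Rightarrow> complex set" where
  "Omega_plus A0 \<phi> = {z \<in> resolvent_set A0. norm (\<phi> z) \<ge> 1}"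

definition system_operator ::
  "complex ^ 'm ^ 'm \<Rightarrow> complex ^ 'm ^ 'm \<Rightarrow> ('m::finite) cseq \<Rightarrow> 'm cseq" where
  "system_operator A0 A1 x =
     (\<lambda>k. case k of 0 \<Rightarrow> A0 *v x 0 | Suc j \<Rightarrow> A0 *v x (Suc j) + A1 *v x j)"

definition right_shift :: "('m::finite) cseq \<Rightarrow> 'm cseq" where
  "right_shift x = (\<lambda>k. case k of 0 \<Rightarrow> 0 | Suc j \<Rightarrow> x j)"

definition M_operator ::
  "complex ^ 'm ^ 'm \<Rightarrow> complex ^ 'm ^ 'm \<Rightarrow> ('m::finite) cseq \<Rightarrow> 'm cseq" where
  "M_operator A0 A1 x = (\<lambda>k. (A1 ** matrix_inv A0) *v x k)"

definition cesaro_mean ::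
  "complex ^ 'm ^ 'm \<Rightarrow> complex ^ 'm ^ 'm \<Rightarrow> (complex \<Rightarrow> complex) \<Rightarrow> ('m::finite) cseq \<Rightarrow>
     nat \<Rightarrow> 'm cseq" where
  "cesaro_mean A0 A1 \<phi> x n =
     (\<lambda>j. (1 / of_nat n) *s (\<Sum>k=1..n. \<phi> 0 ^ k *s (right_shift ^^ k) (M_operator A0 A1 x) j))"

end

theory Submission
  imports Defs "HOL-Complex_Analysis.Complex_Analysis"
begin

text \<open>
  Write \<open>A\<close> for the bidiagonal operator \<open>A0 + S A1\<close> and let \<open>\<epsilon>\<close>, \<open>a\<close> witness the total monotonicity of \<open>\<phi>\<close>. The whole
  proof compares the semigroup with powers of the Euler step \<open>B = 1 + \<epsilon> A\<close>, which has
  \<open>E = 1 + \<epsilon> A0\<close> on the diagonal and \<open>F = \<epsilon> A1\<close> below it.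
  
  Expanding \<open>A1 R(z, A0) A1 = \<phi>(z) A1\<close> in powers of \<open>1 / \<lambda>\<close>, where \<open>\<lambda> = 1 + \<epsilon> z\<close>, gives \<open>F E\<^sup>n F = a n F\<close>
  (\<open>F_E_power_F\<close>), with weights \<open>a n \<ge> 0\<close> of total mass \<open>\<phi>(0) = 1\<close>. Hence the norms of \<open>F B\<^sup>n x\<close> satisfy a renewal
  inequality with mass one, and \<open>B\<close> is power bounded (\<open>system_operator_power_bounded\<close>, \<open>B_power_bounded\<close>). Here the
  powers of \<open>E\<close> are summable because \<open>\<phi> = p\<^sub>0(0) / p\<^sub>0\<close> is bounded for \<open>\<bar>\<lambda>\<bar> \<ge> 1\<close>, so that all eigenvalues of \<open>E\<close>
  lie in the open unit disc (\<open>resolvent_set_outside_disc\<close>, \<open>matrix_powers_summable\<close>).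
  
  The semigroup is a Poisson average of these powers: \<open>T(\<epsilon> s)\<close> is \<open>exp(-s)\<close> times the sum of \<open>s\<^sup>n / n! B\<^sup>n\<close>
  (\<open>T_series\<close>). Applying \<open>A\<close> amounts to taking differences of the Poisson weights, whose total variation is of order
  \<open>s\<^sup>-\<^sup>1\<^sup>/\<^sup>2\<close>, standard deviation divided by mean. Thus the norm of \<open>T(t) A\<close> is \<open>O(t\<^sup>-\<^sup>1\<^sup>/\<^sup>2)\<close> (\<open>T_A_decay\<close>). As
  \<open>T(t) A x0\<close> is the derivative of the orbit of \<open>x0\<close>, this is the second rate. The first rate is the same
  statement, because the Cesaro condition characterises the range of \<open>A\<close>
  (\<open>range_A_if_cesaro_mean\<close>, \<open>cesaro_mean_A\<close>).
  
  For the same reason sharpness of one rate is sharpness of the other. Near \<open>0\<close> the curve \<open>\<bar>\<phi>\<bar> = 1\<close> touches the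
  imaginary axis to second order (\<open>phi_unit_circle_curve\<close>), and its points are approximate eigenvalues of \<open>A\<close>
  (\<open>approximate_eigenvector\<close>). The point \<open>z\<close> with imaginary part \<open>t\<^sup>-\<^sup>1\<^sup>/\<^sup>2\<close> shows that the norm of \<open>T(t) A\<close> is at least
  \<open>\<bar>z exp(t z)\<bar>\<close>, which is of order \<open>t\<^sup>-\<^sup>1\<^sup>/\<^sup>2\<close> (\<open>norm_T_A_lower_bound\<close>). The uniform boundedness
  principle on \<open>\<ell>\<^sup>p\<close> turns this into a single orbit that violates any faster rate (\<open>T_A_rate_sharp\<close>).
\<close>

section \<open>The norm of \<open>\<ell>\<^sup>p\<close>\<close>

lemma enn2real_ge_1:
  assumes "1 \<le> p" "p \<noteq> \<infinity>"
  shows "1 \<le> enn2real p"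
  using assms enn2real_mono[of 1 p] by (simp add: less_top)

text \<open>
  Membership and norm bound are combined into one condition on finite partial sums. It has no
  infinite sum in it, so comparison, shift invariance and passage to coordinatewise limits
  all become statements about finite sums.
\<close>

lemma lp_norm_le_iff_finite:
  fixes x :: "('m::finite) cseq"
  assumes "1 \<le> p" "p \<noteq> \<infinity>" "0 \<le> C"
  shows "x \<in> lp_space p \<and> lp_norm p x \<le> C \<longleftrightarrow>
         (\<forall>N. (\<Sum>k<N. norm (x k) powr enn2real p) \<le> C powr enn2real p)"
proof -
  define q where "q = enn2real p"
  have q: "1 \<le> q" using enn2real_ge_1 assms by (simp add: q_def)
  have eq: "s powr (1/q) \<le> C \<longleftrightarrow> s \<le> C powr q" if "0 \<le> s" for s
  proof -
    have "s powr (1/q) \<le> C \<longleftrightarrow> (s powr (1/q)) powr q \<le> C powr q"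
      using q assms(3) powr_mono2 powr_less_mono2 by (smt (verit) powr_ge_zero)
    also have "(s powr (1/q)) powr q = s"
      using q that by (simp add: powr_powr)
    finally show ?thesis .
  qed
  show ?thesis
  proof
    assume a: "x \<in> lp_space p \<and> lp_norm p x \<le> C"
    then have s: "summable (\<lambda>k. norm (x k) powr q)"
      and le: "(\<Sum>k. norm (x k) powr q) \<le> C powr q"
      using assms eq suminf_nonneg[of "\<lambda>k. norm (x k) powr q"]
      by (auto simp: lp_space_def lp_norm_def q_def)
    show "\<forall>N. (\<Sum>k<N. norm (x k) powr enn2real p) \<le> C powr enn2real p"
      using sum_le_suminf[OF s, of "{..<N}" for N] le
      by (auto simp: q_def intro: order_trans)
  next
    assume b: "\<forall>N. (\<Sum>k<N. norm (x k) powr enn2real p) \<le> C powr enn2real p"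
    have s: "summable (\<lambda>k. norm (x k) powr q)"
      by (rule summableI_nonneg_bounded[where x = "C powr q"]) (use b in \<open>auto simp: q_def\<close>)
    have "(\<Sum>k. norm (x k) powr q) \<le> C powr q"
      by (rule suminf_le_const[OF s]) (use b in \<open>auto simp: q_def\<close>)
    then show "x \<in> lp_space p \<and> lp_norm p x \<le> C"
      using s assms(2) eq suminf_nonneg[OF s] by (auto simp: lp_space_def lp_norm_def q_def)
  qed
qed

lemma lp_norm_le_iff_infinity:
  fixes x :: "('m::finite) cseq"
  shows "x \<in> lp_space \<infinity> \<and> lp_norm \<infinity> x \<le> C \<longleftrightarrow> (\<forall>k. norm (x k) \<le> C)"
proof
  assume a: "x \<in> lp_space \<infinity> \<and> lp_norm \<infinity> x \<le> C"
  then obtain b where "norm (x k) \<le> b" for k by (auto simp: lp_space_def bounded_iff)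
  then have "bdd_above (range (\<lambda>k. norm (x k)))" by (intro bdd_aboveI2[of UNIV _ b]) auto
  then have "norm (x k) \<le> (SUP k. norm (x k))" for k
    by (rule cSUP_upper[rotated]) simp
  then show "\<forall>k. norm (x k) \<le> C"
    using a by (auto simp: lp_norm_def intro: order_trans)
next
  assume "\<forall>k. norm (x k) \<le> C"
  then show "x \<in> lp_space \<infinity> \<and> lp_norm \<infinity> x \<le> C"
    by (auto simp: lp_space_def lp_norm_def bounded_iff intro: cSUP_least)
qed

lemma lp_norm_nonneg:
  fixes x :: "('m::finite) cseq"
  assumes "x \<in> lp_space p"
  shows "0 \<le> lp_norm p x"
proof (cases "p = \<infinity>")
  case True
  then have "norm (x 0) \<le> lp_norm p x"
    using assms lp_norm_le_iff_infinity[of x "lp_norm p x"] by auto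
  then show ?thesis by (smt (verit) norm_ge_zero)
qed (simp add: lp_norm_def)

lemma norm_le_lp_norm:
  fixes x :: "('m::finite) cseq"
  assumes "1 \<le> p" "x \<in> lp_space p"
  shows "norm (x k) \<le> lp_norm p x"
proof (cases "p = \<infinity>")
  case True
  then show ?thesis using assms lp_norm_le_iff_infinity[of x "lp_norm p x"] by auto
next
  case False
  have "norm (x k) powr enn2real p \<le> (\<Sum>k<Suc k. norm (x k) powr enn2real p)"
    by (simp add: sum_nonneg)
  also have "\<dots> \<le> lp_norm p x powr enn2real p"
    using lp_norm_le_iff_finite[of p "lp_norm p x" x] False assms lp_norm_nonneg[OF assms(2)] by blast
  finally show ?thesis
    using enn2real_ge_1[OF assms(1) False] powr_less_mono2[of "enn2real p" "lp_norm p x" "norm (x k)"]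
      lp_norm_nonneg[OF assms(2)] by force
qed

lemma lp_dominated:
  fixes x y :: "('m::finite) cseq"
  assumes p: "1 \<le> p" and x: "x \<in> lp_space p" and c: "0 \<le> c"
    and le: "\<And>k. norm (y k) \<le> c * norm (x k)"
  shows "y \<in> lp_space p" "lp_norm p y \<le> c * lp_norm p x"
proof -
  have n: "0 \<le> lp_norm p x" by (rule lp_norm_nonneg[OF x])
  have "y \<in> lp_space p \<and> lp_norm p y \<le> c * lp_norm p x"
  proof (cases "p = \<infinity>")
    case True
    have "norm (y k) \<le> c * lp_norm p x" for k
      using le[of k] norm_le_lp_norm[OF p x, of k] c by (meson mult_left_mono order_trans)
    then show ?thesis using lp_norm_le_iff_infinity True by auto
  next
    case False
    define q where "q = enn2real p"
    have q: "1 \<le> q" using enn2real_ge_1 p False by (simp add: q_def)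
    have "(\<Sum>k<N. norm (y k) powr q) \<le> (c * lp_norm p x) powr q" for N
    proof -
      have "(\<Sum>k<N. norm (y k) powr q) \<le> (\<Sum>k<N. (c * norm (x k)) powr q)"
        using le q by (intro sum_mono powr_mono2) auto
      also have "\<dots> = c powr q * (\<Sum>k<N. norm (x k) powr q)"
        using c by (simp add: powr_mult sum_distrib_left)
      also have "\<dots> \<le> c powr q * (lp_norm p x powr q)"
        using lp_norm_le_iff_finite[of p "lp_norm p x" x] False p x n
        by (intro mult_left_mono) (auto simp: q_def)
      finally show ?thesis using c n by (simp add: powr_mult)
    qed
    then show ?thesis
      using lp_norm_le_iff_finite[of p "c * lp_norm p x" y] p False c n by (auto simp: q_def)
  qed
  then show "y \<in> lp_space p" "lp_norm p y \<le> c * lp_norm p x" by auto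
qed

lemma powr_convex_combination:
  fixes u v a b q :: real
  assumes q: "1 \<le> q" and "0 \<le> u" "0 \<le> v" "0 \<le> a" "0 \<le> b" "a + b = 1"
  shows "(a * u + b * v) powr q \<le> a * u powr q + b * v powr q"
proof (cases "u = 0 \<or> v = 0")
  case True
  have le: "(c * w) powr q \<le> c * w powr q" if "0 \<le> c" "c \<le> 1" "0 \<le> w" for c w :: real
  proof -
    have "c powr q \<le> c"
      using that q powr_mono'[of 1 q c] by (cases "c = 0") auto
    then show ?thesis using that by (simp add: powr_mult mult_right_mono)
  qed
  show ?thesis
    using True le[of a u] le[of b v] assms by auto
next
  case False
  have b: "a = 1 - b" and "b \<le> 1" using assms by auto
  then show ?thesis
    using False assms convex_onD[OF powr_convex[OF q], of b u v] unfolding b by (simp add: algebra_simps)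
qed

text \<open>
  Minkowski's inequality. For bounds \<open>a\<close>, \<open>b\<close> of the two norms, \<open>x + y\<close> is \<open>a + b\<close> times a convex
  combination of \<open>x / a\<close> and \<open>y / b\<close>, and \<open>u \<mapsto> u powr q\<close> is convex. Strictly positive bounds avoid
  a case distinction on vanishing norms; they are let tend to the norms at the end.
\<close>

lemma lp_add:
  fixes x y :: "('m::finite) cseq"
  assumes p: "1 \<le> p" and x: "x \<in> lp_space p" and y: "y \<in> lp_space p"
  shows "(\<lambda>k. x k + y k) \<in> lp_space p"
    and "lp_norm p (\<lambda>k. x k + y k) \<le> lp_norm p x + lp_norm p y"
proof -
  let ?z = "\<lambda>k. x k + y k"
  have bound: "?z \<in> lp_space p \<and> lp_norm p ?z \<le> a + b"
    if a: "lp_norm p x \<le> a" "0 < a" and b: "lp_norm p y \<le> b" "0 < b" for a b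
  proof (cases "p = \<infinity>")
    case True
    have "norm (?z k) \<le> a + b" for k
      using norm_le_lp_norm[OF p x, of k] norm_le_lp_norm[OF p y, of k] a b norm_triangle_ineq[of "x k" "y k"]
      by linarith
    then show ?thesis using lp_norm_le_iff_infinity True by auto
  next
    case False
    define q where "q = enn2real p"
    have q: "1 \<le> q" using enn2real_ge_1 p False by (simp add: q_def)
    have "(\<Sum>k<N. norm (?z k) powr q) \<le> (a + b) powr q" for N
    proof -
      define s where "s = a + b"
      have s: "0 < s" using a b by (simp add: s_def)
      have pointwise: "norm (?z k) powr q \<le> s powr q *
          (a / s * (norm (x k) powr q / a powr q) + b / s * (norm (y k) powr q / b powr q))" for k
      proof -
        have "norm (?z k) \<le> norm (x k) + norm (y k)" by (rule norm_triangle_ineq)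
        also have "\<dots> = s * (a / s * (norm (x k) / a) + b / s * (norm (y k) / b))"
          using a b s by (simp add: field_simps)
        finally have "norm (?z k) powr q
            \<le> (s * (a / s * (norm (x k) / a) + b / s * (norm (y k) / b))) powr q"
          using q by (intro powr_mono2) auto
        also have "\<dots> = s powr q * (a / s * (norm (x k) / a) + b / s * (norm (y k) / b)) powr q"
          using s a b by (subst powr_mult) auto
        also have "\<dots> \<le> s powr q * (a / s * (norm (x k) / a) powr q + b / s * (norm (y k) / b) powr q)"
          using a b s q by (intro mult_left_mono powr_convex_combination)
            (auto simp: s_def add_divide_distrib[symmetric])
        finally show ?thesis using a b by (simp add: powr_divide)
      qed
      have X: "(\<Sum>k<N. norm (x k) powr q) \<le> a powr q"
        using lp_norm_le_iff_finite[of p a x] False p x a by (auto simp: q_def)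
      have Y: "(\<Sum>k<N. norm (y k) powr q) \<le> b powr q"
        using lp_norm_le_iff_finite[of p b y] False p y b by (auto simp: q_def)
      have "(\<Sum>k<N. norm (?z k) powr q) \<le> (\<Sum>k<N. s powr q *
          (a / s * (norm (x k) powr q / a powr q) + b / s * (norm (y k) powr q / b powr q)))"
        by (intro sum_mono pointwise)
      also have "\<dots> = s powr q * (a / s * ((\<Sum>k<N. norm (x k) powr q) / a powr q)
          + b / s * ((\<Sum>k<N. norm (y k) powr q) / b powr q))"
        by (simp add: sum_distrib_left sum.distrib sum_divide_distrib distrib_left)
      also have "\<dots> \<le> s powr q * (a / s * 1 + b / s * 1)"
        using X Y a b s by (intro mult_left_mono add_mono) auto
      also have "\<dots> = s powr q" using s by (simp add: s_def add_divide_distrib[symmetric])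
      finally show ?thesis by (simp add: s_def)
    qed
    then show ?thesis
      using lp_norm_le_iff_finite[of p "a + b" ?z] p False a b by (auto simp: q_def)
  qed
  have nn: "0 \<le> lp_norm p x" "0 \<le> lp_norm p y" by (simp_all add: lp_norm_nonneg x y)
  show "?z \<in> lp_space p"
    using bound[of "lp_norm p x + 1" "lp_norm p y + 1"] nn by auto
  show "lp_norm p ?z \<le> lp_norm p x + lp_norm p y"
  proof (rule field_le_epsilon)
    fix e :: real assume "0 < e"
    then show "lp_norm p ?z \<le> lp_norm p x + lp_norm p y + e"
      using bound[of "lp_norm p x + e/2" "lp_norm p y + e/2"] nn by auto
  qed
qed

text \<open>
  This replaces completeness of the space throughout: a limit is always found coordinate by
  coordinate first, and its membership and norm are then read off from bounds on the approximants.
\<close>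

lemma lp_Fatou:
  fixes x :: "('m::finite) cseq" and xs :: "nat \<Rightarrow> 'm cseq"
  assumes p: "1 \<le> p"
    and ev: "eventually (\<lambda>n. xs n \<in> lp_space p \<and> lp_norm p (xs n) \<le> C) sequentially"
    and lim: "\<And>k. (\<lambda>n. xs n k) \<longlonglongrightarrow> x k"
  shows "x \<in> lp_space p" "lp_norm p x \<le> C"
proof -
  obtain n where "xs n \<in> lp_space p" "lp_norm p (xs n) \<le> C"
    using ev eventually_happens'[OF sequentially_bot] by blast
  then have C: "0 \<le> C" using lp_norm_nonneg order_trans by blast
  have "x \<in> lp_space p \<and> lp_norm p x \<le> C"
  proof (cases "p = \<infinity>")
    case True
    have "norm (x k) \<le> C" for k
    proof (rule tendsto_upperbound[OF tendsto_norm[OF lim]])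
      show "eventually (\<lambda>n. norm (xs n k) \<le> C) sequentially"
        using ev by eventually_elim (use True lp_norm_le_iff_infinity in blast)
    qed simp
    then show ?thesis using lp_norm_le_iff_infinity True by auto
  next
    case False
    define q where "q = enn2real p"
    have q: "1 \<le> q" using enn2real_ge_1 p False by (simp add: q_def)
    have "(\<Sum>k<N. norm (x k) powr q) \<le> C powr q" for N
    proof (rule tendsto_upperbound)
      show "(\<lambda>n. \<Sum>k<N. norm (xs n k) powr q) \<longlonglongrightarrow> (\<Sum>k<N. norm (x k) powr q)"
        using q by (intro tendsto_intros tendsto_powr2 lim tendsto_norm tendsto_sum) auto
      show "eventually (\<lambda>n. (\<Sum>k<N. norm (xs n k) powr q) \<le> C powr q) sequentially"
        using ev by eventually_elim (use lp_norm_le_iff_finite[OF p False C] in \<open>auto simp: q_def\<close>)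
    qed simp
    then show ?thesis
      using lp_norm_le_iff_finite[of p C x] p False C by (auto simp: q_def)
  qed
  then show "x \<in> lp_space p" "lp_norm p x \<le> C" by auto
qed

lemma right_shift_simps [simp]:
  "right_shift x 0 = 0" "right_shift x (Suc j) = x j"
  by (simp_all add: right_shift_def)

lemma right_shift_funpow:
  "(right_shift ^^ n) x k = (if k < n then 0 else x (k - n))"
  by (induction n arbitrary: k) (auto simp: right_shift_def split: nat.split)

lemma lp_right_shift_bound_iff:
  fixes x :: "('m::finite) cseq"
  assumes p: "1 \<le> p" and C: "0 \<le> C"
  shows "right_shift x \<in> lp_space p \<and> lp_norm p (right_shift x) \<le> C \<longleftrightarrow>
         x \<in> lp_space p \<and> lp_norm p x \<le> C"
proof (cases "p = \<infinity>")
  case True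
  have "(\<forall>k. norm (right_shift x k) \<le> C) \<longleftrightarrow> (\<forall>k. norm (x k) \<le> C)"
    using C by (metis norm_zero not0_implies_Suc right_shift_simps)
  then show ?thesis unfolding True lp_norm_le_iff_infinity .
next
  case False
  define q where "q = enn2real p"
  have s: "(\<Sum>k<Suc N. norm (right_shift x k) powr q) = (\<Sum>k<N. norm (x k) powr q)" for N
    by (simp add: sum.lessThan_Suc_shift del: sum.lessThan_Suc)
  have "(\<forall>N. (\<Sum>k<N. norm (right_shift x k) powr q) \<le> C powr q) \<longleftrightarrow>
        (\<forall>N. (\<Sum>k<N. norm (x k) powr q) \<le> C powr q)"
  proof (intro iffI allI)
    fix N assume "\<forall>N. (\<Sum>k<N. norm (right_shift x k) powr q) \<le> C powr q"
    then show "(\<Sum>k<N. norm (x k) powr q) \<le> C powr q" using s by metis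
  next
    fix N assume "\<forall>N. (\<Sum>k<N. norm (x k) powr q) \<le> C powr q"
    then show "(\<Sum>k<N. norm (right_shift x k) powr q) \<le> C powr q"
      by (cases N) (auto simp only: s lessThan_0 sum.empty powr_ge_zero)
  qed
  then show ?thesis unfolding lp_norm_le_iff_finite[OF p False C] q_def .
qed

lemma lp_right_shift:
  fixes x :: "('m::finite) cseq"
  assumes p: "1 \<le> p" and x: "x \<in> lp_space p"
  shows "right_shift x \<in> lp_space p" "lp_norm p (right_shift x) = lp_norm p x"
proof -
  have n: "0 \<le> lp_norm p x" by (rule lp_norm_nonneg[OF x])
  show 1: "right_shift x \<in> lp_space p"
    using lp_right_shift_bound_iff[OF p n, of x] x by simp
  have n': "0 \<le> lp_norm p (right_shift x)" by (rule lp_norm_nonneg[OF 1])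
  show "lp_norm p (right_shift x) = lp_norm p x"
    using lp_right_shift_bound_iff[OF p n, of x] lp_right_shift_bound_iff[OF p n', of x] x 1
    by (auto intro: antisym)
qed

lemma lp_finite_support:
  fixes x :: "('m::finite) cseq"
  assumes p: "1 \<le> p" and x: "\<And>k. N \<le> k \<Longrightarrow> x k = 0"
  shows "x \<in> lp_space p"
proof (cases "p = \<infinity>")
  case True
  have "x k \<in> insert 0 (x ` {..<N})" for k using x[of k] by (cases "k < N") auto
  then have "range x \<subseteq> insert 0 (x ` {..<N})" by blast
  then have "bounded (range x)"
    by (rule bounded_subset[rotated]) (simp add: finite_imp_bounded)
  then show ?thesis using True by (simp add: lp_space_def)
next
  case False
  have "summable (\<lambda>k. norm (x k) powr enn2real p)"
    by (rule summable_finite[of "{..<N}"]) (use x in auto)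
  then show ?thesis using False by (simp add: lp_space_def)
qed

section \<open>Bounded operators and uniform boundedness\<close>

lemma lp_zero [simp]:
  fixes p :: ennreal
  assumes "1 \<le> p"
  shows "(\<lambda>k. 0 :: complex ^ ('m::finite)) \<in> lp_space p" "lp_norm p (\<lambda>k. 0 :: complex ^ 'm) = 0"
proof -
  show 1: "(\<lambda>k. 0 :: complex ^ 'm) \<in> lp_space p" using assms by (rule lp_finite_support) simp
  show "lp_norm p (\<lambda>k. 0 :: complex ^ 'm) = 0"
    using lp_dominated(2)[OF assms 1, of 0 "\<lambda>k. 0"] lp_norm_nonneg[OF 1] by simp
qed

lemma norm_smult_vec: "norm (a *s (v :: complex ^ 'm::finite)) = norm a * norm v"
proof -
  have "norm (a *s v) = sqrt (\<Sum>i\<in>UNIV. (norm a * norm (v $ i))\<^sup>2)"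
    by (simp add: norm_vec_def L2_set_def norm_mult)
  also have "\<dots> = norm a * norm v"
    by (simp add: norm_vec_def L2_set_def power_mult_distrib sum_distrib_left[symmetric] real_sqrt_mult)
  finally show ?thesis .
qed

lemma lp_smult:
  fixes x :: "('m::finite) cseq"
  assumes p: "1 \<le> p" and x: "x \<in> lp_space p"
  shows "(\<lambda>k. a *s x k) \<in> lp_space p" "lp_norm p (\<lambda>k. a *s x k) = norm a * lp_norm p x"
proof -
  show 1: "(\<lambda>k. a *s x k) \<in> lp_space p"
    by (rule lp_dominated(1)[OF p x, of "norm a"]) (auto simp: norm_smult_vec)
  have le: "lp_norm p (\<lambda>k. a *s x k) \<le> norm a * lp_norm p x"
    by (rule lp_dominated(2)[OF p x]) (auto simp: norm_smult_vec)
  have "norm a * lp_norm p x \<le> lp_norm p (\<lambda>k. a *s x k)"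
  proof (cases "a = 0")
    case True
    then show ?thesis using lp_norm_nonneg[OF 1] by simp
  next
    case False
    have "lp_norm p x \<le> (1 / norm a) * lp_norm p (\<lambda>k. a *s x k)"
      by (rule lp_dominated(2)[OF p 1]) (use False in \<open>auto simp: norm_smult_vec\<close>)
    then show ?thesis using False by (simp add: field_simps)
  qed
  then show "lp_norm p (\<lambda>k. a *s x k) = norm a * lp_norm p x" using le by simp
qed

lemma scaleR_eq_smult: "c *\<^sub>R (v :: complex ^ 'm::finite) = complex_of_real c *s v"
  by (simp add: vec_eq_iff) (simp add: scaleR_conv_of_real)

lemma lp_scaleR:
  fixes x :: "('m::finite) cseq"
  assumes p: "1 \<le> p" and x: "x \<in> lp_space p"
  shows "(\<lambda>k. c *\<^sub>R x k) \<in> lp_space p" "lp_norm p (\<lambda>k. c *\<^sub>R x k) = \<bar>c\<bar> * lp_norm p x"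
  using lp_smult[OF p x, of "complex_of_real c"] by (simp_all add: scaleR_eq_smult)

lemma lp_diff:
  fixes x y :: "('m::finite) cseq"
  assumes p: "1 \<le> p" and x: "x \<in> lp_space p" and y: "y \<in> lp_space p"
  shows "(\<lambda>k. x k - y k) \<in> lp_space p"
    and "lp_norm p (\<lambda>k. x k - y k) \<le> lp_norm p x + lp_norm p y"
  using lp_add[OF p x lp_scaleR(1)[OF p y, of "-1"]] lp_scaleR(2)[OF p y, of "-1"] by simp_all

lemma lp_norm_diff_ge:
  fixes x y :: "('m::finite) cseq"
  assumes p: "1 \<le> p" and x: "x \<in> lp_space p" and y: "y \<in> lp_space p"
  shows "lp_norm p x - lp_norm p y \<le> lp_norm p (\<lambda>k. x k - y k)"
  using lp_add(2)[OF p lp_diff(1)[OF p x y] y] by simp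

lemma lp_norm_diff_commute:
  fixes x y :: "('m::finite) cseq"
  shows "lp_norm p (\<lambda>k. x k - y k) = lp_norm p (\<lambda>k. y k - x k)"
  by (simp add: lp_norm_def norm_minus_commute)

lemma lp_norm_uminus: "lp_norm p (\<lambda>k. - x k :: complex ^ 'm::finite) = lp_norm p x"
  by (simp add: lp_norm_def)

lemma lp_sum:
  fixes f :: "'i \<Rightarrow> ('m::finite) cseq"
  assumes p: "1 \<le> p" and "\<And>i. i \<in> I \<Longrightarrow> f i \<in> lp_space p"
  shows "(\<lambda>k. \<Sum>i\<in>I. f i k) \<in> lp_space p \<and> lp_norm p (\<lambda>k. \<Sum>i\<in>I. f i k) \<le> (\<Sum>i\<in>I. lp_norm p (f i))"
  using assms(2)
proof (induction I rule: infinite_finite_induct)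
  case (insert i I)
  then show ?case
    using lp_add[OF p, of "f i" "\<lambda>k. \<Sum>i\<in>I. f i k"] by (auto intro: order_trans)
qed (use p in auto)

lemma lp_bounded_operatorD:
  fixes B :: "('m::finite) cseq \<Rightarrow> 'm cseq"
  assumes "lp_bounded_operator p B"
  shows "x \<in> lp_space p \<Longrightarrow> B x \<in> lp_space p"
    and "\<lbrakk>x \<in> lp_space p; y \<in> lp_space p\<rbrakk> \<Longrightarrow> B (\<lambda>k. a *s x k + b *s y k) = (\<lambda>k. a *s B x k + b *s B y k)"
    and "\<exists>C\<ge>0. \<forall>x\<in>lp_space p. lp_norm p (B x) \<le> C * lp_norm p x"
proof -
  show "x \<in> lp_space p \<Longrightarrow> B x \<in> lp_space p"
    and "\<lbrakk>x \<in> lp_space p; y \<in> lp_space p\<rbrakk> \<Longrightarrow> B (\<lambda>k. a *s x k + b *s y k) = (\<lambda>k. a *s B x k + b *s B y k)"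
    using assms by (auto simp: lp_bounded_operator_def)
  obtain C where C: "\<forall>x\<in>lp_space p. lp_norm p (B x) \<le> C * lp_norm p x"
    using assms by (auto simp: lp_bounded_operator_def)
  have "lp_norm p (B x) \<le> max 0 C * lp_norm p x" if "x \<in> lp_space p" for x
    using C that lp_norm_nonneg[OF that] by (smt (verit) mult_right_mono)
  then show "\<exists>C\<ge>0. \<forall>x\<in>lp_space p. lp_norm p (B x) \<le> C * lp_norm p x"
    by (intro exI[of _ "max 0 C"]) auto
qed

lemma lp_operator_scaleR:
  fixes B :: "('m::finite) cseq \<Rightarrow> 'm cseq"
  assumes "lp_bounded_operator p B" "x \<in> lp_space p"
  shows "B (\<lambda>k. c *\<^sub>R x k) = (\<lambda>k. c *\<^sub>R B x k)"
  using lp_bounded_operatorD(2)[OF assms assms(2), of "complex_of_real c" 0] by (simp add: scaleR_eq_smult)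

lemma lp_operator_smult:
  fixes B :: "('m::finite) cseq \<Rightarrow> 'm cseq"
  assumes "lp_bounded_operator p B" "x \<in> lp_space p"
  shows "B (\<lambda>k. c *s x k) = (\<lambda>k. c *s B x k)"
  using lp_bounded_operatorD(2)[OF assms assms(2), of c 0] by simp

lemma lp_operator_add:
  fixes B :: "('m::finite) cseq \<Rightarrow> 'm cseq"
  assumes "lp_bounded_operator p B" "x \<in> lp_space p" "y \<in> lp_space p"
  shows "B (\<lambda>k. x k + y k) = (\<lambda>k. B x k + B y k)"
  using lp_bounded_operatorD(2)[OF assms, of 1 1] by simp

lemma lp_operator_diff:
  fixes B :: "('m::finite) cseq \<Rightarrow> 'm cseq"
  assumes "lp_bounded_operator p B" "x \<in> lp_space p" "y \<in> lp_space p"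
  shows "B (\<lambda>k. x k - y k) = (\<lambda>k. B x k - B y k)"
  using lp_bounded_operatorD(2)[OF assms, of 1 "-1"] by (simp add: vector_sneg_minus1[symmetric])

definition lp_opnorm :: "ennreal \<Rightarrow> (('m::finite) cseq \<Rightarrow> 'm cseq) \<Rightarrow> real" where
  "lp_opnorm p B = (SUP x\<in>{x \<in> lp_space p. lp_norm p x \<le> 1}. lp_norm p (B x))"

lemma lp_opnorm:
  fixes B :: "('m::finite) cseq \<Rightarrow> 'm cseq"
  assumes p: "1 \<le> p" and B: "lp_bounded_operator p B"
  shows "0 \<le> lp_opnorm p B"
    and "x \<in> lp_space p \<Longrightarrow> lp_norm p (B x) \<le> lp_opnorm p B * lp_norm p x"
    and "\<exists>x\<in>lp_space p. lp_norm p x \<le> 1 \<and> 3/4 * lp_opnorm p B \<le> lp_norm p (B x)"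
proof -
  let ?U = "{x :: 'm cseq. x \<in> lp_space p \<and> lp_norm p x \<le> 1}"
  obtain C where C: "0 \<le> C" "\<And>x. x \<in> lp_space p \<Longrightarrow> lp_norm p (B x) \<le> C * lp_norm p x"
    using lp_bounded_operatorD(3)[OF B] by blast
  have bdd: "bdd_above ((\<lambda>x. lp_norm p (B x)) ` ?U)"
  proof (rule bdd_aboveI2)
    fix x assume "x \<in> ?U"
    then show "lp_norm p (B x) \<le> C"
      using C mult_left_mono[of "lp_norm p x" 1 C] by (force intro: order_trans)
  qed
  have z: "(\<lambda>k. 0 :: complex ^ 'm) \<in> ?U" using p by simp
  have up: "lp_norm p (B x) \<le> lp_opnorm p B" if "x \<in> ?U" for x
    unfolding lp_opnorm_def by (rule cSUP_upper[OF that bdd])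
  show nn: "0 \<le> lp_opnorm p B"
    using up[OF z] lp_norm_nonneg[OF lp_bounded_operatorD(1)[OF B], of "\<lambda>k. 0"] p by simp
  show "lp_norm p (B x) \<le> lp_opnorm p B * lp_norm p x" if x: "x \<in> lp_space p"
  proof (cases "lp_norm p x = 0")
    case True
    then show ?thesis using C(2)[OF x] by simp
  next
    case False
    then have pos: "0 < lp_norm p x" using lp_norm_nonneg[OF x] by simp
    have "(\<lambda>k. (1 / lp_norm p x) *\<^sub>R x k) \<in> ?U"
      using lp_scaleR[OF p x, of "1 / lp_norm p x"] pos by simp
    from up[OF this] show ?thesis
      using pos by (simp add: lp_operator_scaleR[OF B x] lp_scaleR(2)[OF p lp_bounded_operatorD(1)[OF B x]] field_simps)
  qed
  show "\<exists>x\<in>lp_space p. lp_norm p x \<le> 1 \<and> 3/4 * lp_opnorm p B \<le> lp_norm p (B x)"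
  proof (cases "lp_opnorm p B = 0")
    case True
    then show ?thesis
      using lp_norm_nonneg[OF lp_bounded_operatorD(1)[OF B], of "\<lambda>k. 0"] p
      by (intro bexI[of _ "\<lambda>k. 0"]) auto
  next
    case False
    then have "3/4 * lp_opnorm p B < lp_opnorm p B" using nn by simp
    then have "\<exists>x\<in>?U. 3/4 * lp_opnorm p B < lp_norm p (B x)"
      unfolding lp_opnorm_def using less_cSUP_iff[OF _ bdd] z by blast
    then show ?thesis by force
  qed
qed

text \<open>
  A gliding hump argument in place of Baire's theorem. If the operator norms exceed \<open>4 ^ j\<close> along some
  \<open>n j\<close>, add up vectors of size \<open>(1/3) ^ j\<close> that almost attain these norms. Adding or subtracting
  the new vector, one of the two choices makes the image at least as large as the image of the new
  vector alone, because half the difference of the two images is that image. The remaining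
  tail has size \<open>(1/3) ^ j / 2\<close>, too small to undo this, so the images of the limit grow like \<open>(4/3) ^ j\<close>.
\<close>

lemma lp_uniform_boundedness:
  fixes L :: "nat \<Rightarrow> ('m::finite) cseq \<Rightarrow> 'm cseq"
  assumes p: "1 \<le> p" and L: "\<And>n. lp_bounded_operator p (L n)"
    and ptw: "\<And>x. x \<in> lp_space p \<Longrightarrow> \<exists>C. \<forall>\<^sub>F n in sequentially. lp_norm p (L n x) \<le> C"
  shows "\<exists>C\<ge>0. \<forall>n. \<forall>x\<in>lp_space p. lp_norm p (L n x) \<le> C * lp_norm p x"
proof (rule ccontr)
  assume contr: "\<not> ?thesis"
  have "\<exists>n. 4 ^ j < lp_opnorm p (L n)" for j :: nat
  proof (rule ccontr)
    assume "\<nexists>n. 4 ^ j < lp_opnorm p (L n)"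
    then have "lp_opnorm p (L n) \<le> 4 ^ j" for n by (auto simp: not_less)
    then have "lp_norm p (L n x) \<le> 4 ^ j * lp_norm p x" if "x \<in> lp_space p" for n x
      using lp_opnorm(2)[OF p L that, of n] lp_norm_nonneg[OF that] mult_right_mono order_trans by blast
    then show False using contr by (metis zero_le_numeral zero_le_power)
  qed
  then obtain n where n: "4 ^ j < lp_opnorm p (L (n j))" for j :: nat by metis
  have "\<exists>u. \<forall>j. u j \<in> lp_space p \<and> (u (Suc j) \<in> lp_space p \<and>
      lp_norm p (\<lambda>k. u (Suc j) k - u j k) \<le> (1/3) ^ j \<and>
      (1/3) ^ j * (3/4 * lp_opnorm p (L (n j))) \<le> lp_norm p (L (n j) (u (Suc j))))"
  proof (rule dependent_nat_choice)
    show "\<exists>x :: 'm cseq. x \<in> lp_space p" using lp_zero(1)[OF p] by blast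
    fix x :: "'m cseq" and j assume x: "x \<in> lp_space p"
    obtain y where y: "y \<in> lp_space p" "lp_norm p y \<le> 1"
      and yL: "3/4 * lp_opnorm p (L (n j)) \<le> lp_norm p (L (n j) y)"
      using lp_opnorm(3)[OF p L] by blast
    let ?c = "(1/3) ^ j :: real"
    let ?w = "\<lambda>k. ?c *\<^sub>R y k"
    have w: "?w \<in> lp_space p" "lp_norm p ?w \<le> ?c"
      using lp_scaleR[OF p y(1), of ?c] y(2) by (simp_all add: mult_left_le)
    let ?P = "\<lambda>k. x k + ?w k" and ?M = "\<lambda>k. x k - ?w k"
    have P: "?P \<in> lp_space p" and M: "?M \<in> lp_space p"
      using lp_add(1)[OF p x w(1)] lp_diff(1)[OF p x w(1)] by simp_all
    have LP: "L (n j) ?P \<in> lp_space p" and LM: "L (n j) ?M \<in> lp_space p"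
      using lp_bounded_operatorD(1)[OF L] P M by auto
    have Lw: "L (n j) ?w = (\<lambda>k. ?c *\<^sub>R L (n j) y k)" by (rule lp_operator_scaleR[OF L y(1)])
    have Ly: "L (n j) y \<in> lp_space p" by (rule lp_bounded_operatorD(1)[OF L y(1)])
    have "2 * (?c * lp_norm p (L (n j) y)) = lp_norm p (\<lambda>k. (2 * ?c) *\<^sub>R L (n j) y k)"
      by (simp add: lp_scaleR(2)[OF p Ly])
    also have "(\<lambda>k. (2 * ?c) *\<^sub>R L (n j) y k) = (\<lambda>k. L (n j) ?P k - L (n j) ?M k)"
      by (simp add: lp_operator_add[OF L x w(1)] lp_operator_diff[OF L x w(1)] Lw
          scaleR_add_left[symmetric])
    also have "lp_norm p \<dots> \<le> lp_norm p (L (n j) ?P) + lp_norm p (L (n j) ?M)"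
      by (rule lp_diff(2)[OF p LP LM])
    finally have "?c * lp_norm p (L (n j) y) \<le> lp_norm p (L (n j) ?P) \<or>
        ?c * lp_norm p (L (n j) y) \<le> lp_norm p (L (n j) ?M)" by linarith
    moreover have "?c * (3/4 * lp_opnorm p (L (n j))) \<le> ?c * lp_norm p (L (n j) y)"
      using yL by (intro mult_left_mono) auto
    moreover have "lp_norm p (\<lambda>k. ?P k - x k) \<le> ?c" "lp_norm p (\<lambda>k. ?M k - x k) \<le> ?c"
      using w(2) by (simp_all add: lp_norm_uminus)
    ultimately show "\<exists>y. y \<in> lp_space p \<and> (y \<in> lp_space p \<and>
      lp_norm p (\<lambda>k. y k - x k) \<le> (1/3) ^ j \<and>
      (1/3) ^ j * (3/4 * lp_opnorm p (L (n j))) \<le> lp_norm p (L (n j) y))"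
      using P M by (meson order_trans)
  qed
  then obtain u where u: "\<And>j. u j \<in> lp_space p"
    and step: "\<And>j. lp_norm p (\<lambda>k. u (Suc j) k - u j k) \<le> (1/3) ^ j"
    and big: "\<And>j. (1/3) ^ j * (3/4 * lp_opnorm p (L (n j))) \<le> lp_norm p (L (n j) (u (Suc j)))"
    by blast
  have dist: "lp_norm p (\<lambda>k. u (j + i) k - u j k) \<le> 3/2 * (1/3) ^ j" for i j
  proof -
    have "(\<lambda>k. u (j + i) k - u j k) = (\<lambda>k. \<Sum>l<i. u (Suc (j + l)) k - u (j + l) k)"
      by (induction i) (auto simp: fun_eq_iff algebra_simps)
    then have "lp_norm p (\<lambda>k. u (j + i) k - u j k) \<le> (\<Sum>l<i. lp_norm p (\<lambda>k. u (Suc (j + l)) k - u (j + l) k))"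
      using lp_sum[OF p, of "{..<i}" "\<lambda>l k. u (Suc (j + l)) k - u (j + l) k"] lp_diff(1)[OF p u u] by simp
    also have "\<dots> \<le> (\<Sum>l<i. (1/3) ^ j * (1/3) ^ l)"
      by (intro sum_mono order_trans[OF step]) (simp add: power_add)
    also have "\<dots> = (1/3) ^ j * (\<Sum>l<i. (1/3) ^ l)" by (simp add: sum_distrib_left)
    also have "(\<Sum>l<i. (1/3 :: real) ^ l) \<le> 3/2"
      by (subst sum_gp_strict) (simp add: field_simps)
    finally show ?thesis by (simp add: mult.commute mult_left_mono)
  qed
  have inc: "summable (\<lambda>j. u (Suc j) k - u j k)" for k
  proof (rule summable_comparison_test'[where N = 0])
    show "summable (\<lambda>j. (1/3 :: real) ^ j)" by (simp add: summable_geometric)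
    show "norm (u (Suc j) k - u j k) \<le> (1/3) ^ j" for j
      using norm_le_lp_norm[OF p lp_diff(1)[OF p u[of "Suc j"] u[of j]], of k] step[of j] by linarith
  qed
  have "\<exists>l. (\<lambda>j. u j k) \<longlonglongrightarrow> l" for k
  proof -
    have "convergent (\<lambda>N. u N k - u 0 k)"
      using summable_LIMSEQ[OF inc[of k]]
      unfolding sum_lessThan_telescope[of "\<lambda>j. u j k"] by (rule convergentI)
    from convergent_add[OF this convergent_const[of "u 0 k"]] show ?thesis
      by (simp add: convergent_def)
  qed
  then obtain v where v: "\<And>k. (\<lambda>j. u j k) \<longlonglongrightarrow> v k" by metis
  have vu: "(\<lambda>k. v k - u j k) \<in> lp_space p" "lp_norm p (\<lambda>k. v k - u j k) \<le> 3/2 * (1/3) ^ j" for j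
  proof -
    have "(\<lambda>i. u (j + i) k - u j k) \<longlonglongrightarrow> v k - u j k" for k
      using LIMSEQ_ignore_initial_segment[OF v, of j k] by (intro tendsto_diff) (simp_all add: add.commute)
    moreover have "\<forall>\<^sub>F i in sequentially. (\<lambda>k. u (j + i) k - u j k) \<in> lp_space p
        \<and> lp_norm p (\<lambda>k. u (j + i) k - u j k) \<le> 3/2 * (1/3) ^ j"
      using dist lp_diff(1)[OF p u u] by simp
    ultimately show "(\<lambda>k. v k - u j k) \<in> lp_space p" "lp_norm p (\<lambda>k. v k - u j k) \<le> 3/2 * (1/3) ^ j"
      using lp_Fatou[OF p, of "\<lambda>i k. u (j + i) k - u j k" "3/2 * (1/3) ^ j" "\<lambda>k. v k - u j k"] by blast+
  qed
  have vl: "v \<in> lp_space p"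
    using lp_add(1)[OF p vu(1)[of 0] u[of 0]] by simp
  have large: "(4/3) ^ j / 4 \<le> lp_norm p (L (n j) v)" for j
  proof -
    let ?N = "lp_opnorm p (L (n j))"
    have Lv: "L (n j) v \<in> lp_space p" and Lu: "L (n j) (u (Suc j)) \<in> lp_space p"
      using lp_bounded_operatorD(1)[OF L] vl u by auto
    have "lp_norm p (\<lambda>k. L (n j) v k - L (n j) (u (Suc j)) k) \<le> ?N * lp_norm p (\<lambda>k. v k - u (Suc j) k)"
      using lp_opnorm(2)[OF p L vu(1)] by (simp add: lp_operator_diff[OF L vl u])
    also have "\<dots> \<le> ?N * (3/2 * (1/3) ^ Suc j)"
      by (rule mult_left_mono[OF vu(2) lp_opnorm(1)[OF p L]])
    finally have "lp_norm p (L (n j) (u (Suc j))) - lp_norm p (L (n j) v) \<le> ?N * (3/2 * (1/3) ^ Suc j)"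
      using lp_norm_diff_ge[OF p Lu Lv] by (simp add: lp_norm_diff_commute)
    then have "?N * (1/3) ^ j / 4 \<le> lp_norm p (L (n j) v)"
      using big[of j] by (simp add: algebra_simps)
    moreover have "4 ^ j * (1/3) ^ j / 4 \<le> ?N * (1/3) ^ j / (4::real)"
      using n[of j] by (intro divide_right_mono mult_right_mono) auto
    ultimately show ?thesis by (simp add: power_divide)
  qed
  obtain C0 N where C0: "\<And>m. N \<le> m \<Longrightarrow> lp_norm p (L m v) \<le> C0"
    using ptw[OF vl] by (auto simp: eventually_sequentially)
  define C where "C = \<bar>C0\<bar> + (\<Sum>m<N. lp_norm p (L m v))"
  have nn: "0 \<le> lp_norm p (L m v)" for m
    by (rule lp_norm_nonneg[OF lp_bounded_operatorD(1)[OF L vl]])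
  have C: "lp_norm p (L m v) \<le> C" for m
  proof (cases "m < N")
    case True
    then have "lp_norm p (L m v) \<le> (\<Sum>m<N. lp_norm p (L m v))"
      using nn by (intro member_le_sum) auto
    then show ?thesis by (simp add: C_def)
  next
    case False
    moreover have "0 \<le> (\<Sum>m<N. lp_norm p (L m v))" by (intro sum_nonneg nn)
    ultimately show ?thesis using C0[of m] by (simp add: C_def)
  qed
  obtain j where "4 * C < (4/3 :: real) ^ j" using real_arch_pow[of "4/3" "4 * C"] by auto
  then show False using large[of j] C[of "n j"] by simp
qed

section \<open>Resolvents and powers of a matrix\<close>

lemma bounded_linear_matrix: "bounded_linear ((*v) (M :: complex ^ 'm ^ ('m::finite)))"
  unfolding linear_conv_bounded_linear[symmetric]
  by (rule linearI)
    (simp_all add: matrix_vector_right_distrib scaleR_eq_smult vector_scalar_commute)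

lemma matrix_norm_bound:
  fixes M :: "complex ^ 'm ^ ('m::finite)"
  obtains K where "0 < K" "\<And>v. norm (M *v v) \<le> K * norm v"
proof -
  show ?thesis
    using that bounded_linear.pos_bounded[OF bounded_linear_matrix] by (metis mult.commute)
qed

lemma mat_minus_mult_vec:
  fixes A :: "complex ^ 'm ^ ('m::finite)"
  shows "(mat z - A) *v v = z *s v - A *v v"
proof -
  have "mat z *v v = z *s v"
    by (simp add: vec_eq_iff matrix_vector_mult_def mat_def if_distrib if_distribR cong: if_cong)
  then show ?thesis by (simp add: matrix_vector_mult_diff_rdistrib)
qed

lemma matrix_inv_mult:
  assumes "invertible A"
  shows "A ** matrix_inv A = mat 1" "matrix_inv A ** A = mat 1"
  using someI_ex[of "\<lambda>B. A ** B = mat 1 \<and> B ** A = mat 1"] assms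
  by (auto simp: invertible_def matrix_inv_def)

lemma resolvent_eq:
  fixes A :: "complex ^ 'm ^ ('m::finite)"
  assumes "z \<in> resolvent_set A"
  shows "z *s (resolvent z A *v b) - A *v (resolvent z A *v b) = b"
proof -
  have "(mat z - A) ** resolvent z A = mat 1"
    using assms by (simp add: resolvent_set_def resolvent_def matrix_inv_mult)
  then have "(mat z - A) *v (resolvent z A *v b) = b"
    by (simp add: matrix_vector_mul_assoc)
  then show ?thesis by (simp add: mat_minus_mult_vec)
qed

lemma resolvent_set_kernel:
  fixes A :: "complex ^ 'm ^ ('m::finite)"
  shows "z \<in> resolvent_set A \<longleftrightarrow> (\<forall>v. z *s v - A *v v = 0 \<longrightarrow> v = 0)"
  using matrix_left_invertible_ker[of "mat z - A"]
  by (simp add: resolvent_set_def invertible_left_inverse mat_minus_mult_vec)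

lemma resolvent_set_char_poly: "z \<in> resolvent_set A \<longleftrightarrow> char_poly_fun A z \<noteq> 0"
  for A :: "complex ^ 'm ^ ('m::finite)"
  by (simp add: resolvent_set_def char_poly_fun_def invertible_det_nz)

lemma holomorphic_on_det:
  fixes M :: "complex \<Rightarrow> complex ^ 'm ^ ('m::finite)"
  assumes "\<And>i j. (\<lambda>z. M z $ i $ j) holomorphic_on S"
  shows "(\<lambda>z. det (M z)) holomorphic_on S"
  unfolding det_def by (intro holomorphic_intros assms)

lemma holomorphic_char_poly_fun: "char_poly_fun A holomorphic_on S"
  for A :: "complex ^ 'm ^ ('m::finite)"
proof -
  have "(\<lambda>z. (mat z - A) $ i $ j) holomorphic_on S" for i j
    by (cases "i = j") (auto simp: mat_def intro!: holomorphic_intros)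
  then have "(\<lambda>z. det (mat z - A)) holomorphic_on S" by (rule holomorphic_on_det)
  then show ?thesis by (simp add: char_poly_fun_def[abs_def])
qed

text \<open>
  The value at \<open>x = 0\<close> is excluded because the series arise from expansions in \<open>1 / \<lambda>\<close> at infinity.
\<close>

lemma power_series_zero_unique:
  fixes c :: "nat \<Rightarrow> complex"
  assumes r: "0 < r" and s: "\<And>x. \<lbrakk>norm x < r; x \<noteq> 0\<rbrakk> \<Longrightarrow> (\<lambda>n. c n * x ^ Suc n) sums 0"
  shows "c n = 0"
proof (rule ccontr)
  assume "c n \<noteq> 0"
  define d where "d n = (case n of 0 \<Rightarrow> 0 | Suc m \<Rightarrow> c m)" for n
  have sm: "(\<lambda>n. d n * x ^ n) sums 0" if "norm x < r" for x
  proof (cases "x = 0")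
    case True
    then show ?thesis by (simp add: d_def)
  next
    case False
    then show ?thesis
      using s[OF that] sums_Suc_iff[of "\<lambda>n. d n * x ^ n" 0] by (simp add: d_def)
  qed
  have sm': "\<And>x. norm (x - 0) < r \<Longrightarrow> (\<lambda>n. d n * (x - 0) ^ n) sums 0" using sm by simp
  have "d (Suc n) \<noteq> 0" using \<open>c n \<noteq> 0\<close> by (simp add: d_def)
  show False
  proof (rule powser_0_nonzero[of r 0 d "\<lambda>_. 0", OF r sm' refl \<open>d (Suc n) \<noteq> 0\<close> zero_less_Suc])
    fix s :: real assume s: "0 < s" "\<And>z::complex. z \<in> cball 0 s - {0} \<Longrightarrow> (0::complex) \<noteq> 0"
    from s(2)[of "of_real s"] s(1) show False by simp
  qed
qed

lemma matrix_funpow_add: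
  fixes E :: "complex ^ 'm ^ ('m::finite)"
  shows
  "((*v) E ^^ n) (v + w) = ((*v) E ^^ n) v + ((*v) E ^^ n) (w :: complex ^ 'm::finite)"
  by (induction n) (simp_all add: matrix_vector_right_distrib)

lemma matrix_funpow_smult:
  fixes E :: "complex ^ 'm ^ ('m::finite)"
  shows
  "((*v) E ^^ n) (c *s v) = c *s ((*v) E ^^ n) (v :: complex ^ 'm::finite)"
  by (induction n) (simp_all add: vector_scalar_commute)

lemma matrix_vector_mult_sum:
  fixes M :: "complex ^ 'm ^ ('m::finite)"
  shows "M *v (\<Sum>i\<in>I. f i) = (\<Sum>i\<in>I. M *v f i)"
  by (induction I rule: infinite_finite_induct) (simp_all add: matrix_vector_right_distrib)

lemma matrix_funpow_sum:
  fixes E :: "complex ^ 'm ^ ('m::finite)"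
  shows
  "((*v) E ^^ n) (\<Sum>i\<in>I. f i) = (\<Sum>i\<in>I. ((*v) E ^^ n) (f i :: complex ^ 'm::finite))"
  by (induction n) (simp_all add: matrix_vector_mult_sum)

text \<open>
  Substituting the fixed point equation into itself \<open>N\<close> times leaves the remainder
  \<open>\<mu> ^ N\<close> times the \<open>N\<close>-th power applied to \<open>u\<close>, which tends to \<open>0\<close>.
\<close>

lemma neumann_sums:
  fixes E :: "complex ^ 'm ^ ('m::finite)"
  assumes K: "\<And>v. norm (E *v v) \<le> K * norm v" "0 < K" "norm \<mu> * K < 1"
    and u: "u = b + \<mu> *s (E *v u)"
  shows "(\<lambda>n. \<mu> ^ n *s ((*v) E ^^ n) b) sums u"
proof -
  have partial: "(\<Sum>n<N. \<mu> ^ n *s ((*v) E ^^ n) b) = u - \<mu> ^ N *s ((*v) E ^^ N) u" for N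
  proof (induction N)
    case (Suc N)
    have "((*v) E ^^ N) u = ((*v) E ^^ N) (b + \<mu> *s (E *v u))" using u by simp
    also have "\<dots> = ((*v) E ^^ N) b + \<mu> *s ((*v) E ^^ Suc N) u"
      by (simp add: matrix_funpow_add matrix_funpow_smult funpow_swap1)
    finally have "\<mu> ^ N *s ((*v) E ^^ N) u
        = \<mu> ^ N *s (((*v) E ^^ N) b + \<mu> *s ((*v) E ^^ Suc N) u)" by (rule arg_cong)
    then show ?case
      using Suc by (simp add: vector_add_ldistrib vector_smult_assoc algebra_simps del: funpow.simps)
  qed simp
  have pow: "norm (((*v) E ^^ N) u) \<le> K ^ N * norm u" for N
  proof (induction N)
    case (Suc N)
    have "norm (((*v) E ^^ Suc N) u) \<le> K * norm (((*v) E ^^ N) u)" using K(1) by simp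
    also have "\<dots> \<le> K * (K ^ N * norm u)" using Suc K(2) by (intro mult_left_mono) auto
    finally show ?case by (simp add: mult.assoc)
  qed simp
  have "(\<lambda>N. \<mu> ^ N *s ((*v) E ^^ N) u) \<longlonglongrightarrow> 0"
  proof (rule Lim_null_comparison)
    show "\<forall>\<^sub>F N in sequentially. norm (\<mu> ^ N *s ((*v) E ^^ N) u) \<le> (norm \<mu> * K) ^ N * norm u"
      using mult_left_mono[OF pow, of "norm \<mu> ^ N" for N]
      by (simp add: norm_smult_vec norm_power power_mult_distrib mult.assoc)
    show "(\<lambda>N. (norm \<mu> * K) ^ N * norm u) \<longlonglongrightarrow> 0"
      using K by (intro tendsto_mult_left_zero LIMSEQ_power_zero) auto
  qed
  then have "(\<lambda>N. u - \<mu> ^ N *s ((*v) E ^^ N) u) \<longlonglongrightarrow> u - 0" by (intro tendsto_intros)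
  then show ?thesis by (simp add: sums_def partial)
qed

lemma sums_vec_nth: "f sums s \<Longrightarrow> (\<lambda>n. f n $ i) sums (s $ i)" for f :: "nat \<Rightarrow> complex ^ 'm::finite"
  unfolding sums_def by (drule tendsto_vec_nth[where i = i]) simp

lemma norm_le_sum_vec_nth: "norm v \<le> (\<Sum>k\<in>UNIV. norm (v $ k))" for v :: "complex ^ 'm::finite"
  by (simp add: norm_vec_def L2_set_le_sum)

text \<open>
  The hypothesis says that \<open>E\<close> has no eigenvalue of modulus at least \<open>1\<close>. Then \<open>1 - \<mu> E\<close> is invertible
  for \<open>\<mu>\<close> in the closed unit disc, hence by compactness in a larger disc. By Cramer's rule its inverse is
  holomorphic there, so the power series of the inverse, whose coefficients are the powers of \<open>E\<close>,
  has radius of convergence greater than \<open>1\<close>.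
\<close>

lemma matrix_powers_summable:
  fixes E :: "complex ^ 'm ^ ('m::finite)"
  assumes ker: "\<And>\<mu> v. \<lbrakk>norm \<mu> \<le> 1; v = \<mu> *s (E *v v)\<rbrakk> \<Longrightarrow> v = 0"
  shows "\<exists>c. (\<forall>n. 0 \<le> c n) \<and> summable c \<and> (\<forall>n v. norm (((*v) E ^^ n) v) \<le> c n * norm v)"
proof -
  define F where "F \<mu> = mat 1 - (\<chi> i j. \<mu> * E $ i $ j)" for \<mu>
  have F: "F \<mu> *v u = u - \<mu> *s (E *v u)" for \<mu> u
  proof -
    have "(\<chi> i j. \<mu> * E $ i $ j) *v u = \<mu> *s (E *v u)"
      by (simp add: vec_eq_iff matrix_vector_mult_def sum_distrib_left mult.assoc)
    then show ?thesis by (simp add: F_def matrix_vector_mult_diff_rdistrib)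
  qed
  have holF: "(\<lambda>\<mu>. F \<mu> $ i $ j) holomorphic_on S" for i j S
    by (cases "i = j") (auto simp: F_def mat_def intro!: holomorphic_intros)
  then have hol_det: "(\<lambda>\<mu>. det (F \<mu>)) holomorphic_on S" for S by (intro holomorphic_on_det)
  have "det (F \<mu>) \<noteq> 0" if "norm \<mu> \<le> 1" for \<mu>
  proof -
    have "\<exists>G. G ** F \<mu> = mat 1"
      unfolding matrix_left_invertible_ker using ker[OF that] by (simp add: F)
    then show ?thesis by (simp add: invertible_left_inverse invertible_det_nz[symmetric])
  qed
  then have sub: "cball 0 1 \<subseteq> {\<mu>. det (F \<mu>) \<noteq> 0}" by auto
  have "open {\<mu>. det (F \<mu>) \<noteq> 0}"
    using holomorphic_on_imp_continuous_on[OF hol_det[of UNIV]]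
    by (intro open_Collect_neq) auto
  then obtain e where e: "0 < e" "(\<Union>x\<in>cball 0 1. ball x e) \<subseteq> {\<mu>. det (F \<mu>) \<noteq> 0}"
    using compact_subset_open_imp_ball_epsilon_subset[OF compact_cball _ sub] by auto
  have detR: "det (F \<mu>) \<noteq> 0" if "\<mu> \<in> ball 0 (1 + e)" for \<mu>
  proof (cases "norm \<mu> \<le> 1")
    case True
    then show ?thesis using sub by auto
  next
    case False
    have "dist (sgn \<mu>) \<mu> < e"
    proof -
      have "sgn \<mu> - \<mu> = (1 / norm \<mu> - 1) *\<^sub>R \<mu>"
        by (simp add: sgn_div_norm algebra_simps divide_inverse)
      then have d: "dist (sgn \<mu>) \<mu> = \<bar>1 / norm \<mu> - 1\<bar> * norm \<mu>" by (simp add: dist_norm)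
      have norming: "\<bar>1 / r - 1\<bar> * r = r - 1" if "1 < r" for r :: real
        using that by (simp add: abs_of_neg divide_less_eq left_diff_distrib)
      have "\<bar>1 / norm \<mu> - 1\<bar> * norm \<mu> = norm \<mu> - 1"
        by (rule norming) (use False in linarith)
      then show ?thesis using d that by simp
    qed
    moreover have "sgn \<mu> \<in> cball 0 1" by (simp add: norm_sgn)
    ultimately have "\<mu> \<in> (\<Union>x\<in>cball 0 1. ball x e)" by (intro UN_I[of "sgn \<mu>"]) auto
    then show ?thesis using subsetD[OF e(2)] by simp
  qed
  obtain K where K: "0 < K" "\<And>v. norm (E *v v) \<le> K * norm v" using matrix_norm_bound[of E] by blast
  have sm: "summable (\<lambda>n. norm (((*v) E ^^ n) b $ k))" for b k
  proof -
    \<comment> \<open>the \<open>k\<close>-th entry of the solution \<open>u\<close> of \<open>(1 - \<mu> E) u = b\<close>\<close>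
    define h where "h \<mu> = det (\<chi> i j. if j = k then b $ i else F \<mu> $ i $ j) / det (F \<mu>)" for \<mu>
    have "(\<lambda>\<mu>. (\<chi> i j. if j = k then b $ i else F \<mu> $ i $ j) $ i $ j) holomorphic_on S" for i j S
      using holF by (cases "j = k") auto
    then have hol: "h holomorphic_on ball 0 (1 + e)"
      unfolding h_def[abs_def] using detR
      by (intro holomorphic_on_divide holomorphic_on_det hol_det) auto
    define c where "c n = (deriv ^^ n) h 0 / fact n" for n
    have c: "(\<lambda>n. c n * w ^ n) sums h w" if "w \<in> ball 0 (1 + e)" for w
      using holomorphic_power_series[OF hol that] by (simp add: c_def)
    have "((*v) E ^^ n) b $ k - c n = 0" for n
    proof (rule power_series_zero_unique)
      show "0 < min 1 (1 / K)" using K by simp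
      fix \<mu> :: complex assume \<mu>: "norm \<mu> < min 1 (1 / K)" "\<mu> \<noteq> 0"
      then have d: "det (F \<mu>) \<noteq> 0" using detR[of \<mu>] e(1) by simp
      define u where "u = (\<chi> k. det (\<chi> i j. if j = k then b $ i else F \<mu> $ i $ j) / det (F \<mu>))"
      have "F \<mu> *v u = b" using cramer[OF d, of u b] by (simp add: u_def)
      then have "u = b + \<mu> *s (E *v u)" by (simp add: F algebra_simps)
      then have "(\<lambda>n. \<mu> ^ n *s ((*v) E ^^ n) b) sums u"
        using K \<mu> by (intro neumann_sums[of E K]) (auto simp: field_simps)
      then have "(\<lambda>n. \<mu> ^ n * ((*v) E ^^ n) b $ k) sums h \<mu>"
        using sums_vec_nth[of _ u k] by (fastforce simp: u_def h_def)
      from sums_diff[OF this c[of \<mu>]] \<mu>(1) e(1)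
      have "(\<lambda>n. \<mu> * (\<mu> ^ n * ((*v) E ^^ n) b $ k - c n * \<mu> ^ n)) sums (\<mu> * 0)"
        by (intro sums_mult) auto
      then show "(\<lambda>n. (((*v) E ^^ n) b $ k - c n) * \<mu> ^ Suc n) sums 0"
        by (simp add: algebra_simps)
    qed
    then have ceq: "((*v) E ^^ n) b $ k = c n" for n by simp
    have "summable (\<lambda>n. c n * of_real (1 + e/2) ^ n)"
      using c[of "of_real (1 + e/2)"] e(1) by (intro sums_summable) (auto simp del: of_real_add)
    from powser_insidea[OF this, of 1] e(1) show ?thesis by (simp add: ceq del: of_real_add)
  qed
  define c where "c n = (\<Sum>i\<in>UNIV. \<Sum>k\<in>UNIV. norm (((*v) E ^^ n) (axis i 1) $ k))" for n
  have "norm (((*v) E ^^ n) v) \<le> c n * norm v" for n v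
  proof -
    have "((*v) E ^^ n) v = (\<Sum>i\<in>UNIV. v $ i *s ((*v) E ^^ n) (axis i 1))"
      by (subst basis_expansion[symmetric]) (simp only: matrix_funpow_sum matrix_funpow_smult)
    also have "norm \<dots> \<le> (\<Sum>i\<in>UNIV. norm v * (\<Sum>k\<in>UNIV. norm (((*v) E ^^ n) (axis i 1) $ k)))"
      by (intro order_trans[OF norm_sum] sum_mono)
        (auto simp: norm_smult_vec intro!: mult_mono Finite_Cartesian_Product.norm_nth_le norm_le_sum_vec_nth)
    also have "\<dots> = c n * norm v" by (simp add: c_def sum_distrib_left mult.commute)
    finally show ?thesis .
  qed
  moreover have "summable c" unfolding c_def[abs_def] by (intro summable_sum sm)
  moreover have "0 \<le> c n" for n by (simp add: c_def sum_nonneg)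
  ultimately show ?thesis by blast
qed

section \<open>Power boundedness of the Euler step\<close>

lemma system_operator_eq:
  "system_operator E F x k = E *v x k + F *v right_shift x k" for E :: "complex ^ 'm ^ ('m::finite)"
  by (cases k) (simp_all add: system_operator_def)

lemma right_shift_matrix: "M *v right_shift x k = right_shift (\<lambda>k. M *v x k) k" for M :: "complex ^ 'm ^ ('m::finite)"
  by (cases k) simp_all

lemma lp_matrix:
  fixes x :: "('m::finite) cseq" and M :: "complex ^ 'm ^ 'm"
  assumes p: "1 \<le> p" and x: "x \<in> lp_space p"
  shows "(\<lambda>k. M *v x k) \<in> lp_space p"
proof -
  obtain K where "0 < K" "\<And>v. norm (M *v v) \<le> K * norm v" using matrix_norm_bound[of M] by blast
  then show ?thesis by (intro lp_dominated(1)[OF p x, of K]) auto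
qed

lemma lp_bounded_operator_system:
  fixes E F :: "complex ^ 'm ^ ('m::finite)"
  assumes p: "1 \<le> p"
  shows "lp_bounded_operator p (system_operator E F)"
proof -
  obtain K L where K: "0 < K" "\<And>v. norm (E *v v) \<le> K * norm v"
    and L: "0 < L" "\<And>v. norm (F *v v) \<le> L * norm v"
    using matrix_norm_bound[of E] matrix_norm_bound[of F] by metis
  have bd: "system_operator E F x \<in> lp_space p \<and> lp_norm p (system_operator E F x) \<le> (K + L) * lp_norm p x"
    if x: "x \<in> lp_space p" for x
  proof -
    note S = lp_right_shift[OF p x]
    have "lp_norm p (\<lambda>k. E *v x k) \<le> K * lp_norm p x"
      by (rule lp_dominated(2)[OF p x]) (use K in auto)
    moreover have "lp_norm p (\<lambda>k. F *v right_shift x k) \<le> L * lp_norm p x"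
      unfolding S(2)[symmetric] by (rule lp_dominated(2)[OF p S(1)]) (use L in auto)
    ultimately show ?thesis
      using lp_add[OF p lp_matrix[OF p x, of E] lp_matrix[OF p S(1), of F]]
      by (auto simp: system_operator_eq[abs_def] algebra_simps)
  qed
  have "system_operator E F (\<lambda>k. a *s x k + b *s y k) =
      (\<lambda>k. a *s system_operator E F x k + b *s system_operator E F y k)" for x y a b
  proof
    fix k show "system_operator E F (\<lambda>k. a *s x k + b *s y k) k =
        a *s system_operator E F x k + b *s system_operator E F y k"
      by (cases k) (simp_all add: system_operator_eq matrix_vector_right_distrib vector_scalar_commute
          vector_add_ldistrib)
  qed
  then show ?thesis using bd unfolding lp_bounded_operator_def by blast
qed

lemma lp_funpow:
  fixes B :: "('m::finite) cseq \<Rightarrow> 'm cseq"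
  assumes "lp_bounded_operator p B" "x \<in> lp_space p"
  shows "(B ^^ n) x \<in> lp_space p"
  by (induction n) (use assms lp_bounded_operatorD(1) in auto)

text \<open>
  Variation of constants in discrete time, with the coupling to the left neighbour as inhomogeneity.
\<close>

lemma system_operator_power:
  fixes E F :: "complex ^ 'm ^ ('m::finite)"
  shows "(system_operator E F ^^ n) x k =
    ((*v) E ^^ n) (x k) + (\<Sum>i<n. ((*v) E ^^ (n - 1 - i)) (F *v right_shift ((system_operator E F ^^ i) x) k))"
proof (induction n)
  case (Suc n)
  have "E *v (\<Sum>i<n. ((*v) E ^^ (n - 1 - i)) (F *v right_shift ((system_operator E F ^^ i) x) k))
      = (\<Sum>i<n. ((*v) E ^^ (n - i)) (F *v right_shift ((system_operator E F ^^ i) x) k))"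
    unfolding matrix_vector_mult_sum
  proof (intro sum.cong refl)
    fix i assume "i \<in> {..<n}"
    then have "n - i = Suc (n - 1 - i)" by auto
    then show "E *v ((*v) E ^^ (n - 1 - i)) (F *v right_shift ((system_operator E F ^^ i) x) k)
      = ((*v) E ^^ (n - i)) (F *v right_shift ((system_operator E F ^^ i) x) k)" by simp
  qed
  moreover have "(system_operator E F ^^ Suc n) x k
      = E *v (system_operator E F ^^ n) x k + F *v right_shift ((system_operator E F ^^ n) x) k"
    by (simp add: system_operator_eq[of E F "(system_operator E F ^^ n) x" k])
  moreover have "((*v) E ^^ Suc n) (x k) = E *v ((*v) E ^^ n) (x k)" by simp
  ultimately show ?case by (simp add: Suc matrix_vector_right_distrib del: funpow.simps)
qed simp

lemma sum_convolution_le: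
  fixes a e :: "nat \<Rightarrow> real"
  assumes a: "\<And>n. 0 \<le> a n" "summable a" "suminf a \<le> C" and e: "\<And>i. i < n \<Longrightarrow> e i \<le> M" and M: "0 \<le> M"
  shows "(\<Sum>i<n. a (n - 1 - i) * e i) \<le> C * M"
proof -
  have "(\<Sum>i<n. a (n - 1 - i) * e i) \<le> (\<Sum>i<n. a (n - 1 - i) * M)"
    using a e by (intro sum_mono mult_left_mono) auto
  also have "\<dots> = (\<Sum>i<n. a i) * M"
    using sum.nat_diff_reindex[of a n] by (simp flip: sum_distrib_right)
  also have "\<dots> \<le> C * M"
    using sum_le_suminf[OF a(2), of "{..<n}"] a M by (intro mult_right_mono) auto
  finally show ?thesis .
qed

text \<open>
  Apply \<open>F\<close> to the discrete variation of constants formula. By the identity for \<open>F E\<^sup>n F\<close>, the sequences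
  \<open>y n = F (B\<^sup>n x)\<close> satisfy the renewal inequality
  \<open>\<parallel>y n\<parallel> \<le> \<parallel>F E\<^sup>n x\<parallel> + \<Sum>i<n. a (n - 1 - i) \<parallel>y i\<parallel>\<close>, the shift being an isometry. As the weights have total mass
  at most \<open>1\<close>, the norms \<open>\<parallel>y n\<parallel>\<close> never exceed the sum of the inhomogeneities, which is finite. Inserting
  this bound into the formula once more and using the summability of \<open>\<parallel>E\<^sup>n\<parallel>\<close> bounds \<open>B\<^sup>n x\<close>.
\<close>

lemma system_operator_power_bounded:
  fixes E F :: "complex ^ 'm ^ ('m::finite)" and a :: "nat \<Rightarrow> real"
  assumes p: "1 \<le> p"
    and c: "\<And>n. 0 \<le> c n" "summable c" "\<And>n v. norm (((*v) E ^^ n) v) \<le> c n * norm v"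
    and a: "\<And>n. 0 \<le> a n" "summable a" "suminf a \<le> 1"
    and FEF: "\<And>n v. F *v (((*v) E ^^ n) (F *v v)) = a n *\<^sub>R (F *v v)"
  shows "\<exists>C\<ge>0. \<forall>n. \<forall>x\<in>lp_space p. lp_norm p ((system_operator E F ^^ n) x) \<le> C * lp_norm p x"
proof -
  obtain L where L: "0 < L" "\<And>v. norm (F *v v) \<le> L * norm v" using matrix_norm_bound[of F] by blast
  let ?B = "system_operator E F"
  define S where "S = suminf c"
  have S: "0 \<le> S" "(\<Sum>i<n. c i) \<le> S" "c n \<le> S" for n
    using c sum_le_suminf[OF c(2), of "{..<n}"] sum_le_suminf[OF c(2), of "{n}"] suminf_nonneg[OF c(2)]
    by (auto simp: S_def)
  have "lp_norm p ((?B ^^ n) x) \<le> (S + S * (L * S)) * lp_norm p x" if x: "x \<in> lp_space p" for n x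
  proof -
    let ?N = "lp_norm p x"
    have N: "0 \<le> ?N" by (rule lp_norm_nonneg[OF x])
    have Bx: "(?B ^^ i) x \<in> lp_space p" for i
      by (rule lp_funpow[OF lp_bounded_operator_system[OF p] x])
    define y where "y i = (\<lambda>k. F *v (?B ^^ i) x k)" for i
    have y: "y i \<in> lp_space p" for i unfolding y_def by (rule lp_matrix[OF p Bx])
    have Fy: "F *v right_shift ((?B ^^ i) x) k = right_shift (y i) k" for i k
      by (simp only: y_def right_shift_matrix)
    note Sy = lp_right_shift[OF p y]
    have y_bound: "lp_norm p (y n) \<le> (\<Sum>i\<le>n. L * c i * ?N)" for n
    proof (induction n rule: less_induct)
      case (less n)
      let ?g = "\<lambda>k. F *v ((*v) E ^^ n) (x k)"
      let ?h = "\<lambda>k. \<Sum>i<n. a (n - 1 - i) *\<^sub>R right_shift (y i) k"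
      have g: "norm (?g k) \<le> L * c n * norm (x k)" for k
        using order_trans[OF L(2) mult_left_mono[OF c(3)]] L(1) by (simp add: mult.assoc)
      have Lc: "0 \<le> L * c n" using L(1) c(1) by simp
      have "y n k = ?g k + ?h k" for k
      proof -
        have "y n k = F *v (((*v) E ^^ n) (x k)
            + (\<Sum>i<n. ((*v) E ^^ (n - 1 - i)) (F *v right_shift ((?B ^^ i) x) k)))"
          by (simp only: y_def system_operator_power)
        also have "\<dots> = ?g k + (\<Sum>i<n. a (n - 1 - i) *\<^sub>R (F *v right_shift ((?B ^^ i) x) k))"
          by (simp only: matrix_vector_right_distrib matrix_vector_mult_sum FEF)
        finally show ?thesis by (simp only: Fy)
      qed
      then have yn: "y n = (\<lambda>k. ?g k + ?h k)" by blast
      moreover have g': "lp_norm p ?g \<le> L * c n * ?N" "?g \<in> lp_space p"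
        using lp_dominated[OF p x Lc g] by auto
      moreover have h': "?h \<in> lp_space p \<and> lp_norm p ?h \<le> (\<Sum>i<n. a (n - 1 - i) * lp_norm p (y i))"
        using lp_sum[OF p, of "{..<n}" "\<lambda>i k. a (n - 1 - i) *\<^sub>R right_shift (y i) k"]
          lp_scaleR[OF p Sy(1)] Sy(2) a(1) by simp
      moreover have "(\<Sum>i<n. a (n - 1 - i) * lp_norm p (y i)) \<le> 1 * (\<Sum>i<n. L * c i * ?N)"
      proof (rule sum_convolution_le[OF a])
        fix i assume "i < n"
        then have "lp_norm p (y i) \<le> (\<Sum>i\<le>i. L * c i * ?N)" by (rule less)
        also have "\<dots> \<le> (\<Sum>i<n. L * c i * ?N)"
          using \<open>i < n\<close> L(1) c(1) N by (intro sum_mono2) auto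
        finally show "lp_norm p (y i) \<le> (\<Sum>i<n. L * c i * ?N)" .
      qed (use L(1) c(1) N in \<open>auto intro!: sum_nonneg\<close>)
      moreover have "lp_norm p (\<lambda>k. ?g k + ?h k) \<le> lp_norm p ?g + lp_norm p ?h"
        using g'(2) h' by (intro lp_add(2)[OF p]) auto
      ultimately have "lp_norm p (y n) \<le> L * c n * ?N + (\<Sum>i<n. L * c i * ?N)"
        unfolding yn by linarith
      then show ?case by (simp add: lessThan_Suc_atMost[symmetric])
    qed
    have y_bound': "lp_norm p (y n) \<le> L * S * ?N" for n
    proof -
      have "lp_norm p (y n) \<le> L * (\<Sum>i<Suc n. c i) * ?N"
        using y_bound[of n] by (simp add: sum_distrib_left sum_distrib_right lessThan_Suc_atMost[symmetric] distrib_left distrib_right)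
      also have "\<dots> \<le> L * S * ?N"
        by (intro mult_right_mono mult_left_mono S(2) N) (use L(1) in simp)
      finally show ?thesis .
    qed
    let ?g = "\<lambda>k. ((*v) E ^^ n) (x k)"
    let ?f = "\<lambda>i k. ((*v) E ^^ (n - 1 - i)) (right_shift (y i) k)"
    let ?h = "\<lambda>k. \<Sum>i<n. ?f i k"
    have Bn: "(?B ^^ n) x = (\<lambda>k. ?g k + ?h k)"
      by (rule ext) (simp only: system_operator_power[of n] Fy)
    have g: "?g \<in> lp_space p" "lp_norm p ?g \<le> S * ?N"
      by (rule lp_dominated(1)[OF p x c(1) c(3)])
        (rule order_trans[OF lp_dominated(2)[OF p x c(1) c(3)] mult_right_mono[OF S(3) N]])
    have f: "?f i \<in> lp_space p" "lp_norm p (?f i) \<le> c (n - 1 - i) * lp_norm p (y i)" for i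
      using lp_dominated[OF p Sy(1)[of i] c(1)[of "n - 1 - i"], of "?f i"] c(3) unfolding Sy(2) by simp_all
    have "(\<Sum>i<n. lp_norm p (?f i)) \<le> (\<Sum>i<n. c (n - 1 - i) * lp_norm p (y i))"
      by (intro sum_mono f(2))
    then have h: "?h \<in> lp_space p \<and> lp_norm p ?h \<le> (\<Sum>i<n. c (n - 1 - i) * lp_norm p (y i))"
      using lp_sum[OF p, of "{..<n}" ?f] f(1) by (meson order_trans)
    have "(\<Sum>i<n. c (n - 1 - i) * lp_norm p (y i)) \<le> S * (L * S * ?N)"
      by (rule sum_convolution_le[OF c(1,2)]) (use y_bound' S(1) L(1) N in \<open>simp_all add: S_def[symmetric]\<close>)
    moreover have "lp_norm p (\<lambda>k. ?g k + ?h k) \<le> lp_norm p ?g + lp_norm p ?h"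
      using g(1) h by (intro lp_add(2)[OF p]) auto
    ultimately have "lp_norm p ((?B ^^ n) x) \<le> S * ?N + S * (L * S * ?N)"
      unfolding Bn using g(2) h by linarith
    then show ?thesis by (simp add: algebra_simps)
  qed
  moreover have "0 \<le> S + S * (L * S)" using S(1) L(1) by auto
  ultimately show ?thesis by blast
qed

text \<open>
  The data of the problem that do not involve the exponent \<open>p\<close>, with \<open>\<epsilon>\<close> and \<open>a\<close> witnessing total monotonicity.
\<close>

locale monotone_system =
  fixes A0 A1 :: "complex ^ 'm ^ ('m::finite)" and \<phi> :: "complex \<Rightarrow> complex"
    and \<epsilon> :: real and a :: "nat \<Rightarrow> real"
  assumes A1_nonzero: "A1 \<noteq> 0"
    and characteristic:
      "\<And>z. z \<in> resolvent_set A0 \<Longrightarrow> A1 ** resolvent z A0 ** A1 = (\<chi> i j. \<phi> z * A1 $ i $ j)"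
    and zero_resolvent: "0 \<in> resolvent_set A0"
    and eps: "0 < \<epsilon>"
    and a_nonneg: "\<And>n. 0 \<le> a n"
    and a_summable: "summable a"
    and series: "\<And>z. 1 \<le> norm z \<Longrightarrow>
      (\<lambda>n. of_real (a n) / z ^ (n + 1)) sums \<phi> ((z - 1) / of_real \<epsilon>)"
    and quotient: "\<And>z. z \<in> resolvent_set A0 \<Longrightarrow> \<phi> z = char_poly_fun A0 0 / char_poly_fun A0 z"
begin

lemma phi_zero: "\<phi> 0 = 1"
  using quotient[OF zero_resolvent] zero_resolvent[unfolded resolvent_set_char_poly] by simp

text \<open>
  Evaluate the series at \<open>1\<close>, where it represents \<open>\<phi> 0 = 1\<close>.
\<close>

lemma a_sums: "a sums 1"
proof -
  have "(\<lambda>n. complex_of_real (a n)) sums of_real 1"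
    using series[of 1] phi_zero by simp
  then show ?thesis by (simp only: sums_of_real_iff)
qed

lemma phi_series: "1 \<le> norm (1 + of_real \<epsilon> * z) \<Longrightarrow> (\<lambda>n. of_real (a n) / (1 + of_real \<epsilon> * z) ^ (n + 1)) sums \<phi> z"
  using series[of "1 + of_real \<epsilon> * z"] eps by simp

lemma norm_phi_le_1:
  assumes "1 \<le> norm (1 + of_real \<epsilon> * z)"
  shows "norm (\<phi> z) \<le> 1"
proof -
  note s = phi_series[OF assms]
  have le: "norm (complex_of_real (a n) / (1 + of_real \<epsilon> * z) ^ (n + 1)) \<le> a n" for n
  proof -
    have "norm (complex_of_real (a n) / (1 + of_real \<epsilon> * z) ^ (n + 1)) = a n / norm (1 + of_real \<epsilon> * z) ^ (n + 1)"
      using a_nonneg by (simp add: norm_divide norm_power norm_mult)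
    also have "\<dots> \<le> a n / 1"
      using one_le_power[OF assms, of "n + 1"] by (intro divide_left_mono a_nonneg) linarith+
    finally show ?thesis by simp
  qed
  have "norm (\<Sum>n. complex_of_real (a n) / (1 + of_real \<epsilon> * z) ^ (n + 1)) \<le> suminf a"
    by (rule norm_suminf_le[OF le a_summable])
  then show ?thesis using s a_sums by (simp add: sums_iff)
qed

text \<open>
  The function \<open>\<phi>\<close> is bounded by \<open>1\<close> outside the disc, but equals \<open>p\<^sub>0(0) / p\<^sub>0\<close> off the spectrum and so
  would blow up on approaching an eigenvalue. Eigenvalues outside or on the boundary of the disc are
  approached radially from the outside, which keeps the approximating points in the region of the bound.
\<close>

lemma resolvent_set_outside_disc:
  assumes "1 \<le> norm (1 + of_real \<epsilon> * z0)"
  shows "z0 \<in> resolvent_set A0"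
proof (rule ccontr)
  let ?f = "char_poly_fun A0"
  assume "z0 \<notin> resolvent_set A0"
  then have f0: "?f z0 = 0" by (simp add: resolvent_set_char_poly)
  have f00: "?f 0 \<noteq> 0" using zero_resolvent by (simp add: resolvent_set_char_poly)
  obtain r where r: "0 < r" "\<And>z. z \<in> ball z0 r - {z0} \<Longrightarrow> ?f z \<noteq> 0"
    using isolated_zeros[OF holomorphic_char_poly_fun[of A0 UNIV] open_UNIV connected_UNIV UNIV_I f0 UNIV_I f00]
    by auto
  define g where "g t = z0 + of_real t * ((1 + of_real \<epsilon> * z0) / of_real \<epsilon>)" for t :: real
  have lim: "(g \<longlongrightarrow> g 0) (at_right 0)"
    unfolding g_def[abs_def] by (intro tendsto_intros)
  have "\<forall>\<^sub>F t in at_right 0. dist (g t) z0 < r"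
    using tendstoD[OF lim r(1)] by (simp add: g_def)
  moreover have "\<forall>\<^sub>F t in at_right 0. 0 < (t::real)" by (simp add: eventually_at_right_less)
  ultimately have "\<forall>\<^sub>F t in at_right 0. norm (?f 0) \<le> norm (?f (g t))"
  proof eventually_elim
    case (elim t)
    have nz: "1 + of_real \<epsilon> * z0 \<noteq> 0" using assms by auto
    then have "g t \<noteq> z0" using elim eps by (simp add: g_def)
    then have ft: "?f (g t) \<noteq> 0" using r(2)[of "g t"] elim by (simp add: dist_commute)
    have "1 + of_real \<epsilon> * g t = of_real (1 + t) * (1 + of_real \<epsilon> * z0)"
      using eps by (simp add: g_def field_simps)
    then have "norm (1 + of_real \<epsilon> * g t) = (1 + t) * norm (1 + of_real \<epsilon> * z0)"
      using elim by (simp add: norm_mult del: of_real_add)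
    then have "1 \<le> norm (1 + of_real \<epsilon> * g t)"
      using elim assms mult_mono[of 1 "1 + t" 1 "norm (1 + of_real \<epsilon> * z0)"] by simp
    from norm_phi_le_1[OF this] show ?case
      using quotient[of "g t"] ft by (simp add: resolvent_set_char_poly norm_divide)
  qed
  moreover have "((\<lambda>t. norm (?f (g t))) \<longlongrightarrow> norm (?f z0)) (at_right 0)"
  proof -
    have "isCont ?f (g 0)"
      using holomorphic_on_imp_continuous_on[OF holomorphic_char_poly_fun[of A0 UNIV]]
      by (simp add: continuous_on_eq_continuous_at)
    from isCont_tendsto_compose[OF this lim] show ?thesis
      by (simp add: g_def tendsto_norm)
  qed
  ultimately have "norm (?f 0) \<le> norm (?f z0)"
    by (intro tendsto_lowerbound[where F = "at_right (0::real)"]) auto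
  then show False using f0 f00 by simp
qed

lemma characteristic_vec:
  assumes "z \<in> resolvent_set A0"
  shows "A1 *v (resolvent z A0 *v (A1 *v v)) = \<phi> z *s (A1 *v v)"
proof -
  have "A1 *v (resolvent z A0 *v (A1 *v v)) = (A1 ** resolvent z A0 ** A1) *v v"
    by (simp add: matrix_vector_mul_assoc matrix_mul_assoc)
  also have "\<dots> = \<phi> z *s (A1 *v v)"
    unfolding characteristic[OF assms]
    by (simp add: vec_eq_iff matrix_vector_mult_def sum_distrib_left mult.assoc)
  finally show ?thesis .
qed

text \<open>
  \<open>B\<close> is the explicit Euler step \<open>1 + \<epsilon> A\<close> of the system. It has the same bidiagonal form as
  \<open>A\<close>, with \<open>E\<close> on the diagonal and \<open>F\<close> below it. The substitution \<open>\<lambda> = 1 + \<epsilon> z\<close> in the definition of total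
  monotonicity is the one that turns resolvents of \<open>A0\<close> into resolvents of \<open>E\<close>.
\<close>

definition "E = mat 1 + (\<chi> i j. of_real \<epsilon> * A0 $ i $ j)"
definition "F = (\<chi> i j. of_real \<epsilon> * A1 $ i $ j)"
definition "B = system_operator E F"

lemma E_mult: "E *v v = v + \<epsilon> *\<^sub>R (A0 *v v)"
proof -
  have "(\<chi> i j. of_real \<epsilon> * A0 $ i $ j) *v v = \<epsilon> *\<^sub>R (A0 *v v)"
    by (simp add: scaleR_eq_smult vec_eq_iff matrix_vector_mult_def sum_distrib_left mult.assoc)
  then show ?thesis by (simp add: E_def matrix_vector_mult_add_rdistrib)
qed

lemma F_mult: "F *v v = \<epsilon> *\<^sub>R (A1 *v v)"
  by (simp add: F_def scaleR_eq_smult vec_eq_iff matrix_vector_mult_def sum_distrib_left mult.assoc)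

lemma B_eq: "B x k = x k + \<epsilon> *\<^sub>R system_operator A0 A1 x k"
  by (simp add: B_def system_operator_eq[of _ _ x k] E_mult F_mult scaleR_add_right)

lemma resolvent_set_inverse:
  assumes "norm \<mu> \<le> 1" "\<mu> \<noteq> 0"
  shows "(1 / \<mu> - 1) / of_real \<epsilon> \<in> resolvent_set A0"
  using assms eps by (intro resolvent_set_outside_disc) (simp add: norm_divide le_divide_eq)

lemma E_powers_summable:
  "\<exists>c. (\<forall>n. 0 \<le> c n) \<and> summable c \<and> (\<forall>n v. norm (((*v) E ^^ n) v) \<le> c n * norm v)"
proof (rule matrix_powers_summable)
  fix \<mu> and v :: "complex ^ 'm" assume \<mu>: "norm \<mu> \<le> 1" and v: "v = \<mu> *s (E *v v)"
  show "v = 0"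
  proof (cases "\<mu> = 0")
    case False
    have "v $ i = \<mu> * (v $ i + of_real \<epsilon> * (A0 *v v) $ i)" for i
      using arg_cong[OF v, of "\<lambda>w. w $ i"] by (simp add: E_mult scaleR_eq_smult distrib_left mult.assoc)
    then have "(1 / \<mu> - 1) / of_real \<epsilon> * v $ i = (A0 *v v) $ i" for i
      using False eps by (simp add: field_simps)
    then have "((1 / \<mu> - 1) / of_real \<epsilon>) *s v - A0 *v v = 0" by (simp add: vec_eq_iff)
    then show ?thesis
      using resolvent_set_inverse[OF \<mu> False] unfolding resolvent_set_kernel by blast
  qed (use v in simp)
qed

text \<open>
  Both sides are coefficients of the same expansion in \<open>\<mu> = 1 / \<lambda>\<close>: the left-hand sides come from
  \<open>A1 R(z, A0) A1\<close> through the Neumann series, the right-hand sides from the series of \<open>\<phi>(z)\<close>.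
  This is where nonnegativity of the coefficients of \<open>\<phi>\<close> becomes a property of the dynamics.
\<close>

lemma F_E_power_F: "F *v (((*v) E ^^ n) (F *v v)) = a n *\<^sub>R (F *v v)"
proof -
  define w where "w = A1 *v v"
  obtain K where K: "0 < K" "\<And>v. norm (E *v v) \<le> K * norm v" using matrix_norm_bound[of E] by blast
  have "of_real \<epsilon> * (A1 *v ((*v) E ^^ n) w) $ i - of_real (a n) * w $ i = 0" for n i
  proof (rule power_series_zero_unique)
    show "0 < min 1 (1 / K)" using K by simp
    fix \<mu> :: complex assume \<mu>: "norm \<mu> < min 1 (1 / K)" "\<mu> \<noteq> 0"
    define z where "z = (1 / \<mu> - 1) / of_real \<epsilon>"
    have z: "z \<in> resolvent_set A0" using resolvent_set_inverse[of \<mu>] \<mu> by (simp add: z_def)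
    have z\<mu>: "1 + of_real \<epsilon> * z = 1 / \<mu>" using eps by (simp add: z_def)
    define u where "u = resolvent z A0 *v w"
    have "z * u $ i - (A0 *v u) $ i = w $ i" for i
      using arg_cong[OF resolvent_eq[OF z, of w], of "\<lambda>v. v $ i"] by (simp add: u_def)
    then have A0u: "(A0 *v u) $ i = z * u $ i - w $ i" for i by (simp add: algebra_simps)
    have "\<mu> * (of_real \<epsilon> * z) = 1 - \<mu>" using \<mu>(2) eps by (simp add: z_def field_simps)
    then have \<mu>z: "\<mu> * (of_real \<epsilon> * (z * x)) = (1 - \<mu>) * x" for x by (metis mult.assoc)
    have alg: "x = m * e * w + m * (x + e * y)"
      if "y = z * x - w" "m * (e * (z * x)) = (1 - m) * x" for x y w m e z :: complex
      using that by algebra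
    have u_nth: "u $ i = \<mu> * of_real \<epsilon> * w $ i + \<mu> * (u $ i + of_real \<epsilon> * (A0 *v u) $ i)" for i
      by (rule alg[OF A0u \<mu>z])
    have "u = (\<mu> * of_real \<epsilon>) *s w + \<mu> *s (E *v u)"
      unfolding vec_eq_iff
      by (intro allI trans[OF u_nth]) (simp add: E_mult scaleR_eq_smult distrib_left mult.assoc)
    then have "(\<lambda>n. \<mu> ^ n *s ((*v) E ^^ n) ((\<mu> * of_real \<epsilon>) *s w)) sums u"
      using K \<mu> by (intro neumann_sums[of E K]) (auto simp: field_simps)
    from sums_vec_nth[OF bounded_linear.sums[OF bounded_linear_matrix this, of A1], of i]
    have "(\<lambda>n. \<mu> ^ n * (\<mu> * of_real \<epsilon> * (A1 *v ((*v) E ^^ n) w) $ i)) sums (\<phi> z * w $ i)"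
      using characteristic_vec[OF z, of v]
      by (simp add: u_def w_def vector_scalar_commute matrix_funpow_smult mult.assoc)
    moreover have "(\<lambda>n. of_real (a n) / (1 / \<mu>) ^ (n + 1) * w $ i) sums (\<phi> z * w $ i)"
      using phi_series[of z] \<mu> unfolding z\<mu> by (intro sums_mult2) (simp add: norm_divide le_divide_eq)
    ultimately have "(\<lambda>n. \<mu> ^ n * (\<mu> * of_real \<epsilon> * (A1 *v ((*v) E ^^ n) w) $ i)
        - of_real (a n) / (1 / \<mu>) ^ (n + 1) * w $ i) sums (\<phi> z * w $ i - \<phi> z * w $ i)"
      by (rule sums_diff)
    then show "(\<lambda>n. (of_real \<epsilon> * (A1 *v ((*v) E ^^ n) w) $ i - of_real (a n) * w $ i) * \<mu> ^ Suc n) sums 0"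
      using \<mu>(2) by (simp add: power_divide algebra_simps)
  qed
  then have "\<epsilon> *\<^sub>R (A1 *v ((*v) E ^^ n) w) = a n *\<^sub>R w"
    by (simp add: vec_eq_iff scaleR_eq_smult)
  then show ?thesis
    by (simp add: F_mult w_def scaleR_eq_smult matrix_funpow_smult vector_scalar_commute
        vector_smult_assoc mult.commute)
qed

lemma B_power_bounded:
  assumes "1 \<le> p"
  shows "\<exists>C\<ge>0. \<forall>n. \<forall>x\<in>lp_space p. lp_norm p ((B ^^ n) x) \<le> C * lp_norm p x"
proof -
  obtain c where "\<And>n. 0 \<le> c n" "summable c" "\<And>n v. norm (((*v) E ^^ n) v) \<le> c n * norm v"
    using E_powers_summable by blast
  then show ?thesis
    unfolding B_def using a_sums
    by (intro system_operator_power_bounded[of p c E a F] assms a_nonneg a_summable F_E_power_F)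
      (auto simp: sums_iff)
qed

end

section \<open>Poisson weights and Taylor series\<close>

lemma exp_coeff_Suc:
  fixes s :: real
  assumes "s \<noteq> 0"
  shows "s ^ Suc n / fact (Suc n) * (real (Suc n) / s) = s ^ n / fact n"
  using assms by (simp add: fact_Suc del: of_nat_Suc)

text \<open>
  The mean of the Poisson distribution with parameter \<open>s\<close>, multiplied by \<open>exp s / s\<close>.
\<close>

lemma exp_coeff_times_index_sums:
  fixes s :: real
  assumes "s \<noteq> 0"
  shows "(\<lambda>n. s ^ n / fact n * (real n / s)) sums exp s"
proof -
  have "(\<lambda>n. s ^ Suc n / fact (Suc n) * (real (Suc n) / s)) sums exp s"
    unfolding exp_coeff_Suc[OF assms] using exp_converges[of s] by (simp add: divide_inverse mult.commute)
  then show ?thesis by (subst (asm) sums_Suc_iff) simp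
qed

lemma poisson_variance_sums:
  fixes s :: real
  assumes "s \<noteq> 0"
  shows "(\<lambda>n. s ^ n / fact n * (real n / s - 1)\<^sup>2) sums (exp s / s)"
proof -
  have e: "(\<lambda>n. s ^ n / fact n) sums exp s"
    using exp_converges[of s] by (simp add: divide_inverse mult.commute)
  note q = exp_coeff_times_index_sums[OF assms]
  have "(\<lambda>n. s ^ n / fact n * (real n / s) + (s ^ n / fact n) / s) sums (exp s + exp s / s)"
    by (intro sums_add sums_divide q e)
  moreover have "s ^ n / fact n * (real n / s) + (s ^ n / fact n) / s
      = s ^ Suc n / fact (Suc n) * (real (Suc n) / s)\<^sup>2" for n
  proof -
    have "s ^ Suc n / fact (Suc n) * (real (Suc n) / s)\<^sup>2
        = (s ^ Suc n / fact (Suc n) * (real (Suc n) / s)) * (real (Suc n) / s)"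
      by (simp only: power2_eq_square mult.assoc)
    also have "\<dots> = s ^ n / fact n * (real n / s) + (s ^ n / fact n) / s"
      unfolding exp_coeff_Suc[OF assms] by (simp add: add_divide_distrib distrib_left)
    finally show ?thesis by simp
  qed
  ultimately have r: "(\<lambda>n. s ^ n / fact n * (real n / s)\<^sup>2) sums (exp s + exp s / s)"
    using sums_Suc_iff[of "\<lambda>n. s ^ n / fact n * (real n / s)\<^sup>2"] by simp
  have "(\<lambda>n. s ^ n / fact n * (real n / s)\<^sup>2 - 2 * (s ^ n / fact n * (real n / s)) + s ^ n / fact n)
      sums (exp s + exp s / s - 2 * exp s + exp s)"
    by (intro sums_add sums_diff sums_mult r q e)
  then show ?thesis by (simp add: power2_eq_square algebra_simps)
qed

text \<open>
  The standard deviation of a Poisson variable with mean \<open>s\<close> is \<open>sqrt s\<close>. This is the source of the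
  exponent \<open>1/2\<close>. Instead of the Cauchy-Schwarz inequality, \<open>\<bar>u\<bar>\<close> is estimated by a quadratic polynomial
  whose coefficients make its mean equal to the required bound.
\<close>

lemma poisson_abs_deviation_le:
  fixes s :: real
  assumes s: "0 < s"
  shows "(\<Sum>n<N. s ^ n / fact n * \<bar>real n / s - 1\<bar>) \<le> exp s / sqrt s"
proof -
  have am_gm: "\<bar>u\<bar> \<le> (sqrt s * u\<^sup>2 + 1 / sqrt s) / 2" for u
  proof -
    have "0 \<le> (sqrt s * \<bar>u\<bar> - 1)\<^sup>2" by simp
    then have "2 * sqrt s * \<bar>u\<bar> \<le> sqrt s * (sqrt s * u\<^sup>2) + 1"
      using s by (simp add: power2_diff power_mult_distrib flip: mult.assoc)
    then have "2 * sqrt s * \<bar>u\<bar> / sqrt s \<le> (sqrt s * (sqrt s * u\<^sup>2) + 1) / sqrt s"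
      using s by (intro divide_right_mono) auto
    then show ?thesis using s by (simp add: add_divide_distrib)
  qed
  have e: "(\<lambda>n. s ^ n / fact n) sums exp s"
    using exp_converges[of s] by (simp add: divide_inverse mult.commute)
  let ?f = "\<lambda>n. (sqrt s * (s ^ n / fact n * (real n / s - 1)\<^sup>2) + 1 / sqrt s * (s ^ n / fact n)) / 2"
  have f: "?f sums ((sqrt s * (exp s / s) + 1 / sqrt s * exp s) / 2)"
    by (intro sums_divide sums_add sums_mult e poisson_variance_sums) (use s in auto)
  have "(\<Sum>n<N. s ^ n / fact n * \<bar>real n / s - 1\<bar>) \<le> (\<Sum>n<N. ?f n)"
  proof (rule sum_mono)
    fix n
    have "s ^ n / fact n * \<bar>real n / s - 1\<bar>
        \<le> s ^ n / fact n * ((sqrt s * (real n / s - 1)\<^sup>2 + 1 / sqrt s) / 2)"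
      using s by (intro mult_left_mono am_gm) auto
    then show "s ^ n / fact n * \<bar>real n / s - 1\<bar> \<le> ?f n" by (simp add: algebra_simps)
  qed
  also have "\<dots> \<le> suminf ?f"
    using s by (intro sum_le_suminf sums_summable[OF f]) auto
  also have "\<dots> = (sqrt s * (exp s / s) + 1 / sqrt s * exp s) / 2" using f by (simp add: sums_iff)
  also have "sqrt s * (exp s / s) = exp s / sqrt s"
    using real_div_sqrt[of s] s by (metis divide_divide_eq_right less_imp_le mult.commute real_div_sqrt times_divide_eq_right)
  finally show ?thesis by simp
qed

text \<open>
  One bound for all derivatives makes the Taylor remainder \<open>O(s ^ n / fact n)\<close>.
\<close>

lemma taylor_sums_vector:
  fixes f :: "nat \<Rightarrow> real \<Rightarrow> 'a::banach"
  assumes s: "0 < s"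
    and deriv: "\<And>n r. r \<in> {0..s} \<Longrightarrow> (f n has_vector_derivative f (Suc n) r) (at r within {0..s})"
    and M: "\<And>n r. r \<in> {0..s} \<Longrightarrow> norm (f n r) \<le> M"
  shows "(\<lambda>n. (s ^ n / fact n) *\<^sub>R f n 0) sums f 0 s"
proof -
  have M0: "0 \<le> M" using M[of 0 0] s norm_ge_zero order_trans by (metis atLeastAtMost_iff less_imp_le order_refl)
  have rem: "norm (f 0 s - (\<Sum>i<Suc n. (s ^ i / fact i) *\<^sub>R f i 0)) \<le> s ^ n / fact n * M * s" for n
  proof -
    have "((\<lambda>x. ((s - x) ^ (Suc n - 1) / fact (Suc n - 1)) *\<^sub>R f (Suc n) x) has_integral
        f 0 s - (\<Sum>i<Suc n. ((s - 0) ^ i / fact i) *\<^sub>R f i 0)) {0..s}"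
      using s deriv by (intro Taylor_has_integral) auto
    then have "((\<lambda>x. ((s - x) ^ n / fact n) *\<^sub>R f (Suc n) x) has_integral
        f 0 s - (\<Sum>i<Suc n. (s ^ i / fact i) *\<^sub>R f i 0)) (cbox 0 s)"
      by simp
    then have "norm (f 0 s - (\<Sum>i<Suc n. (s ^ i / fact i) *\<^sub>R f i 0)) \<le> (s ^ n / fact n * M) * measure lborel (cbox 0 s)"
    proof (rule has_integral_bound[rotated])
      show "0 \<le> s ^ n / fact n * M" using s M0 by simp
      fix x assume x: "x \<in> cbox 0 s"
      then have "(s - x) ^ n / fact n \<le> s ^ n / fact n"
        by (intro divide_right_mono power_mono) auto
      then show "norm (((s - x) ^ n / fact n) *\<^sub>R f (Suc n) x) \<le> s ^ n / fact n * M"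
        using mult_mono[OF _ M[of x "Suc n"], of "(s - x) ^ n / fact n" "s ^ n / fact n"] x s
        by (simp add: abs_of_nonneg)
    qed
    then show ?thesis using s by simp
  qed
  have "(\<lambda>n. s ^ n / fact n * M * s) \<longlonglongrightarrow> 0 * M * s"
  proof (intro tendsto_intros)
    have "summable (\<lambda>n. s ^ n / fact n)"
      using summable_exp[of s] by (simp add: divide_inverse mult.commute)
    then show "(\<lambda>n. s ^ n / fact n) \<longlonglongrightarrow> 0" by (rule summable_LIMSEQ_zero)
  qed
  then have lim0: "(\<lambda>n. s ^ n / fact n * M * s) \<longlonglongrightarrow> 0" by simp
  have "(\<lambda>n. f 0 s - (\<Sum>i<Suc n. (s ^ i / fact i) *\<^sub>R f i 0)) \<longlonglongrightarrow> 0"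
    by (rule Lim_null_comparison[OF always_eventually lim0]) (use rem in blast)
  then have "(\<lambda>n. f 0 s - (f 0 s - (\<Sum>i<Suc n. (s ^ i / fact i) *\<^sub>R f i 0))) \<longlonglongrightarrow> f 0 s - 0"
    by (intro tendsto_diff tendsto_const)
  then have "(\<lambda>n. \<Sum>i<Suc n. (s ^ i / fact i) *\<^sub>R f i 0) \<longlonglongrightarrow> f 0 s"
    by (simp del: sum.lessThan_Suc)
  then show ?thesis unfolding sums_def by (rule LIMSEQ_imp_Suc)
qed

lemma lp_has_derivative_nth:
  fixes x :: "real \<Rightarrow> ('m::finite) cseq"
  assumes p: "1 \<le> p" and x: "\<And>t. 0 \<le> t \<Longrightarrow> x t \<in> lp_space p" and t: "0 \<le> t"
    and d: "lp_has_derivative p x v t"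
  shows "((\<lambda>s. x s k) has_vector_derivative v k) (at t within {0..})"
proof -
  have v: "v \<in> lp_space p"
    and lim: "((\<lambda>s. lp_norm p (\<lambda>k. (1 / (s - t)) *\<^sub>R (x s k - x t k) - v k)) \<longlongrightarrow> 0) (at t within {0..})"
    using d by (auto simp: lp_has_derivative_def)
  have le: "norm ((x s k - x t k) - (s - t) *\<^sub>R v k) / norm (s - t)
      \<le> lp_norm p (\<lambda>k. (1 / (s - t)) *\<^sub>R (x s k - x t k) - v k)" if "0 \<le> s" "s \<noteq> t" for s
  proof -
    have "(x s k - x t k) - (s - t) *\<^sub>R v k = (s - t) *\<^sub>R ((1 / (s - t)) *\<^sub>R (x s k - x t k) - v k)"
      using that by (simp add: scaleR_diff_right)
    then have "norm ((x s k - x t k) - (s - t) *\<^sub>R v k) / norm (s - t)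
        = norm ((1 / (s - t)) *\<^sub>R (x s k - x t k) - v k)" using that by simp
    also have "\<dots> \<le> lp_norm p (\<lambda>k. (1 / (s - t)) *\<^sub>R (x s k - x t k) - v k)"
      using lp_diff(1)[OF p x[of s] x[of t]] that t
      by (intro norm_le_lp_norm[OF p] lp_diff(1)[OF p _ v] lp_scaleR(1)[OF p]) auto
    finally show ?thesis .
  qed
  show ?thesis
    unfolding has_vector_derivative_def has_derivative_iff_norm
  proof
    show "bounded_linear (\<lambda>h. h *\<^sub>R v k)" by (rule bounded_linear_scaleR_left)
    show "((\<lambda>s. norm ((x s k - x t k) - (s - t) *\<^sub>R v k) / norm (s - t)) \<longlongrightarrow> 0) (at t within {0..})"
    proof (rule tendsto_sandwich[OF _ _ tendsto_const lim])
      show "\<forall>\<^sub>F s in at t within {0..}. 0 \<le> norm ((x s k - x t k) - (s - t) *\<^sub>R v k) / norm (s - t)"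
        by (simp add: always_eventually)
      show "\<forall>\<^sub>F s in at t within {0..}. norm ((x s k - x t k) - (s - t) *\<^sub>R v k) / norm (s - t)
          \<le> lp_norm p (\<lambda>k. (1 / (s - t)) *\<^sub>R (x s k - x t k) - v k)"
        using le by (auto simp: eventually_at_filter)
    qed
  qed
qed

section \<open>The semigroup as a Poisson average of Euler steps\<close>

lemma lp_bounded_operator_compose:
  fixes L M :: "('m::finite) cseq \<Rightarrow> 'm cseq"
  assumes L: "lp_bounded_operator p L" and M: "lp_bounded_operator p M"
  shows "lp_bounded_operator p (\<lambda>x. L (M x))"
proof -
  note L' = lp_bounded_operatorD[OF L] and M' = lp_bounded_operatorD[OF M]
  obtain C D where C: "0 \<le> C" "\<And>x. x \<in> lp_space p \<Longrightarrow> lp_norm p (L x) \<le> C * lp_norm p x"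
    and D: "0 \<le> D" "\<And>x. x \<in> lp_space p \<Longrightarrow> lp_norm p (M x) \<le> D * lp_norm p x"
    using L'(3) M'(3) by metis
  have "lp_norm p (L (M x)) \<le> (C * D) * lp_norm p x" if "x \<in> lp_space p" for x
    using order_trans[OF C(2)[OF M'(1)[OF that]] mult_left_mono[OF D(2)[OF that] C(1)]]
    by (simp add: mult.assoc)
  then show ?thesis
    using L'(1,2) M'(1,2) unfolding lp_bounded_operator_def by (auto intro!: exI[of _ "C * D"])
qed

lemma lp_bounded_operator_scaleR:
  fixes c :: real
  assumes p: "1 \<le> p"
  shows "lp_bounded_operator p (\<lambda>x k. c *\<^sub>R x k :: complex ^ 'm::finite)"
  unfolding lp_bounded_operator_def
  by (auto simp: lp_smult[OF p] scaleR_eq_smult vector_add_ldistrib vector_smult_assoc mult.commute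
      intro!: exI[of _ "\<bar>c\<bar>"])

lemma lp_bounded_operator_funpow:
  fixes B :: "('m::finite) cseq \<Rightarrow> 'm cseq"
  assumes B: "lp_bounded_operator p B"
  shows "lp_bounded_operator p (B ^^ n)"
proof (induction n)
  case 0
  then show ?case unfolding lp_bounded_operator_def by (auto intro: exI[of _ 1])
next
  case (Suc n)
  show ?case using lp_bounded_operator_compose[OF B Suc] by (simp add: o_def)
qed

locale monotone_semigroup = monotone_system A0 A1 \<phi> \<epsilon> a
  for A0 A1 :: "complex ^ 'm ^ ('m::finite)" and \<phi> \<epsilon> a +
  fixes p :: ennreal and T :: "real \<Rightarrow> 'm cseq \<Rightarrow> 'm cseq"
  assumes p: "1 \<le> p"
    and semigroup: "lp_C0_semigroup p T"
    and generator: "lp_generator p T = {(x, system_operator A0 A1 x) | x. x \<in> lp_space p}"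
begin

abbreviation "A \<equiv> system_operator A0 A1"

lemmas A_operator = lp_bounded_operator_system[OF p, of A0 A1]
lemmas A_space = lp_bounded_operatorD(1)[OF A_operator]

lemma B_operator: "lp_bounded_operator p B"
  unfolding B_def by (rule lp_bounded_operator_system[OF p])

lemmas B_space = lp_bounded_operatorD(1)[OF B_operator]
lemmas B_funpow_operator = lp_bounded_operator_funpow[OF B_operator]
lemmas B_funpow_space = lp_bounded_operatorD(1)[OF B_funpow_operator]

lemma T_operator: "0 \<le> t \<Longrightarrow> lp_bounded_operator p (T t)"
  and T_zero: "x \<in> lp_space p \<Longrightarrow> T 0 x = x"
  and T_add: "\<lbrakk>0 \<le> s; 0 \<le> t; x \<in> lp_space p\<rbrakk> \<Longrightarrow> T (s + t) x = T s (T t x)"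
  and T_continuous: "x \<in> lp_space p \<Longrightarrow> ((\<lambda>h. lp_norm p (\<lambda>k. T h x k - x k)) \<longlongrightarrow> 0) (at_right 0)"
  using semigroup by (auto simp: lp_C0_semigroup_def)

lemma T_space: "\<lbrakk>0 \<le> t; x \<in> lp_space p\<rbrakk> \<Longrightarrow> T t x \<in> lp_space p"
  using lp_bounded_operatorD(1)[OF T_operator] .

lemma T_generator:
  assumes "x \<in> lp_space p"
  shows "((\<lambda>h. lp_norm p (\<lambda>k. (1 / h) *\<^sub>R (T h x k - x k) - A x k)) \<longlongrightarrow> 0) (at_right 0)"
proof -
  have "(x, A x) \<in> lp_generator p T" using assms generator by blast
  then show ?thesis by (simp add: lp_generator_def)
qed

text \<open>
  Otherwise some sequence \<open>h n \<longlonglongrightarrow> 0\<close> would give operators of unbounded norm. Strong continuity at \<open>0\<close>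
  makes them pointwise bounded, which contradicts uniform boundedness.
\<close>

lemma T_bounded_near_zero: "\<exists>d>0. \<exists>K\<ge>0. \<forall>h\<in>{0..d}. \<forall>x\<in>lp_space p. lp_norm p (T h x) \<le> K * lp_norm p x"
proof (rule ccontr)
  assume contr: "\<not> ?thesis"
  have "\<exists>h\<in>{0..1 / real (Suc n)}. \<exists>x\<in>lp_space p. real n * lp_norm p x < lp_norm p (T h x)" for n
  proof (rule ccontr)
    assume "\<not> ?thesis"
    then have "\<forall>h\<in>{0..1 / real (Suc n)}. \<forall>x\<in>lp_space p. lp_norm p (T h x) \<le> real n * lp_norm p x"
      by (auto simp: not_less)
    moreover have "0 < 1 / real (Suc n)" by simp
    ultimately show False using contr of_nat_0_le_iff by blast
  qed
  then obtain h x where h: "\<And>n. h n \<in> {0..1 / real (Suc n)}" and x: "\<And>n. x n \<in> lp_space p"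
    and big: "\<And>n. real n * lp_norm p (x n) < lp_norm p (T (h n) (x n))"
    by metis
  have h0: "0 \<le> h n" for n using h[of n] by simp
  have hlim: "h \<longlonglongrightarrow> 0"
  proof (rule tendsto_sandwich[OF _ _ tendsto_const])
    show "(\<lambda>n. 1 / real (Suc n)) \<longlonglongrightarrow> 0" using LIMSEQ_inverse_real_of_nat by (simp add: inverse_eq_divide)
  qed (use h in auto)
  have "\<exists>C\<ge>0. \<forall>n. \<forall>x\<in>lp_space p. lp_norm p (T (h n) x) \<le> C * lp_norm p x"
  proof (rule lp_uniform_boundedness[OF p T_operator[OF h0]])
    fix y :: "'m cseq" assume y: "y \<in> lp_space p"
    obtain d where d: "0 < d" "\<And>t. \<lbrakk>0 < t; t < d\<rbrakk> \<Longrightarrow> lp_norm p (\<lambda>k. T t y k - y k) < 1"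
      using order_tendstoD(2)[OF T_continuous[OF y], of 1] by (auto simp: eventually_at_right_field)
    have le: "lp_norm p (T t y) \<le> 1 + lp_norm p y" if "0 \<le> t" "t < d" for t
    proof (cases "t = 0")
      case False
      then show ?thesis
        using d(2)[of t] that lp_norm_diff_ge[OF p T_space[OF that(1) y] y] by simp
    qed (simp add: T_zero[OF y])
    have "\<forall>\<^sub>F n in sequentially. h n < d" by (rule order_tendstoD(2)[OF hlim d(1)])
    then show "\<exists>C. \<forall>\<^sub>F n in sequentially. lp_norm p (T (h n) y) \<le> C"
      by (intro exI[of _ "1 + lp_norm p y"]) (erule eventually_mono, rule le[OF h0])
  qed
  then obtain C where C: "\<And>n x. x \<in> lp_space p \<Longrightarrow> lp_norm p (T (h n) x) \<le> C * lp_norm p x" by blast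
  obtain n where "C \<le> real n" using real_arch_simple by blast
  then have "lp_norm p (T (h n) (x n)) \<le> real n * lp_norm p (x n)"
    using C[OF x, of n n] mult_right_mono[OF _ lp_norm_nonneg[OF x]] by (meson order_trans)
  then show False using big[of n] by simp
qed

lemma T_locally_bounded: "\<exists>K\<ge>0. \<forall>t\<in>{0..b}. \<forall>x\<in>lp_space p. lp_norm p (T t x) \<le> K * lp_norm p x"
proof -
  obtain d K where d: "0 < d" and K: "0 \<le> K"
    "\<And>h x. \<lbrakk>h \<in> {0..d}; x \<in> lp_space p\<rbrakk> \<Longrightarrow> lp_norm p (T h x) \<le> K * lp_norm p x"
    using T_bounded_near_zero by blast
  have main: "\<exists>L\<ge>0. \<forall>t\<in>{0..real (Suc n) * d}. \<forall>x\<in>lp_space p. lp_norm p (T t x) \<le> L * lp_norm p x" for n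
  proof (induction n)
    case 0
    then show ?case using K by auto
  next
    case (Suc n)
    then obtain L where L: "0 \<le> L"
      "\<And>t x. \<lbrakk>t \<in> {0..real (Suc n) * d}; x \<in> lp_space p\<rbrakk> \<Longrightarrow> lp_norm p (T t x) \<le> L * lp_norm p x"
      by blast
    have "lp_norm p (T t x) \<le> (L + K * L) * lp_norm p x"
      if t: "t \<in> {0..real (Suc (Suc n)) * d}" and x: "x \<in> lp_space p" for t x
    proof (cases "t \<le> real (Suc n) * d")
      case True
      have "lp_norm p (T t x) \<le> L * lp_norm p x" using True t x by (intro L(2)) auto
      also have "\<dots> \<le> (L + K * L) * lp_norm p x"
        using K(1) L(1) lp_norm_nonneg[OF x] by (intro mult_right_mono) auto
      finally show ?thesis .
    next
      case False
      have "d \<le> real (Suc n) * d" using d by simp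
      then have "0 \<le> t - d" using False by linarith
      then have r: "t - d \<in> {0..real (Suc n) * d}" using t by (auto simp: algebra_simps)
      then have "T t x = T d (T (t - d) x)" using T_add[of d "t - d" x] d x by simp
      then have "lp_norm p (T t x) \<le> K * lp_norm p (T (t - d) x)"
        using K(2)[of d "T (t - d) x"] T_space[of "t - d" x] x r d by simp
      also have "\<dots> \<le> K * (L * lp_norm p x)" using L(2)[OF r x] K(1) by (intro mult_left_mono) auto
      also have "\<dots> \<le> (L + K * L) * lp_norm p x"
        using L(1) lp_norm_nonneg[OF x] by (simp add: algebra_simps)
      finally show ?thesis .
    qed
    moreover have "0 \<le> L + K * L" using K(1) L(1) by simp
    ultimately show ?case by blast
  qed
  obtain n where "b / d \<le> real n" using real_arch_simple by blast
  then have "b \<le> real n * d" using d by (simp add: divide_le_eq)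
  also have "\<dots> \<le> real (Suc n) * d" using d by simp
  finally have "{0..b} \<subseteq> {0..real (Suc n) * d}" by auto
  then show ?thesis using main[of n] by (meson subsetD)
qed

text \<open>
  The generator yields right derivatives only. For difference quotients from the left,
  factor \<open>T s\<close> out of \<open>T (s + h) - T s\<close>; what remains is the right difference quotient at \<open>0\<close> and
  a term \<open>T h (A x) - A x\<close>, and \<open>T s\<close> is uniformly bounded for \<open>s\<close> near \<open>t\<close>. Both cases are covered by one
  bound in terms of \<open>\<bar>s - t\<bar>\<close>.
\<close>

lemma T_has_derivative:
  assumes x: "x \<in> lp_space p" and t: "0 \<le> t"
  shows "lp_has_derivative p (\<lambda>s. T s x) (T t (A x)) t"
proof -
  define G where "G h = lp_norm p (\<lambda>k. (1 / h) *\<^sub>R (T h x k - x k) - A x k)" for h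
  define H where "H h = lp_norm p (\<lambda>k. T h (A x) k - A x k)" for h
  note Ax = A_space[OF x]
  obtain K where K: "0 \<le> K"
    "\<And>r y. \<lbrakk>r \<in> {0..t + 1}; y \<in> lp_space p\<rbrakk> \<Longrightarrow> lp_norm p (T r y) \<le> K * lp_norm p y"
    using T_locally_bounded[of "t + 1"] by blast
  let ?D = "\<lambda>s k. (1 / (s - t)) *\<^sub>R (T s x k - T t x k) - T t (A x) k"
  have gs: "(\<lambda>k. (1 / h) *\<^sub>R (T h x k - x k)) \<in> lp_space p"
    and gs': "(\<lambda>k. (1 / h) *\<^sub>R (T h x k - x k) - A x k) \<in> lp_space p" if "0 \<le> h" for h
    using that by (auto intro!: lp_diff(1)[OF p] lp_scaleR(1)[OF p] T_space x Ax)
  have Tg: "T r (\<lambda>k. (1 / h) *\<^sub>R (T h x k - x k) - A x k)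
      = (\<lambda>k. (1 / h) *\<^sub>R (T (r + h) x k - T r x k) - T r (A x) k)" if "0 \<le> r" "0 \<le> h" for r h
  proof -
    note op = T_operator[OF that(1)] and Th = T_space[OF that(2) x]
    have "T r (\<lambda>k. (1 / h) *\<^sub>R (T h x k - x k) - A x k)
        = (\<lambda>k. (1 / h) *\<^sub>R (T r (T h x) k - T r x k) - T r (A x) k)"
      by (simp only: lp_operator_diff[OF op gs[OF that(2)] Ax] lp_operator_diff[OF op Th x]
          lp_operator_scaleR[OF op lp_diff(1)[OF p Th x]])
    then show ?thesis using that x by (simp add: T_add)
  qed
  have bound: "lp_norm p (?D s) \<le> K * (G \<bar>s - t\<bar> + H \<bar>s - t\<bar>)" if s: "0 \<le> s" "s \<noteq> t" "\<bar>s - t\<bar> \<le> 1" for s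
  proof -
    define h where "h = \<bar>s - t\<bar>"
    have h: "0 < h" "h \<le> 1" using s by (auto simp: h_def)
    have H0: "0 \<le> H h" "0 \<le> G h"
      using h gs'[of h] by (auto simp: H_def G_def intro!: lp_norm_nonneg lp_diff(1)[OF p] T_space Ax)
    show ?thesis
    proof (cases "t < s")
      case True
      then have sh: "s = t + h" by (simp add: h_def)
      have "lp_norm p (?D s) = lp_norm p (T t (\<lambda>k. (1 / h) *\<^sub>R (T h x k - x k) - A x k))"
        using Tg[of t h] t h by (simp add: sh)
      also have "\<dots> \<le> K * G h" unfolding G_def using t h by (intro K(2) gs') auto
      also have "\<dots> \<le> K * (G h + H h)" using K(1) H0 by (intro mult_left_mono) auto
      finally show ?thesis by (simp add: h_def)
    next
      case False
      then have sh: "t = s + h" using s by (simp add: h_def)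
      have hs: "(\<lambda>k. T h (A x) k - A x k) \<in> lp_space p"
        using h by (intro lp_diff(1)[OF p] T_space Ax) auto
      have e: "T s (\<lambda>k. T h (A x) k - A x k) = (\<lambda>k. T t (A x) k - T s (A x) k)"
        using lp_operator_diff[OF T_operator[OF s(1)] T_space[OF _ Ax] Ax, of h] h s
        by (simp add: sh T_add Ax)
      have "?D s = (\<lambda>k. T s (\<lambda>k. (1 / h) *\<^sub>R (T h x k - x k) - A x k) k
          - T s (\<lambda>k. T h (A x) k - A x k) k)"
        unfolding e Tg[OF s(1) less_imp_le[OF h(1)]] using h(1) by (simp add: sh fun_eq_iff algebra_simps)
      then have "lp_norm p (?D s) \<le> lp_norm p (T s (\<lambda>k. (1 / h) *\<^sub>R (T h x k - x k) - A x k))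
          + lp_norm p (T s (\<lambda>k. T h (A x) k - A x k))"
        using lp_diff(2)[OF p T_space[OF s(1) gs'] T_space[OF s(1) hs], of h] h by simp
      also have "\<dots> \<le> K * G h + K * H h"
        unfolding G_def H_def using t h s sh by (intro add_mono K(2) gs' hs) auto
      finally show ?thesis by (simp add: h_def distrib_left)
    qed
  qed
  have "filterlim (\<lambda>s. \<bar>s - t\<bar>) (at_right 0) (at t within {0..})"
    unfolding filterlim_at
  proof
    show "\<forall>\<^sub>F s in at t within {0..}. \<bar>s - t\<bar> \<in> {0<..} \<and> \<bar>s - t\<bar> \<noteq> 0"
      by (auto simp: eventually_at_filter)
    have "((\<lambda>s. \<bar>s - t\<bar>) \<longlongrightarrow> \<bar>t - t\<bar>) (at t within {0..})" by (intro tendsto_intros)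
    then show "((\<lambda>s. \<bar>s - t\<bar>) \<longlongrightarrow> 0) (at t within {0..})" by simp
  qed
  moreover have "((\<lambda>h. K * (G h + H h)) \<longlongrightarrow> K * (0 + 0)) (at_right 0)"
    unfolding G_def H_def by (intro tendsto_intros T_generator T_continuous x Ax)
  ultimately have lim: "((\<lambda>s. K * (G \<bar>s - t\<bar> + H \<bar>s - t\<bar>)) \<longlongrightarrow> 0) (at t within {0..})"
    using filterlim_compose[of "\<lambda>h. K * (G h + H h)" "nhds 0" "at_right 0" "\<lambda>s. \<bar>s - t\<bar>"] by simp
  have "((\<lambda>s. lp_norm p (?D s)) \<longlongrightarrow> 0) (at t within {0..})"
  proof (rule tendsto_sandwich[OF _ _ tendsto_const lim])
    have Dsp: "?D s \<in> lp_space p" if "0 \<le> s" for s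
      using that t by (intro lp_diff(1)[OF p] lp_scaleR(1)[OF p] T_space x Ax) auto
    show "\<forall>\<^sub>F s in at t within {0..}. 0 \<le> lp_norm p (?D s)"
      using lp_norm_nonneg[OF Dsp] by (auto simp: eventually_at_filter)
    have "\<forall>\<^sub>F s in at t within {0..}. dist s t < 1" using eventually_at_ball[of 1 t "{0..}"]
      by (auto simp: dist_commute elim: eventually_mono)
    then show "\<forall>\<^sub>F s in at t within {0..}. lp_norm p (?D s) \<le> K * (G \<bar>s - t\<bar> + H \<bar>s - t\<bar>)"
      unfolding eventually_at_filter by eventually_elim (auto simp: dist_real_def intro!: bound)
  qed
  then show ?thesis using T_space[OF t Ax] by (simp add: lp_has_derivative_def)
qed

lemma B_apply_T:
  assumes "x \<in> lp_space p" "0 \<le> t"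
  shows "T t (B x) = (\<lambda>k. T t x k + \<epsilon> *\<^sub>R T t (A x) k)"
proof -
  have "B x = (\<lambda>k. x k + \<epsilon> *\<^sub>R A x k)" by (rule ext) (rule B_eq)
  then show ?thesis
    using assms lp_operator_add[OF T_operator assms(1) lp_scaleR(1)[OF p A_space[OF assms(1)]]]
      lp_operator_scaleR[OF T_operator A_space[OF assms(1)]] by simp
qed

text \<open>
  The factor \<open>exp r\<close> turns the generator \<open>\<epsilon> A\<close> of \<open>r \<mapsto> T (\<epsilon> r)\<close> into \<open>1 + \<epsilon> A = B\<close>, so the \<open>n\<close>-th derivative of
  \<open>exp r\<close> times \<open>T (\<epsilon> r) x\<close> is the same expression with \<open>B\<^sup>n x\<close> in place of \<open>x\<close>. All derivatives are bounded
  uniformly in \<open>n\<close> since \<open>B\<close> is power bounded, and the Taylor series at \<open>0\<close> is the claim. In particular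
  this identifies the given semigroup without a separate uniqueness argument.
\<close>

lemma T_series:
  assumes x: "x \<in> lp_space p" and s: "0 < s"
  shows "(\<lambda>n. (s ^ n / fact n) *\<^sub>R (B ^^ n) x k) sums (exp s *\<^sub>R T (\<epsilon> * s) x k)"
proof -
  define f where "f n r = exp r *\<^sub>R T (\<epsilon> * r) ((B ^^ n) x) k" for n r
  obtain K where K: "0 \<le> K"
    "\<And>r y. \<lbrakk>r \<in> {0..\<epsilon> * s}; y \<in> lp_space p\<rbrakk> \<Longrightarrow> lp_norm p (T r y) \<le> K * lp_norm p y"
    using T_locally_bounded[of "\<epsilon> * s"] by blast
  obtain C where C: "\<And>n. lp_norm p ((B ^^ n) x) \<le> C * lp_norm p x"
    using B_power_bounded[OF p] x by blast
  have "(\<lambda>n. (s ^ n / fact n) *\<^sub>R f n 0) sums f 0 s"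
  proof (rule taylor_sums_vector[OF s])
    fix n r assume r: "r \<in> {0..s}"
    note Bn = B_funpow_space[OF x, of n]
    have r0: "0 \<le> \<epsilon> * r" using r eps by simp
    have "((\<lambda>t. T t ((B ^^ n) x) k) has_vector_derivative T (\<epsilon> * r) (A ((B ^^ n) x)) k) (at (\<epsilon> * r) within {0..})"
      by (rule lp_has_derivative_nth[OF p T_space[OF _ Bn] r0 T_has_derivative[OF Bn r0]])
    then have "((\<lambda>t. T t ((B ^^ n) x) k) has_vector_derivative T (\<epsilon> * r) (A ((B ^^ n) x)) k)
        (at (\<epsilon> * r) within (\<lambda>r. \<epsilon> * r) ` {0..s})"
      by (rule has_vector_derivative_within_subset) (use eps in auto)
    moreover have "((\<lambda>r. \<epsilon> * r) has_vector_derivative \<epsilon>) (at r within {0..s})"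
      by (auto intro!: derivative_eq_intros)
    ultimately have "((\<lambda>r. T (\<epsilon> * r) ((B ^^ n) x) k) has_vector_derivative
        \<epsilon> *\<^sub>R T (\<epsilon> * r) (A ((B ^^ n) x)) k) (at r within {0..s})"
      using vector_diff_chain_within by (fastforce simp: o_def)
    moreover have "(exp has_field_derivative exp r) (at r within {0..s})"
      by (auto intro!: derivative_eq_intros)
    ultimately have "((\<lambda>r. exp r *\<^sub>R T (\<epsilon> * r) ((B ^^ n) x) k) has_vector_derivative
        exp r *\<^sub>R (\<epsilon> *\<^sub>R T (\<epsilon> * r) (A ((B ^^ n) x)) k) + exp r *\<^sub>R T (\<epsilon> * r) ((B ^^ n) x) k) (at r within {0..s})"
      by (intro has_vector_derivative_scaleR)
    moreover have "exp r *\<^sub>R (\<epsilon> *\<^sub>R T (\<epsilon> * r) (A ((B ^^ n) x)) k) + exp r *\<^sub>R T (\<epsilon> * r) ((B ^^ n) x) k = f (Suc n) r"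
      by (simp add: f_def B_apply_T[OF Bn r0] scaleR_add_right)
    ultimately show "(f n has_vector_derivative f (Suc n) r) (at r within {0..s})"
      by (simp add: f_def[abs_def])
    have "norm (T (\<epsilon> * r) ((B ^^ n) x) k) \<le> lp_norm p (T (\<epsilon> * r) ((B ^^ n) x))"
      by (rule norm_le_lp_norm[OF p T_space[OF r0 Bn]])
    also have "\<dots> \<le> K * lp_norm p ((B ^^ n) x)" using r eps by (intro K(2) Bn) auto
    also have "\<dots> \<le> K * (C * lp_norm p x)" by (intro mult_left_mono C K(1))
    finally show "norm (f n r) \<le> exp s * (K * (C * lp_norm p x))"
      using r by (auto simp: f_def intro!: mult_mono)
  qed
  then show ?thesis using x by (simp add: f_def T_zero B_funpow_space)
qed

end

section \<open>The upper rate\<close>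

context monotone_semigroup
begin

text \<open>
  Since \<open>\<epsilon> A = B - 1\<close>, the vector \<open>exp s\<close> times \<open>\<epsilon> T(\<epsilon> s) A x\<close> is the sum of \<open>q n (B\<^sup>n\<^sup>+\<^sup>1 x - B\<^sup>n x)\<close> with
  \<open>q n = s ^ n / fact n\<close>. Summation by parts moves the difference onto the weights, and
  \<open>q (n - 1) - q n = (n / s - 1) q n\<close> is controlled by the mean deviation of the Poisson distribution.
\<close>

lemma T_A_decay:
  "\<exists>C\<ge>0. \<forall>t>0. \<forall>x\<in>lp_space p. lp_norm p (T t (A x)) \<le> C / sqrt t * lp_norm p x"
proof -
  obtain C where C: "0 \<le> C" "\<And>n x. x \<in> lp_space p \<Longrightarrow> lp_norm p ((B ^^ n) x) \<le> C * lp_norm p x"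
    using B_power_bounded[OF p] by blast
  have main: "\<epsilon> * lp_norm p (T (\<epsilon> * s) (A x)) \<le> 2 * C / sqrt s * lp_norm p x"
    if s: "0 < s" and x: "x \<in> lp_space p" for s x
  proof -
    let ?N = "lp_norm p x"
    define q where "q n = s ^ n / fact n" for n
    have q0: "0 \<le> q n" for n using s by (simp add: q_def)
    have qs: "s ^ n / fact n = q n" for n by (simp add: q_def)
    define b where "b n = (B ^^ n) x" for n
    have b: "b n \<in> lp_space p" "lp_norm p (b n) \<le> C * ?N" for n
      using B_funpow_space[OF x] C(2)[OF x] by (auto simp: b_def)
    have N: "0 \<le> ?N" by (rule lp_norm_nonneg[OF x])
    have es: "0 \<le> \<epsilon> * s" using s eps by simp
    have TA: "T (\<epsilon> * s) (A x) \<in> lp_space p" by (rule T_space[OF es A_space[OF x]])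
    define y where "y M k = (\<Sum>n<M. q n *\<^sub>R (b (Suc n) k - b n k))" for M k
    have by_parts: "y M k = (real M / s * q M) *\<^sub>R b M k + (\<Sum>n<M. ((real n / s - 1) * q n) *\<^sub>R b n k)" for M k
    proof (induction M)
      case (Suc M)
      have "real (Suc M) / s * q (Suc M) = q M"
        using exp_coeff_Suc[of s M] s by (simp add: q_def mult.commute)
      then show ?case using Suc by (simp add: y_def algebra_simps del: of_nat_Suc)
    qed (simp add: y_def)
    have y_lim: "(\<lambda>M. y M k) \<longlonglongrightarrow> (exp s * \<epsilon>) *\<^sub>R T (\<epsilon> * s) (A x) k" for k
    proof -
      have "(\<lambda>n. q n *\<^sub>R b (Suc n) k) sums (exp s *\<^sub>R T (\<epsilon> * s) (B x) k)"
        using T_series[OF B_space[OF x] s, of k] by (simp add: b_def q_def funpow_swap1)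
      moreover have "(\<lambda>n. q n *\<^sub>R b n k) sums (exp s *\<^sub>R T (\<epsilon> * s) x k)"
        using T_series[OF x s, of k] by (simp add: b_def q_def)
      ultimately have "(\<lambda>n. q n *\<^sub>R b (Suc n) k - q n *\<^sub>R b n k) sums
          (exp s *\<^sub>R T (\<epsilon> * s) (B x) k - exp s *\<^sub>R T (\<epsilon> * s) x k)" by (rule sums_diff)
      then show ?thesis
        by (simp add: sums_def y_def B_apply_T[OF x es] algebra_simps)
    qed
    \<comment> \<open>the boundary term of the summation by parts vanishes in the limit; that it is at most the main bound suffices\<close>
    have "(\<lambda>n. s ^ n / fact n * (real n / s)) \<longlonglongrightarrow> 0"
      using exp_coeff_times_index_sums[of s] s by (intro summable_LIMSEQ_zero sums_summable) auto
    moreover have "0 < exp s / sqrt s" using s by simp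
    ultimately have "\<forall>\<^sub>F M in sequentially. s ^ M / fact M * (real M / s) < exp s / sqrt s"
      by (rule order_tendstoD(2))
    then have "\<forall>\<^sub>F M in sequentially. y M \<in> lp_space p \<and> lp_norm p (y M) \<le> 2 * C * ?N * (exp s / sqrt s)"
    proof eventually_elim
      case (elim M)
      have f: "(\<lambda>k. ((real n / s - 1) * q n) *\<^sub>R b n k) \<in> lp_space p"
        "lp_norm p (\<lambda>k. ((real n / s - 1) * q n) *\<^sub>R b n k) \<le> (q n * \<bar>real n / s - 1\<bar>) * (C * ?N)" for n
        using lp_scaleR[OF p b(1), of "(real n / s - 1) * q n" n]
          mult_left_mono[OF b(2)[of n], of "q n * \<bar>real n / s - 1\<bar>"] q0[of n]
        by (simp_all add: abs_mult mult.commute)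
      have "(\<Sum>n<M. lp_norm p (\<lambda>k. ((real n / s - 1) * q n) *\<^sub>R b n k))
          \<le> (\<Sum>n<M. (q n * \<bar>real n / s - 1\<bar>) * (C * ?N))"
        by (intro sum_mono f(2))
      also have "\<dots> = (\<Sum>n<M. q n * \<bar>real n / s - 1\<bar>) * (C * ?N)" by (simp add: sum_distrib_right)
      also have "\<dots> \<le> exp s / sqrt s * (C * ?N)"
        using poisson_abs_deviation_le[OF s, of M] C(1) N by (intro mult_right_mono) (auto simp: q_def)
      finally have sum_le: "(\<Sum>n<M. lp_norm p (\<lambda>k. ((real n / s - 1) * q n) *\<^sub>R b n k)) \<le> exp s / sqrt s * (C * ?N)" .
      have g: "(\<lambda>k. (real M / s * q M) *\<^sub>R b M k) \<in> lp_space p"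
        by (rule lp_scaleR(1)[OF p b(1)])
      have "lp_norm p (\<lambda>k. (real M / s * q M) *\<^sub>R b M k) = (s ^ M / fact M * (real M / s)) * lp_norm p (b M)"
        using s by (simp add: lp_scaleR(2)[OF p b(1)] q_def abs_mult mult_ac)
      also have "\<dots> \<le> exp s / sqrt s * (C * ?N)"
        using elim b(2)[of M] s lp_norm_nonneg[OF b(1)] by (intro mult_mono) auto
      finally have g': "lp_norm p (\<lambda>k. (real M / s * q M) *\<^sub>R b M k) \<le> exp s / sqrt s * (C * ?N)" .
      let ?h = "\<lambda>k. \<Sum>n<M. ((real n / s - 1) * q n) *\<^sub>R b n k"
      have h: "?h \<in> lp_space p" "lp_norm p ?h \<le> exp s / sqrt s * (C * ?N)"
        using lp_sum[OF p, of "{..<M}" "\<lambda>n k. ((real n / s - 1) * q n) *\<^sub>R b n k"] f(1) sum_le by auto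
      have "y M = (\<lambda>k. (real M / s * q M) *\<^sub>R b M k + ?h k)" by (rule ext) (rule by_parts)
      then have yM: "y M \<in> lp_space p" "lp_norm p (y M) \<le> exp s / sqrt s * (C * ?N) + exp s / sqrt s * (C * ?N)"
        using lp_add[OF p g h(1)] add_mono[OF g' h(2)] by (simp_all only: order_trans)
      have eq: "exp s / sqrt s * (C * ?N) + exp s / sqrt s * (C * ?N) = 2 * C * ?N * (exp s / sqrt s)"
        by (simp add: mult_ac)
      show ?case using yM unfolding eq by blast
    qed
    from lp_Fatou(2)[OF p this y_lim]
    have "exp s * \<epsilon> * lp_norm p (T (\<epsilon> * s) (A x)) \<le> 2 * C * ?N * (exp s / sqrt s)"
      unfolding lp_scaleR(2)[OF p TA] using eps by (simp add: abs_mult)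
    also have "\<dots> = exp s * (2 * C / sqrt s * ?N)" by (simp add: mult_ac)
    finally have "exp s * \<epsilon> * lp_norm p (T (\<epsilon> * s) (A x)) \<le> exp s * (2 * C / sqrt s * ?N)" .
    then have "exp s * (\<epsilon> * lp_norm p (T (\<epsilon> * s) (A x))) \<le> exp s * (2 * C / sqrt s * ?N)"
      by (simp only: mult.assoc)
    then show ?thesis by (rule mult_left_le_imp_le) simp
  qed
  have "lp_norm p (T t (A x)) \<le> (2 * C * sqrt \<epsilon> / \<epsilon>) / sqrt t * lp_norm p x"
    if t: "0 < t" and x: "x \<in> lp_space p" for t x
  proof -
    have "\<epsilon> * lp_norm p (T t (A x)) \<le> 2 * C / sqrt (t / \<epsilon>) * lp_norm p x"
      using main[of "t / \<epsilon>" x] t eps x by simp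
    also have "\<dots> = \<epsilon> * ((2 * C * sqrt \<epsilon> / \<epsilon>) / sqrt t * lp_norm p x)"
      using eps t by (simp add: real_sqrt_divide)
    finally show ?thesis using eps by (rule mult_left_le_imp_le)
  qed
  moreover have "0 \<le> 2 * C * sqrt \<epsilon> / \<epsilon>" using C(1) eps by simp
  ultimately show ?thesis by blast
qed

text \<open>
  If \<open>A x\<close> is close to \<open>z x\<close>, then \<open>B x\<close> is close to \<open>\<Lambda> x\<close> with \<open>\<Lambda> = 1 + \<epsilon> z\<close>, and the error of
  \<open>B\<^sup>n x\<close> against \<open>\<Lambda>\<^sup>n x\<close> grows at most like \<open>n L\<^sup>n\<close>. This is summable against the Poisson weights. The
  constant may depend badly on \<open>t\<close> and \<open>z\<close>: it is applied for fixed \<open>t\<close> and \<open>z\<close> with arbitrarily small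
  defects.
\<close>

lemma T_near_eigenvector:
  assumes t: "0 < t"
  shows "\<exists>K\<ge>0. \<forall>x\<in>lp_space p.
    lp_norm p (\<lambda>k. T t x k - exp (of_real t * z) *s x k) \<le> K * lp_norm p (\<lambda>k. A x k - z *s x k)"
proof -
  obtain C where C: "0 \<le> C" "\<And>n x. x \<in> lp_space p \<Longrightarrow> lp_norm p ((B ^^ n) x) \<le> C * lp_norm p x"
    using B_power_bounded[OF p] by blast
  define s where "s = t / \<epsilon>"
  have s: "0 < s" "\<epsilon> * s = t" using t eps by (simp_all add: s_def)
  define \<Lambda> where "\<Lambda> = 1 + of_real \<epsilon> * z"
  define L where "L = max 1 (norm \<Lambda>)"
  have L: "1 \<le> L" "norm \<Lambda> \<le> L" by (simp_all add: L_def)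
  have sL: "0 < s * L" using s L by simp
  define K where "K = (s * L) * exp (s * L) * (C * \<epsilon>)"
  have "lp_norm p (\<lambda>k. T t x k - exp (of_real t * z) *s x k) \<le> K * lp_norm p (\<lambda>k. A x k - z *s x k)"
    if x: "x \<in> lp_space p" for x
  proof -
    define e where "e = (\<lambda>k. A x k - z *s x k)"
    have e: "e \<in> lp_space p" unfolding e_def by (intro lp_diff(1)[OF p] A_space x lp_smult(1)[OF p])
    have e0: "0 \<le> lp_norm p e" by (rule lp_norm_nonneg[OF e])
    define d where "d n = (\<lambda>k. (B ^^ n) x k - \<Lambda> ^ n *s x k)" for n
    have Bx: "B x = (\<lambda>k. \<epsilon> *\<^sub>R e k + \<Lambda> *s x k)"
      by (rule ext) (simp add: B_eq e_def \<Lambda>_def scaleR_eq_smult vec_eq_iff algebra_simps)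
    have d_Suc: "d (Suc n) = (\<lambda>k. \<epsilon> *\<^sub>R (B ^^ n) e k + \<Lambda> *s d n k)" for n
    proof -
      have "(B ^^ Suc n) x = (B ^^ n) (B x)" by (simp add: funpow_swap1)
      also have "\<dots> = (\<lambda>k. \<epsilon> *\<^sub>R (B ^^ n) e k + \<Lambda> *s (B ^^ n) x k)"
        unfolding Bx
        by (simp only: lp_operator_add[OF B_funpow_operator lp_scaleR(1)[OF p e] lp_smult(1)[OF p x]]
            lp_operator_scaleR[OF B_funpow_operator e] lp_operator_smult[OF B_funpow_operator x])
      finally show ?thesis
        by (simp add: d_def vector_sub_rdistrib vector_smult_assoc vector_ssub_ldistrib add_diff_eq del: funpow.simps)
    qed
    have d: "d n \<in> lp_space p \<and> lp_norm p (d n) \<le> (real n * L ^ n) * (C * \<epsilon> * lp_norm p e)" for n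
    proof (induction n)
      case 0
      then show ?case using p by (simp add: d_def)
    next
      case (Suc n)
      let ?D = "C * \<epsilon> * lp_norm p e"
      have D: "0 \<le> ?D" using C(1) eps e0 by simp
      note Bne = B_funpow_space[OF e, of n]
      have "lp_norm p (\<lambda>k. \<epsilon> *\<^sub>R (B ^^ n) e k) \<le> ?D"
        using mult_left_mono[OF C(2)[OF e, of n], of \<epsilon>] eps by (simp add: lp_scaleR(2)[OF p Bne] mult.left_commute mult.assoc)
      also have "\<dots> \<le> L ^ Suc n * ?D"
        using D one_le_power[OF L(1), of "Suc n"] by (simp add: mult_le_cancel_right1)
      finally have 1: "lp_norm p (\<lambda>k. \<epsilon> *\<^sub>R (B ^^ n) e k) \<le> L ^ Suc n * ?D" .
      have "lp_norm p (\<lambda>k. \<Lambda> *s d n k) \<le> L * ((real n * L ^ n) * ?D)"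
        using Suc L lp_norm_nonneg by (simp only: lp_smult(2)[OF p]) (intro mult_mono, auto)
      then have "lp_norm p (\<lambda>k. \<epsilon> *\<^sub>R (B ^^ n) e k) + lp_norm p (\<lambda>k. \<Lambda> *s d n k)
          \<le> (real (Suc n) * L ^ Suc n) * ?D"
        using 1 by (simp add: algebra_simps)
      then show ?case
        unfolding d_Suc using lp_add[OF p lp_scaleR(1)[OF p Bne] lp_smult(1)[OF p], of "d n" \<epsilon> \<Lambda>] Suc by auto
    qed
    have K_sum: "(\<Sum>n<M. s ^ n / fact n * (real n * L ^ n)) \<le> (s * L) * exp (s * L)" for M
    proof -
      have "(\<lambda>n. (s * L) * ((s * L) ^ n / fact n * (real n / (s * L)))) sums ((s * L) * exp (s * L))"
        using s(1) L(1) by (intro sums_mult exp_coeff_times_index_sums) simp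
      moreover have "(s * L) * ((s * L) ^ n / fact n * (real n / (s * L))) = s ^ n / fact n * (real n * L ^ n)" for n
        using s(1) L(1) by (simp add: power_mult_distrib)
      ultimately have "(\<lambda>n. s ^ n / fact n * (real n * L ^ n)) sums ((s * L) * exp (s * L))" by simp
      then show ?thesis
        using s(1) L(1) sum_le_suminf[of "\<lambda>n. s ^ n / fact n * (real n * L ^ n)" "{..<M}"] by (simp add: sums_iff)
    qed
    have "(\<lambda>k. exp s *\<^sub>R (T t x k - exp (of_real t * z) *s x k)) \<in> lp_space p \<and>
        lp_norm p (\<lambda>k. exp s *\<^sub>R (T t x k - exp (of_real t * z) *s x k)) \<le> K * lp_norm p e"
    proof -
      let ?y = "\<lambda>M k. \<Sum>n<M. (s ^ n / fact n) *\<^sub>R d n k"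
      have "\<forall>\<^sub>F M in sequentially. ?y M \<in> lp_space p \<and> lp_norm p (?y M) \<le> K * lp_norm p e"
      proof (rule always_eventually, rule allI)
        fix M
        have f: "(\<lambda>k. (s ^ n / fact n) *\<^sub>R d n k) \<in> lp_space p"
          "lp_norm p (\<lambda>k. (s ^ n / fact n) *\<^sub>R d n k)
            \<le> (s ^ n / fact n * (real n * L ^ n)) * (C * \<epsilon> * lp_norm p e)" for n
          using lp_scaleR[OF p, of "d n" "s ^ n / fact n"] d[of n] s(1)
            mult_left_mono[of "lp_norm p (d n)" "(real n * L ^ n) * (C * \<epsilon> * lp_norm p e)" "s ^ n / fact n"]
          by (simp_all add: mult.assoc)
        have "(\<Sum>n<M. lp_norm p (\<lambda>k. (s ^ n / fact n) *\<^sub>R d n k))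
            \<le> (\<Sum>n<M. s ^ n / fact n * (real n * L ^ n)) * (C * \<epsilon> * lp_norm p e)"
          unfolding sum_distrib_right by (intro sum_mono f(2))
        also have "\<dots> \<le> ((s * L) * exp (s * L)) * (C * \<epsilon> * lp_norm p e)"
          using C(1) eps e0 by (intro mult_right_mono K_sum) simp
        also have "\<dots> = K * lp_norm p e" by (simp add: K_def)
        finally show "?y M \<in> lp_space p \<and> lp_norm p (?y M) \<le> K * lp_norm p e"
          using lp_sum[OF p, of "{..<M}" "\<lambda>n k. (s ^ n / fact n) *\<^sub>R d n k"] f(1) by auto
      qed
      moreover have "(\<lambda>M. ?y M k) \<longlonglongrightarrow> exp s *\<^sub>R (T t x k - exp (of_real t * z) *s x k)" for k
      proof -
        have "(\<lambda>n. (of_real s * \<Lambda>) ^ n /\<^sub>R fact n) sums exp (of_real s * \<Lambda>)" by (rule exp_converges)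
        moreover have "exp (of_real s * \<Lambda>) = of_real (exp s) * exp (of_real t * z)"
          using s(2)[symmetric] by (simp add: \<Lambda>_def distrib_left exp_add exp_of_real mult.commute mult.left_commute)
        moreover have "(of_real s * \<Lambda>) ^ n /\<^sub>R fact n = of_real (s ^ n / fact n) * \<Lambda> ^ n" for n
          by (simp add: power_mult_distrib scaleR_conv_of_real field_simps)
        ultimately have 1: "(\<lambda>n. of_real (s ^ n / fact n) * \<Lambda> ^ n) sums (of_real (exp s) * exp (of_real t * z))"
          by simp
        have "bounded_linear (\<lambda>c :: complex. c *s x k)"
        proof (rule bounded_linear_intro)
          show "norm (c *s x k) \<le> norm c * norm (x k)" for c by (simp add: norm_smult_vec)
        qed (simp_all add: scaleR_eq_smult vector_sadd_rdistrib scaleR_conv_of_real vector_smult_assoc)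
        from bounded_linear.sums[OF this 1]
        have "(\<lambda>n. (of_real (s ^ n / fact n) * \<Lambda> ^ n) *s x k) sums ((of_real (exp s) * exp (of_real t * z)) *s x k)" .
        from sums_diff[OF T_series[OF x s(1), of k] this]
        show ?thesis
          unfolding sums_def s(2)
          by (simp add: d_def scaleR_diff_right) (simp add: scaleR_eq_smult vector_smult_assoc)
      qed
      ultimately show ?thesis
        using lp_Fatou[OF p, of ?y "K * lp_norm p e" "\<lambda>k. exp s *\<^sub>R (T t x k - exp (of_real t * z) *s x k)"] by blast
    qed
    moreover have sp: "(\<lambda>k. T t x k - exp (of_real t * z) *s x k) \<in> lp_space p"
      using t by (intro lp_diff(1)[OF p] T_space lp_smult(1)[OF p] x) simp
    moreover have "lp_norm p (\<lambda>k. T t x k - exp (of_real t * z) *s x k)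
        \<le> exp s * lp_norm p (\<lambda>k. T t x k - exp (of_real t * z) *s x k)"
      using lp_norm_nonneg[OF sp] s(1) by (simp add: mult_le_cancel_right1)
    ultimately show ?thesis by (simp add: lp_scaleR(2)[OF p sp] e_def)
  qed
  moreover have "0 \<le> K" using C(1) eps sL by (simp add: K_def)
  ultimately show ?thesis by blast
qed

end

section \<open>The curve on which the characteristic function has modulus one\<close>

lemma le_zero_if_le_linear:
  fixes u C r :: real
  assumes r: "0 < r" and le: "\<And>x. \<lbrakk>0 < x; x < r\<rbrakk> \<Longrightarrow> u \<le> C * x"
  shows "u \<le> 0"
proof (rule tendsto_lowerbound)
  have "((\<lambda>x. C * x) \<longlongrightarrow> C * 0) (at_right 0)" by (intro tendsto_intros)
  then show "((\<lambda>x. C * x) \<longlongrightarrow> 0) (at_right 0)" by simp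
  show "\<forall>\<^sub>F x in at_right 0. u \<le> C * x" using r le by (auto simp: eventually_at_right_field)
qed simp

context monotone_system
begin

lemma phi_real_axis:
  assumes x: "0 < x"
  shows "Im (\<phi> (of_real x)) = 0" "Re (\<phi> (of_real x)) \<le> 1 / (1 + \<epsilon> * x)"
proof -
  define b where "b n = a n / (1 + \<epsilon> * x) ^ (n + 1)" for n
  have g: "1 \<le> 1 + \<epsilon> * x" using x eps by simp
  have n: "norm (1 + complex_of_real \<epsilon> * of_real x) = 1 + \<epsilon> * x"
  proof -
    have "1 + complex_of_real \<epsilon> * of_real x = of_real (1 + \<epsilon> * x)" by simp
    then show ?thesis using g by (simp only: norm_of_real)
  qed
  have ble: "0 \<le> b n" "b n \<le> a n / (1 + \<epsilon> * x)" for n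
  proof -
    show "0 \<le> b n" using a_nonneg g by (simp add: b_def)
    have "(1 + \<epsilon> * x) ^ 1 \<le> (1 + \<epsilon> * x) ^ (n + 1)" using g by (intro power_increasing) auto
    then show "b n \<le> a n / (1 + \<epsilon> * x)"
      unfolding b_def using g a_nonneg by (intro divide_left_mono) auto
  qed
  have sa: "(\<lambda>n. a n / (1 + \<epsilon> * x)) sums (1 / (1 + \<epsilon> * x))" by (intro sums_divide a_sums)
  have sb: "summable b"
    by (rule summable_comparison_test'[OF sums_summable[OF sa], of 0]) (use ble in auto)
  have "(\<lambda>n. complex_of_real (b n)) sums \<phi> (of_real x)"
    using phi_series[of "of_real x"] n g by (simp add: b_def)
  moreover have "(\<lambda>n. complex_of_real (b n)) sums of_real (suminf b)"
    using sb by (simp only: sums_of_real_iff summable_sums)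
  ultimately have eq: "\<phi> (of_real x) = of_real (suminf b)" by (rule sums_unique2)
  show "Im (\<phi> (of_real x)) = 0" by (simp add: eq)
  have "suminf b \<le> suminf (\<lambda>n. a n / (1 + \<epsilon> * x))"
    by (intro suminf_le ble sb sums_summable[OF sa])
  then show "Re (\<phi> (of_real x)) \<le> 1 / (1 + \<epsilon> * x)" using sa by (simp add: eq sums_iff)
qed

text \<open>
  On the positive real axis \<open>\<phi>\<close> is real and at most \<open>1 / (1 + \<epsilon> x)\<close>, and \<open>\<phi> 0 = 1\<close>. Hence its
  derivative at \<open>0\<close> is real and at most \<open>- \<epsilon>\<close>; the rest is Taylor's theorem.
\<close>

lemma phi_expansion:
  "\<exists>r C d. 0 < r \<and> 0 \<le> C \<and> \<epsilon> \<le> d \<and> ball 0 r \<subseteq> resolvent_set A0 \<and> continuous_on (ball 0 r) \<phi> \<and>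
     (\<forall>z\<in>ball 0 r. norm (\<phi> z - (1 - of_real d * z)) \<le> C * (norm z)\<^sup>2)"
proof -
  let ?f = "char_poly_fun A0"
  have hol: "?f holomorphic_on S" for S by (rule holomorphic_char_poly_fun)
  have "open {z. ?f z \<noteq> 0}"
    using holomorphic_on_imp_continuous_on[OF hol[of UNIV]] by (intro open_Collect_neq) auto
  moreover have "resolvent_set A0 = {z. ?f z \<noteq> 0}" by (auto simp: resolvent_set_char_poly)
  ultimately have "open (resolvent_set A0)" by simp
  then obtain R where R: "0 < R" "ball 0 R \<subseteq> resolvent_set A0"
    using zero_resolvent open_contains_ball by blast
  define r where "r = R / 2"
  have r: "0 < r" "cball 0 r \<subseteq> ball 0 R" using R(1) by (auto simp: r_def)
  have br: "ball 0 r \<subseteq> resolvent_set A0" using r(2) R(2) by (meson ball_subset_cball order_trans)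
  have holQ: "(\<lambda>z. ?f 0 / ?f z) holomorphic_on ball 0 R"
    using R(2) by (intro holomorphic_intros hol) (auto simp: resolvent_set_char_poly)
  have hol\<phi>: "\<phi> holomorphic_on ball 0 R"
    by (rule holomorphic_transform[OF holQ]) (use quotient R(2) in auto)
  define g where "g i = (deriv ^^ i) \<phi>" for i :: nat
  have holg: "g i holomorphic_on ball 0 R" for i
    unfolding g_def by (rule holomorphic_higher_deriv[OF hol\<phi> open_ball])
  have "compact (g 2 ` cball 0 r)"
    using holomorphic_on_imp_continuous_on[OF holg[of 2]] r(2)
    by (intro compact_continuous_image compact_cball) (rule continuous_on_subset)
  then obtain C where C: "0 < C" "\<And>z. z \<in> cball 0 r \<Longrightarrow> norm (g 2 z) \<le> C"
    using compact_imp_bounded bounded_pos by (metis imageI)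
  have taylor: "norm (\<phi> z - (1 + g 1 0 * z)) \<le> C * (norm z)\<^sup>2" if z: "z \<in> cball 0 r" for z
  proof -
    have "norm (g 0 z - (\<Sum>i\<le>1. g i 0 * (z - 0) ^ i / fact i)) \<le> C * norm (z - 0) ^ Suc 1 / fact 1"
    proof (rule complex_Taylor[where S = "cball 0 r"])
      fix i and x :: complex assume "x \<in> cball 0 r" "i \<le> (1::nat)"
      then have "x \<in> ball 0 R" using r(2) by blast
      from holomorphic_derivI[OF holg[of i] open_ball this]
      show "(g i has_field_derivative g (Suc i) x) (at x within cball 0 r)"
        by (simp add: g_def has_field_derivative_at_within)
    qed (use C z r(1) in \<open>auto simp: numeral_2_eq_2\<close>)
    then show ?thesis by (simp add: g_def phi_zero power2_eq_square mult.assoc)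
  qed
  have \<phi>x: "norm (\<phi> (of_real x) - (1 + g 1 0 * of_real x)) \<le> C * x\<^sup>2" if "0 < x" "x < r" for x
    using taylor[of "of_real x"] that by simp
  have "\<bar>Im (g 1 0)\<bar> \<le> 0"
  proof (rule le_zero_if_le_linear[OF r(1)])
    fix x assume x: "0 < x" "x < r"
    have "\<bar>Im (\<phi> (of_real x) - (1 + g 1 0 * of_real x))\<bar> \<le> C * x\<^sup>2"
      by (rule order_trans[OF abs_Im_le_cmod \<phi>x[OF x]])
    then have "\<bar>Im (g 1 0)\<bar> * x \<le> (C * x) * x"
      using x phi_real_axis(1)[OF x(1)] by (simp add: abs_mult power2_eq_square mult.assoc)
    then show "\<bar>Im (g 1 0)\<bar> \<le> C * x" using x(1) by simp
  qed
  then have Im0: "Im (g 1 0) = 0" by simp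
  have "Re (g 1 0) + \<epsilon> \<le> 0"
  proof (rule le_zero_if_le_linear[OF r(1)])
    fix x assume x: "0 < x" "x < r"
    have "\<bar>Re (\<phi> (of_real x) - (1 + g 1 0 * of_real x))\<bar> \<le> C * x\<^sup>2"
      by (rule order_trans[OF abs_Re_le_cmod \<phi>x[OF x]])
    then have "1 + Re (g 1 0) * x - C * x\<^sup>2 \<le> Re (\<phi> (of_real x))" by simp
    also have "\<dots> \<le> 1 / (1 + \<epsilon> * x)" by (rule phi_real_axis(2)[OF x(1)])
    also have "\<dots> \<le> 1 - \<epsilon> * x + (\<epsilon> * x)\<^sup>2"
    proof -
      have p: "0 < 1 + \<epsilon> * x" using x eps by (simp add: add_pos_pos)
      have "1 \<le> 1 + (\<epsilon> * x) ^ 3" using x eps by simp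
      also have "\<dots> = (1 - \<epsilon> * x + (\<epsilon> * x)\<^sup>2) * (1 + \<epsilon> * x)"
        by (simp add: power2_eq_square power3_eq_cube algebra_simps)
      finally show ?thesis using p by (simp add: divide_le_eq)
    qed
    finally have "(Re (g 1 0) + \<epsilon>) * x \<le> ((C + \<epsilon>\<^sup>2) * x) * x"
      by (simp add: power2_eq_square algebra_simps)
    then show "Re (g 1 0) + \<epsilon> \<le> (C + \<epsilon>\<^sup>2) * x" using x(1) by simp
  qed
  moreover have "g 1 0 = - of_real (- Re (g 1 0))" using Im0 by (simp add: complex_eq_iff)
  then have "norm (\<phi> z - (1 - of_real (- Re (g 1 0)) * z)) \<le> C * (norm z)\<^sup>2" if "z \<in> ball 0 r" for z
    using taylor[of z] that by (metis ball_subset_cball diff_minus_eq_add mult_minus_left subsetD uminus_add_conv_diff add.inverse_inverse diff_conv_add_uminus)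
  moreover have "continuous_on (ball 0 r) \<phi>"
    using holomorphic_on_imp_continuous_on[OF hol\<phi>] r(2) by (meson ball_subset_cball continuous_on_subset order_trans)
  ultimately show ?thesis
    using r(1) C(1) br by (intro exI[of _ r] exI[of _ C] exI[of _ "- Re (g 1 0)"]) auto
qed

text \<open>
  On the imaginary axis \<open>\<bar>\<phi>\<bar> \<le> 1\<close>. Moving left from \<open>\<i> \<eta>\<close> by \<open>K \<eta>\<^sup>2\<close> increases the real part of \<open>\<phi>\<close> by about
  \<open>d K \<eta>\<^sup>2\<close>, which beats the quadratic error of the linearisation once \<open>K\<close> is large, so \<open>\<bar>\<phi>\<bar> \<ge> 1\<close> there. A point with
  \<open>\<bar>\<phi>\<bar> = 1\<close> lies in between.
\<close>

lemma phi_unit_circle_curve: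
  "\<exists>K>0. \<exists>\<eta>0>0. \<forall>\<eta>. 0 < \<eta> \<and> \<eta> < \<eta>0 \<longrightarrow>
     (\<exists>z\<in>resolvent_set A0. Im z = \<eta> \<and> - (K * \<eta>\<^sup>2) \<le> Re z \<and> norm (\<phi> z) = 1)"
proof -
  obtain r C d where r: "0 < r" and C: "0 \<le> C" and d: "\<epsilon> \<le> d"
    and sub: "ball 0 r \<subseteq> resolvent_set A0" and cont: "continuous_on (ball 0 r) \<phi>"
    and ex: "\<And>z. z \<in> ball 0 r \<Longrightarrow> norm (\<phi> z - (1 - of_real d * z)) \<le> C * (norm z)\<^sup>2"
    using phi_expansion by blast
  define K where "K = (2 * C + 1) / \<epsilon>"
  have K: "0 < K" "2 * C \<le> d * K"
  proof -
    show "0 < K" using C eps by (simp add: K_def)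
    then have "\<epsilon> * K \<le> d * K" using d by simp
    then show "2 * C \<le> d * K" using eps by (simp add: K_def)
  qed
  define \<eta>0 where "\<eta>0 = min (1 / K) (r / 2)"
  have "\<exists>z\<in>resolvent_set A0. Im z = \<eta> \<and> - (K * \<eta>\<^sup>2) \<le> Re z \<and> norm (\<phi> z) = 1"
    if \<eta>: "0 < \<eta>" "\<eta> < \<eta>0" for \<eta>
  proof -
    have K\<eta>: "K * \<eta> \<le> 1" "2 * \<eta> < r" using \<eta> K(1) by (auto simp: \<eta>0_def field_simps)
    have sq: "K * \<eta>\<^sup>2 \<le> \<eta>"
      using mult_right_mono[OF K\<eta>(1), of \<eta>] \<eta> by (simp add: power2_eq_square mult.assoc)
    define z where "z t = Complex (- t) \<eta>" for t
    have zr: "z t \<in> ball 0 r" if "t \<in> {0..K * \<eta>\<^sup>2}" for t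
      using that cmod_le[of "z t"] K\<eta>(2) sq \<eta> by (simp add: z_def)
    have zcont: "continuous_on {0..K * \<eta>\<^sup>2} (\<lambda>t. norm (\<phi> (z t)))"
    proof -
      have "continuous_on {0..K * \<eta>\<^sup>2} z"
        unfolding z_def Complex_eq by (intro continuous_intros)
      then show ?thesis
        using zr by (intro continuous_on_norm continuous_on_compose2[OF cont]) auto
    qed
    have "norm (\<phi> (z 0)) \<le> 1"
    proof (rule norm_phi_le_1)
      have "1 = \<bar>Re (1 + of_real \<epsilon> * z 0)\<bar>" by (simp add: z_def)
      then show "1 \<le> norm (1 + of_real \<epsilon> * z 0)" by (metis abs_Re_le_cmod)
    qed
    moreover have "1 \<le> norm (\<phi> (z (K * \<eta>\<^sup>2)))"
    proof -
      let ?z = "z (K * \<eta>\<^sup>2)"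
      have "(norm ?z)\<^sup>2 = (K * \<eta>\<^sup>2)\<^sup>2 + \<eta>\<^sup>2" by (simp add: z_def cmod_power2)
      also have "(K * \<eta>\<^sup>2)\<^sup>2 \<le> \<eta>\<^sup>2" using sq K(1) by (intro power_mono) auto
      finally have nz: "C * (norm ?z)\<^sup>2 \<le> C * (2 * \<eta>\<^sup>2)" using C by (intro mult_left_mono) auto
      have "\<bar>Re (\<phi> ?z - (1 - of_real d * ?z))\<bar> \<le> C * (norm ?z)\<^sup>2"
        using K(1) by (intro order_trans[OF abs_Re_le_cmod ex] zr) auto
      then have "1 + d * (K * \<eta>\<^sup>2) - C * (2 * \<eta>\<^sup>2) \<le> Re (\<phi> ?z)" using nz by (simp add: z_def)
      moreover have "C * (2 * \<eta>\<^sup>2) \<le> d * (K * \<eta>\<^sup>2)"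
        using mult_right_mono[OF K(2), of "\<eta>\<^sup>2"] by (simp add: mult_ac)
      ultimately have "1 \<le> Re (\<phi> ?z)" by linarith
      then show ?thesis using complex_Re_le_cmod order_trans by blast
    qed
    ultimately obtain t where t: "0 \<le> t" "t \<le> K * \<eta>\<^sup>2" "norm (\<phi> (z t)) = 1"
      using IVT'[of "\<lambda>t. norm (\<phi> (z t))" 0 1 "K * \<eta>\<^sup>2"] zcont K(1) by auto
    then show ?thesis using zr[of t] sub by (intro bexI[of _ "z t"]) (auto simp: z_def)
  qed
  moreover have "0 < \<eta>0" using K(1) r by (simp add: \<eta>0_def)
  ultimately show ?thesis using K(1) by blast
qed

end

section \<open>The lower rate\<close>

context monotone_semigroup
begin

text \<open>
  On sequences indexed by all integers, \<open>k \<mapsto> \<phi>(z)\<^sup>k w\<close> with \<open>w = R(z, A0) A1 v\<close> would be an exact eigenvector.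
  Truncating it abruptly creates an error which for \<open>p = \<infinity>\<close> is as large as the vector. A tent of slope
  \<open>1\<close> and height \<open>2 N\<close> gives errors of size \<open>1\<close> on an interval of length about \<open>4 N\<close>, while the vector has size at
  least \<open>N\<close> on an interval of length \<open>N\<close>. Comparing indicator sequences of intervals by means of
  shifts and the triangle inequality treats all exponents at once.
\<close>

lemma approximate_eigenvector:
  assumes z: "z \<in> resolvent_set A0" "norm (\<phi> z) = 1" and \<delta>: "0 < \<delta>"
  shows "\<exists>x\<in>lp_space p. 0 < lp_norm p x \<and> lp_norm p (\<lambda>k. A x k - z *s x k) \<le> \<delta> * lp_norm p x"
proof -
  have "\<exists>v. A1 *v v \<noteq> 0"
    using A1_nonzero matrix_eq[of A1 0] by auto
  then obtain v where v: "A1 *v v \<noteq> 0" by blast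
  define w where "w = resolvent z A0 *v (A1 *v v)"
  have A0w: "A0 *v w = z *s w - A1 *v v"
    using resolvent_eq[OF z(1), of "A1 *v v"] by (simp add: w_def algebra_simps)
  have A1w: "A1 *v w = \<phi> z *s (A1 *v v)" using characteristic_vec[OF z(1)] by (simp add: w_def)
  have \<phi>0: "\<phi> z \<noteq> 0" using z(2) by auto
  have w0: "w \<noteq> 0"
  proof
    assume "w = 0"
    then have "\<phi> z *s (A1 *v v) = 0" using A1w by simp
    then have "norm (\<phi> z *s (A1 *v v)) = 0" by simp
    then show False using z(2) v by (simp add: norm_smult_vec)
  qed
  define c where "c = norm (A1 *v v) / norm w"
  have c: "0 \<le> c" by (simp add: c_def)
  obtain N :: nat where N: "5 * c / \<delta> < real N" using reals_Archimedean2 by blast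
  have N0: "0 < N" using N c \<delta> by (metis divide_nonneg_pos mult_nonneg_nonneg not_gr_zero not_less of_nat_0 zero_le_numeral)
  define tent where "tent k = min k (4 * N - k)" for k :: nat
  define x where "x k = (of_nat (tent k) * \<phi> z ^ k) *s w" for k
  define ind where "ind M k = (if k < M then w else 0)" for M k :: nat
  have ind: "ind M \<in> lp_space p" for M
    by (rule lp_finite_support[OF p, of M]) (simp add: ind_def)
  have x: "x \<in> lp_space p"
    by (rule lp_finite_support[OF p, of "4 * N"]) (simp add: x_def tent_def)
  have shift: "(right_shift ^^ n) y \<in> lp_space p \<and> lp_norm p ((right_shift ^^ n) y) = lp_norm p y"
    if "y \<in> lp_space p" for n and y :: "'m cseq"
  proof (induction n)
    case (Suc n)
    then show ?case using lp_right_shift[OF p, of "(right_shift ^^ n) y"] by simp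
  qed (use that in simp)
  have ind_mult: "lp_norm p (ind (j * N)) \<le> real j * lp_norm p (ind N)" for j
  proof (induction j)
    case 0
    have "ind 0 = (\<lambda>k. 0)" by (simp add: ind_def fun_eq_iff)
    then show ?case using p by simp
  next
    case (Suc j)
    have "ind (Suc j * N) = (\<lambda>k. ind (j * N) k + (right_shift ^^ (j * N)) (ind N) k)"
      by (rule ext) (auto simp: ind_def right_shift_funpow)
    then show ?case
      using lp_add(2)[OF p ind, of "(right_shift ^^ (j * N)) (ind N)" "j * N"] shift[OF ind[of N], of "j * N"] Suc
      by (simp add: algebra_simps)
  qed
  have "lp_norm p ((right_shift ^^ N) (ind N)) \<le> (1 / real N) * lp_norm p x"
  proof (rule lp_dominated(2)[OF p x])
    fix k
    show "norm ((right_shift ^^ N) (ind N) k) \<le> 1 / real N * norm (x k)"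
    proof (cases "N \<le> k \<and> k < 2 * N")
      case True
      then have "real N * norm w \<le> real (tent k) * norm w"
        by (intro mult_right_mono) (auto simp: tent_def)
      then show ?thesis using True N0 z(2)
        by (simp add: right_shift_funpow ind_def x_def norm_smult_vec norm_mult norm_power field_simps)
    next
      case False
      then show ?thesis using N0 by (auto simp: right_shift_funpow ind_def)
    qed
  qed simp
  then have indN: "real N * lp_norm p (ind N) \<le> lp_norm p x"
    using shift[OF ind[of N], of N] N0 by (simp add: field_simps)
  let ?e = "\<lambda>k. A x k - z *s x k"
  have err: "norm (?e k) \<le> c * norm (ind (5 * N) k)" for k
  proof (cases k)
    case 0
    then show ?thesis using c by (simp add: system_operator_def x_def tent_def)
  next
    case (Suc j)
    have e: "?e k = ((of_nat (tent j) - of_nat (tent k)) * \<phi> z ^ k) *s (A1 *v v)"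
      by (simp add: Suc system_operator_def x_def vector_scalar_commute A0w A1w vec_eq_iff algebra_simps)
    show ?thesis
    proof (cases "k < 5 * N")
      case True
      have "\<bar>real (tent j) - real (tent k)\<bar> \<le> 1" by (auto simp: Suc tent_def)
      moreover have "norm (complex_of_nat (tent j) - of_nat (tent k)) = \<bar>real (tent j) - real (tent k)\<bar>"
        by (metis norm_of_real of_real_diff of_real_of_nat_eq)
      ultimately have "norm (?e k) \<le> 1 * norm (A1 *v v)"
        unfolding e norm_smult_vec norm_mult norm_power z(2) power_one mult_1_right
        by (intro mult_right_mono) auto
      then show ?thesis using True w0 by (simp add: c_def ind_def)
    next
      case False
      then have "tent k = 0" "tent j = 0" using Suc N0 by (auto simp: tent_def)
      then show ?thesis unfolding e using c by simp
    qed
  qed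
  have "lp_norm p ?e \<le> c * lp_norm p (ind (5 * N))" by (rule lp_dominated(2)[OF p ind c err])
  also have "\<dots> \<le> c * (5 * lp_norm p (ind N))" using ind_mult[of 5] c by (intro mult_left_mono) auto
  also have "\<dots> = (5 * c) * lp_norm p (ind N)" by simp
  also have "\<dots> \<le> (\<delta> * real N) * lp_norm p (ind N)"
    using N \<delta> by (intro mult_right_mono lp_norm_nonneg[OF ind]) (simp add: divide_less_eq mult.commute)
  also have "\<dots> = \<delta> * (real N * lp_norm p (ind N))" by simp
  also have "\<dots> \<le> \<delta> * lp_norm p x" using indN \<delta> by (intro mult_left_mono) auto
  finally have "lp_norm p ?e \<le> \<delta> * lp_norm p x" .
  moreover have "0 < lp_norm p x"
  proof -
    have "x 1 \<noteq> 0"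
      using N0 w0 \<phi>0 by (auto simp: x_def tent_def)
    then show ?thesis using norm_le_lp_norm[OF p x, of 1] by (metis not_le norm_le_zero_iff order_trans)
  qed
  ultimately show ?thesis using x by blast
qed

text \<open>
  An approximate eigenvalue \<open>z\<close> of \<open>A\<close> makes \<open>z exp(t z)\<close> an approximate eigenvalue of \<open>T(t) A\<close>. On the curve
  where \<open>\<phi>\<close> has modulus one take the point with imaginary part \<open>1 / sqrt t\<close>: its real part is at least \<open>- K / t\<close>, so
  the exponential factor stays bounded below.
\<close>

lemma norm_T_A_lower_bound:
  "\<exists>c>0. \<exists>t0>0. \<forall>t\<ge>t0. \<forall>N. (\<forall>x\<in>lp_space p. lp_norm p (T t (A x)) \<le> N * lp_norm p x) \<longrightarrow> c / sqrt t \<le> N"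
proof -
  obtain K \<eta>0 where K: "0 < K" and \<eta>0: "0 < \<eta>0"
    and curve: "\<And>\<eta>. \<lbrakk>0 < \<eta>; \<eta> < \<eta>0\<rbrakk> \<Longrightarrow>
      \<exists>z\<in>resolvent_set A0. Im z = \<eta> \<and> - (K * \<eta>\<^sup>2) \<le> Re z \<and> norm (\<phi> z) = 1"
    using phi_unit_circle_curve by blast
  define t0 where "t0 = (2 / \<eta>0)\<^sup>2"
  have t0: "0 < t0" using \<eta>0 by (simp add: t0_def)
  have "exp (- K) / sqrt t \<le> N"
    if t: "t0 \<le> t" and N: "\<forall>x\<in>lp_space p. lp_norm p (T t (A x)) \<le> N * lp_norm p x" for t N
  proof -
    have tpos: "0 < t" using t t0 by simp
    have st: "0 < sqrt t" using tpos by simp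
    define \<eta> where "\<eta> = 1 / sqrt t"
    have "2 / \<eta>0 \<le> sqrt t"
      using t \<eta>0 by (intro real_le_rsqrt) (simp add: t0_def)
    then have \<eta>: "0 < \<eta>" "\<eta> < \<eta>0" using \<eta>0 st by (auto simp: \<eta>_def field_simps)
    have t\<eta>: "t * \<eta>\<^sup>2 = 1" using tpos by (simp add: \<eta>_def power_divide)
    obtain z where z: "z \<in> resolvent_set A0" "Im z = \<eta>" "- (K * \<eta>\<^sup>2) \<le> Re z" "norm (\<phi> z) = 1"
      using curve[OF \<eta>] by blast
    have "exp (- K) / sqrt t \<le> norm z * exp (t * Re z)"
    proof -
      have "\<eta> \<le> norm z" using abs_Im_le_cmod[of z] z(2) by simp
      moreover have "t * - (K * \<eta>\<^sup>2) \<le> t * Re z" using z(3) tpos by (intro mult_left_mono) auto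
      then have "- K \<le> t * Re z" using t\<eta> by (simp add: mult.left_commute)
      ultimately have "\<eta> * exp (- K) \<le> norm z * exp (t * Re z)"
        using \<eta> by (intro mult_mono) auto
      then show ?thesis by (simp add: \<eta>_def)
    qed
    also have "\<dots> \<le> N"
    proof (rule field_le_epsilon)
      fix e :: real assume e: "0 < e"
      obtain C where C: "0 \<le> C" "\<And>x. x \<in> lp_space p \<Longrightarrow>
          lp_norm p (\<lambda>k. T t x k - exp (of_real t * z) *s x k) \<le> C * lp_norm p (\<lambda>k. A x k - z *s x k)"
        using T_near_eigenvector[OF tpos, of z] by blast
      obtain D where D: "0 \<le> D" "\<And>x. x \<in> lp_space p \<Longrightarrow> lp_norm p (T t x) \<le> D * lp_norm p x"
        using lp_bounded_operatorD(3)[OF T_operator[of t]] tpos by auto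
      define \<delta> where "\<delta> = e / (D + norm z * C + 1)"
      have den: "0 < D + norm z * C + 1" using C(1) D(1) by (intro add_nonneg_pos) auto
      then have \<delta>: "0 < \<delta>" "(D + norm z * C) * \<delta> \<le> e"
        using e C(1) D(1) by (auto simp: \<delta>_def field_simps)
      obtain x where x: "x \<in> lp_space p" "0 < lp_norm p x"
        and ax: "lp_norm p (\<lambda>k. A x k - z *s x k) \<le> \<delta> * lp_norm p x"
        using approximate_eigenvector[OF z(1,4) \<delta>(1)] by blast
      let ?e = "\<lambda>k. A x k - z *s x k" and ?r = "\<lambda>k. T t x k - exp (of_real t * z) *s x k"
      have t0': "0 \<le> t" using tpos by simp
      note Tx = T_space[OF t0' x(1)] and TAx = T_space[OF t0' A_space[OF x(1)]]
      have esp: "?e \<in> lp_space p" by (intro lp_diff(1)[OF p] A_space lp_smult(1)[OF p] x(1))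
      have rsp: "?r \<in> lp_space p" by (intro lp_diff(1)[OF p] Tx lp_smult(1)[OF p] x(1))
      have Te: "T t ?e = (\<lambda>k. T t (A x) k - z *s T t x k)"
        by (simp only: lp_operator_diff[OF T_operator[OF t0'] A_space[OF x(1)] lp_smult(1)[OF p x(1)]]
            lp_operator_smult[OF T_operator[OF t0'] x(1)])
      have decomp: "(\<lambda>k. (z * exp (of_real t * z)) *s x k) = (\<lambda>k. T t (A x) k - (T t ?e k + z *s ?r k))"
        unfolding Te by (simp add: fun_eq_iff vec_eq_iff algebra_simps)
      have s: "(\<lambda>k. T t ?e k + z *s ?r k) \<in> lp_space p"
        "lp_norm p (\<lambda>k. T t ?e k + z *s ?r k) \<le> lp_norm p (T t ?e) + norm z * lp_norm p ?r"
        using lp_add[OF p T_space[OF t0' esp] lp_smult(1)[OF p rsp]] unfolding lp_smult(2)[OF p rsp] by blast+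
      have "norm z * exp (t * Re z) * lp_norm p x = lp_norm p (\<lambda>k. (z * exp (of_real t * z)) *s x k)"
        by (simp add: lp_smult(2)[OF p x(1)] norm_mult)
      also have "\<dots> \<le> lp_norm p (T t (A x)) + lp_norm p (\<lambda>k. T t ?e k + z *s ?r k)"
        unfolding decomp by (rule lp_diff(2)[OF p TAx s(1)])
      also have "\<dots> \<le> N * lp_norm p x + (D * (\<delta> * lp_norm p x) + norm z * (C * (\<delta> * lp_norm p x)))"
      proof (intro add_mono)
        show "lp_norm p (T t (A x)) \<le> N * lp_norm p x" using N x(1) by blast
        have "lp_norm p (T t ?e) \<le> D * (\<delta> * lp_norm p x)"
          by (rule order_trans[OF D(2)[OF esp] mult_left_mono[OF ax D(1)]])
        moreover have "norm z * lp_norm p ?r \<le> norm z * (C * (\<delta> * lp_norm p x))"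
          by (intro mult_left_mono order_trans[OF C(2)[OF x(1)] mult_left_mono[OF ax C(1)]]) simp
        ultimately show "lp_norm p (\<lambda>k. T t ?e k + z *s ?r k) \<le> D * (\<delta> * lp_norm p x) + norm z * (C * (\<delta> * lp_norm p x))"
          using s(2) by linarith
      qed
      also have "\<dots> = (N + (D + norm z * C) * \<delta>) * lp_norm p x" by (simp add: algebra_simps)
      also have "\<dots> \<le> (N + e) * lp_norm p x" using \<delta>(2) x(2) by (intro mult_right_mono) auto
      finally show "norm z * exp (t * Re z) \<le> N + e" using x(2) by simp
    qed
    finally show ?thesis .
  qed
  then show ?thesis using t0 by (intro exI[of _ "exp (- K)"]) auto
qed

text \<open>
  If all orbits decayed like \<open>r\<close>, the operators \<open>T(t) A\<close> multiplied by \<open>sqrt t / \<rho>(t)\<close> would be pointwise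
  bounded for \<open>t = 1, 2, \<dots>\<close>, where \<open>\<rho>(t)\<close> is about \<open>\<bar>r(t)\<bar> sqrt t\<close> and tends to \<open>0\<close>. Uniform boundedness then contradicts
  the lower bound for the operator norms.
\<close>

lemma T_A_rate_sharp:
  fixes r :: "real \<Rightarrow> real"
  assumes r: "r \<in> o[at_top](\<lambda>t. t powr (-1/2))"
  shows "\<exists>z\<in>lp_space p. (\<lambda>t. lp_norm p (T t (A z))) \<notin> O[at_top](r)"
proof (rule ccontr)
  assume "\<not> ?thesis"
  then have O: "(\<lambda>t. lp_norm p (T t (A z))) \<in> O[at_top](r)" if "z \<in> lp_space p" for z using that by blast
  define t where "t n = real (Suc n)" for n
  have t: "0 < t n" for n by (simp add: t_def)
  have tlim: "filterlim t at_top sequentially"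
    unfolding t_def by (rule filterlim_compose[OF filterlim_real_sequentially filterlim_Suc])
  \<comment> \<open>the summand \<open>1 / t n\<close> keeps \<open>\<rho> n\<close> positive where \<open>r\<close> vanishes\<close>
  define \<rho> where "\<rho> n = \<bar>r (t n)\<bar> * sqrt (t n) + 1 / t n" for n
  have \<rho>: "0 < \<rho> n" for n using t[of n] by (simp add: \<rho>_def add_nonneg_pos)
  have \<rho>lim: "\<rho> \<longlonglongrightarrow> 0"
  proof -
    have "((\<lambda>s. r s / s powr (-1/2)) \<longlongrightarrow> 0) at_top" by (rule smalloD_tendsto[OF r])
    then have "(\<lambda>n. \<bar>r (t n) / t n powr (-1/2)\<bar>) \<longlonglongrightarrow> \<bar>0\<bar>"
      by (intro tendsto_rabs) (rule filterlim_compose[OF _ tlim])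
    moreover have "\<bar>r (t n) / t n powr (-1/2)\<bar> = \<bar>r (t n)\<bar> * sqrt (t n)" for n
      using t[of n] by (simp add: powr_minus_divide powr_half_sqrt abs_mult)
    moreover have "(\<lambda>n. 1 / t n) \<longlonglongrightarrow> 0"
      using LIMSEQ_inverse_real_of_nat by (simp add: t_def inverse_eq_divide)
    ultimately have "\<rho> \<longlonglongrightarrow> \<bar>0\<bar> + 0" unfolding \<rho>_def by (intro tendsto_add) auto
    then show ?thesis by simp
  qed
  define \<sigma> where "\<sigma> n = sqrt (t n) / \<rho> n" for n
  have \<sigma>: "0 < \<sigma> n" for n using t \<rho> by (simp add: \<sigma>_def)
  define L where "L n = (\<lambda>x k. \<sigma> n *\<^sub>R T (t n) (A x) k)" for n
  have TA: "T (t n) (A x) \<in> lp_space p" if "x \<in> lp_space p" for n x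
    using t[of n] by (intro T_space A_space that) simp
  have Lnorm: "lp_norm p (L n x) = \<sigma> n * lp_norm p (T (t n) (A x))" if "x \<in> lp_space p" for n x
    using lp_scaleR(2)[OF p TA[OF that], of "\<sigma> n" n] \<sigma>[of n] by (simp add: L_def)
  have "\<exists>C\<ge>0. \<forall>n. \<forall>x\<in>lp_space p. lp_norm p (L n x) \<le> C * lp_norm p x"
  proof (rule lp_uniform_boundedness[OF p])
    fix n
    show "lp_bounded_operator p (L n)"
      unfolding L_def using t[of n]
      by (intro lp_bounded_operator_compose[OF lp_bounded_operator_scaleR[OF p]]
          lp_bounded_operator_compose[OF T_operator A_operator]) simp
  next
    fix x :: "'m cseq" assume x: "x \<in> lp_space p"
    obtain C where C: "0 < C" "\<forall>\<^sub>F s in at_top. norm (lp_norm p (T s (A x))) \<le> C * norm (r s)"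
      using landau_o.bigE[OF O[OF x]] by blast
    from C(2) tlim have "\<forall>\<^sub>F n in sequentially. norm (lp_norm p (T (t n) (A x))) \<le> C * norm (r (t n))"
      by (rule eventually_compose_filterlim)
    then have "\<forall>\<^sub>F n in sequentially. lp_norm p (L n x) \<le> C"
    proof eventually_elim
      case (elim n)
      have "lp_norm p (L n x) \<le> \<sigma> n * (C * \<bar>r (t n)\<bar>)"
        unfolding Lnorm[OF x] using elim \<sigma>[of n] by (intro mult_left_mono) auto
      also have "\<dots> = C * ((\<bar>r (t n)\<bar> * sqrt (t n)) / \<rho> n)" by (simp add: \<sigma>_def)
      also have "(\<bar>r (t n)\<bar> * sqrt (t n)) / \<rho> n \<le> 1"
        using \<rho>[of n] t[of n] by (simp add: \<rho>_def)
      finally show ?case using C(1) by simp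
    qed
    then show "\<exists>C. \<forall>\<^sub>F n in sequentially. lp_norm p (L n x) \<le> C" by blast
  qed
  then obtain C where C: "0 \<le> C" "\<And>n x. x \<in> lp_space p \<Longrightarrow> lp_norm p (L n x) \<le> C * lp_norm p x" by blast
  obtain c t0 where c: "0 < c"
    and low: "\<And>t N. \<lbrakk>t0 \<le> t; \<forall>x\<in>lp_space p. lp_norm p (T t (A x)) \<le> N * lp_norm p x\<rbrakk> \<Longrightarrow> c / sqrt t \<le> N"
    using norm_T_A_lower_bound by blast
  have "\<forall>\<^sub>F n in sequentially. c \<le> C * \<rho> n"
    using filterlim_at_top[THEN iffD1, OF tlim, rule_format, of t0]
  proof eventually_elim
    case (elim n)
    have "lp_norm p (T (t n) (A x)) \<le> (C / \<sigma> n) * lp_norm p x" if "x \<in> lp_space p" for x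
      using C(2)[OF that, of n] \<sigma>[of n] unfolding Lnorm[OF that] by (simp add: field_simps)
    then have "c / sqrt (t n) \<le> C / \<sigma> n" using low[OF elim] by blast
    also have "C / \<sigma> n = C * \<rho> n / sqrt (t n)" by (simp add: \<sigma>_def)
    finally show ?case using t[of n] by (simp add: divide_le_cancel)
  qed
  moreover have "(\<lambda>n. C * \<rho> n) \<longlonglongrightarrow> C * 0" by (intro tendsto_intros \<rho>lim)
  ultimately have "c \<le> C * 0" by (intro tendsto_lowerbound) auto
  then show False using c by simp
qed

section \<open>The Cesaro condition describes the range of the generator\<close>

lemma A0_inv:
  "A0 *v (matrix_inv A0 *v b) = b" "matrix_inv A0 *v (A0 *v b) = b"
  "A1 *v (matrix_inv A0 *v (A1 *v v)) = - (A1 *v v)"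
proof -
  have "\<forall>v. A0 *v v = 0 \<longrightarrow> v = 0"
    using zero_resolvent[unfolded resolvent_set_kernel] by simp
  then have "invertible A0"
    unfolding invertible_left_inverse matrix_left_invertible_ker .
  note inv = matrix_inv_mult[OF this]
  show r: "A0 *v (matrix_inv A0 *v b) = b" and l: "matrix_inv A0 *v (A0 *v b) = b" for b
    by (simp_all add: matrix_vector_mul_assoc inv)
  define u where "u = resolvent 0 A0 *v (A1 *v v)"
  have neg: "M *v (- b) = - (M *v b)" for M :: "complex ^ 'm ^ 'm" and b
    using matrix_vector_mult_diff_distrib[of M 0 b] by simp
  have "A0 *v u = - (A1 *v v)"
    using resolvent_eq[OF zero_resolvent, of "A1 *v v"] by (simp add: u_def minus_equation_iff)
  then have "A1 *v v = A0 *v (- u)" by (simp add: neg)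
  then have "matrix_inv A0 *v (A1 *v v) = - u" by (simp only: l)
  then show "A1 *v (matrix_inv A0 *v (A1 *v v)) = - (A1 *v v)"
    using characteristic_vec[OF zero_resolvent, of v] by (simp add: u_def phi_zero neg)
qed

lemma cesaro_mean_eq:
  "cesaro_mean A0 A1 \<phi> x n = (\<lambda>j. (1 / of_nat n) *s (\<Sum>k=1..n. (right_shift ^^ k) (M_operator A0 A1 x) j))"
  by (simp add: cesaro_mean_def phi_zero)

text \<open>
  For \<open>x = A z\<close> the vector \<open>M x\<close> is \<open>P - S P\<close> with \<open>P = A1 z\<close>, so the sums in the Cesaro means telescope.
\<close>

lemma cesaro_mean_A:
  assumes z: "z \<in> lp_space p"
  shows "(\<lambda>n. lp_norm p (cesaro_mean A0 A1 \<phi> (A z) n)) \<in> O(\<lambda>n. 1 / real n)"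
proof -
  define P where "P = (\<lambda>k. A1 *v z k)"
  have P: "P \<in> lp_space p" unfolding P_def by (rule lp_matrix[OF p z])
  have M: "M_operator A0 A1 (A z) k = P k - right_shift P k" for k
    by (cases k) (simp_all add: M_operator_def system_operator_def P_def A0_inv
        matrix_vector_right_distrib matrix_vector_mul_assoc[symmetric])
  have SP: "(right_shift ^^ k) P \<in> lp_space p \<and> lp_norm p ((right_shift ^^ k) P) = lp_norm p P" for k
  proof (induction k)
    case (Suc k)
    then show ?case using lp_right_shift[OF p, of "(right_shift ^^ k) P"] by simp
  qed (use P in simp)
  have "(right_shift ^^ k) (M_operator A0 A1 (A z)) j = (right_shift ^^ k) P j - (right_shift ^^ Suc k) P j" for k j
    unfolding right_shift_funpow M
    by (cases "j - k") (auto simp: diff_Suc split: nat.split)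
  then have "(\<Sum>k=1..n. (right_shift ^^ k) (M_operator A0 A1 (A z)) j)
      = (right_shift ^^ 1) P j - (right_shift ^^ Suc n) P j" for n j
    by (induction n) simp_all
  then have ces: "cesaro_mean A0 A1 \<phi> (A z) n
      = (\<lambda>j. (1 / of_nat n) *s ((right_shift ^^ 1) P j - (right_shift ^^ Suc n) P j))" for n
    by (simp only: cesaro_mean_eq)
  have d: "(\<lambda>j. (right_shift ^^ 1) P j - (right_shift ^^ Suc n) P j) \<in> lp_space p"
    "lp_norm p (\<lambda>j. (right_shift ^^ 1) P j - (right_shift ^^ Suc n) P j) \<le> 2 * lp_norm p P" for n
    using lp_diff[OF p, of "(right_shift ^^ 1) P" "(right_shift ^^ Suc n) P"] SP[of 1] SP[of "Suc n"] by auto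
  show ?thesis
  proof (rule bigoI[where c = "2 * lp_norm p P"], rule always_eventually, rule allI)
    fix n
    have "lp_norm p (cesaro_mean A0 A1 \<phi> (A z) n) = (1 / real n) *
        lp_norm p (\<lambda>j. (right_shift ^^ 1) P j - (right_shift ^^ Suc n) P j)"
      unfolding ces lp_smult(2)[OF p d(1)] by (simp add: norm_divide)
    also have "\<dots> \<le> (1 / real n) * (2 * lp_norm p P)" by (intro mult_left_mono d(2)) simp
    finally show "norm (lp_norm p (cesaro_mean A0 A1 \<phi> (A z) n)) \<le> 2 * lp_norm p P * norm (1 / real n)"
      using lp_norm_nonneg[OF lp_smult(1)[OF p d(1)], of "1 / of_nat n" n] unfolding ces by (simp add: mult.commute)
  qed
qed

text \<open>
  The sums in the Cesaro means of \<open>y = M x\<close> are bounded and converge coordinatewise to the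
  sequence \<open>w\<close> of partial sums of \<open>y\<close>, so \<open>w\<close> lies in the space. Then \<open>v = y + w\<close> satisfies \<open>v - S v = y\<close> and
  takes values in the range of \<open>A1\<close>, on which \<open>A1 A0\<^sup>-\<^sup>1\<close> acts as \<open>-1\<close>. This \<open>v\<close> is the value that \<open>A1 z\<close> must have if
  \<open>A z = x\<close>, and solving \<open>A0 z = x - S v\<close> for \<open>z\<close> gives a preimage.
\<close>

lemma range_A_if_cesaro_mean:
  assumes x: "x \<in> lp_space p"
    and O: "(\<lambda>n. lp_norm p (cesaro_mean A0 A1 \<phi> x n)) \<in> O(\<lambda>n. 1 / real n)"
  shows "\<exists>z\<in>lp_space p. x = A z"
proof -
  define y where "y = M_operator A0 A1 x"
  have y_eq: "y k = A1 *v (matrix_inv A0 *v x k)" for k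
    by (simp add: y_def M_operator_def matrix_vector_mul_assoc)
  have y: "y \<in> lp_space p"
    unfolding y_def M_operator_def by (rule lp_matrix[OF p x])
  define S where "S n = (\<lambda>j. \<Sum>k=1..n. (right_shift ^^ k) y j)" for n
  have shift: "(right_shift ^^ k) y \<in> lp_space p" for k
  proof (induction k)
    case (Suc k)
    then show ?case using lp_right_shift(1)[OF p, of "(right_shift ^^ k) y"] by simp
  qed (use y in simp)
  have S: "S n \<in> lp_space p" for n
    unfolding S_def using lp_sum[OF p, of "{1..n}" "\<lambda>k. (right_shift ^^ k) y"] shift by simp
  obtain C where C: "0 < C"
    "\<forall>\<^sub>F n in sequentially. norm (lp_norm p (cesaro_mean A0 A1 \<phi> x n)) \<le> C * norm (1 / real n)"
    using landau_o.bigE[OF O] by blast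
  define w where "w j = (\<Sum>i<j. y i)" for j
  have "\<forall>\<^sub>F n in sequentially. S n \<in> lp_space p \<and> lp_norm p (S n) \<le> C"
    using C(2) eventually_gt_at_top[of 0]
  proof eventually_elim
    case (elim n)
    have "lp_norm p (cesaro_mean A0 A1 \<phi> x n) = (1 / real n) * lp_norm p (S n)"
      using lp_smult(2)[OF p S, of "1 / of_nat n" n] by (simp add: cesaro_mean_eq S_def y_def norm_divide)
    then have "(1 / real n) * lp_norm p (S n) \<le> C * (1 / real n)"
      using elim(1) lp_norm_nonneg[OF S[of n]] by simp
    then show ?case using S elim(2) by (simp add: divide_le_cancel)
  qed
  moreover have "(\<lambda>n. S n j) \<longlonglongrightarrow> w j" for j
  proof (rule tendsto_eventually)
    show "\<forall>\<^sub>F n in sequentially. S n j = w j"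
      using eventually_ge_at_top[of j]
    proof eventually_elim
      case (elim n)
      have "S n j = (\<Sum>k=1..j. (right_shift ^^ k) y j)"
        unfolding S_def using elim by (intro sum.mono_neutral_right) (auto simp: right_shift_funpow)
      also have "\<dots> = (\<Sum>i<j. (right_shift ^^ Suc i) y j)"
        by (rule sum.reindex_bij_witness[of _ Suc "\<lambda>k. k - 1"]) auto
      also have "\<dots> = (\<Sum>i<j. y (j - Suc i))"
        by (intro sum.cong refl) (simp only: right_shift_funpow, simp)
      also have "\<dots> = w j" unfolding w_def by (rule sum.nat_diff_reindex)
      finally show ?case .
    qed
  qed
  ultimately have w: "w \<in> lp_space p" by (rule lp_Fatou(1)[OF p])
  define v where "v = (\<lambda>j. y j + w j)"
  have v: "v \<in> lp_space p" unfolding v_def by (rule lp_add(1)[OF p y w])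
  have v_Suc: "v (Suc j) = y (Suc j) + v j" and v_0: "v 0 = y 0" for j
    by (simp_all add: v_def w_def)
  have v_range: "A1 *v (matrix_inv A0 *v v j) = - v j" for j
  proof -
    have "v j = A1 *v (\<Sum>i\<le>j. matrix_inv A0 *v x i)"
      by (simp add: v_def w_def y_eq matrix_vector_mult_sum matrix_vector_right_distrib
          lessThan_Suc_atMost[symmetric] add.commute)
    then show ?thesis by (simp only: A0_inv)
  qed
  define z where "z = (\<lambda>k. matrix_inv A0 *v x k - right_shift (\<lambda>k. matrix_inv A0 *v v k) k)"
  have z: "z \<in> lp_space p"
    unfolding z_def by (intro lp_diff(1)[OF p] lp_matrix[OF p] lp_right_shift(1)[OF p] x v)
  have A1z: "A1 *v z k = v k" for k
    by (cases k) (simp_all add: z_def y_eq v_0 v_Suc v_range matrix_vector_mult_diff_distrib)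
  have "x k = A z k" for k
    by (cases k) (simp_all add: system_operator_def A1z, simp_all add: z_def A0_inv matrix_vector_mult_diff_distrib)
  then show ?thesis using z by blast
qed

end

section \<open>Rates of decay and their sharpness\<close>

theorem theorem2p14:
  fixes p :: ennreal
    and A0 A1 :: "complex ^ 'm ^ 'm"
    and \<phi> :: "complex \<Rightarrow> complex"
    and T :: "real \<Rightarrow> ('m::finite) cseq \<Rightarrow> 'm cseq"
  assumes "1 \<le> p"
    and "A1 \<noteq> 0"
    and "rational_function \<phi>"
    and "\<forall>z\<in>resolvent_set A0. A1 ** resolvent z A0 ** A1 = (\<chi> i j. \<phi> z * A1 $ i $ j)"
    and "lp_C0_semigroup p T"
    and "lp_generator p T = {(x, system_operator A0 A1 x) | x. x \<in> lp_space p}"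
    and "spectrum A0 \<subseteq> {z. Re z < 0}"
    and "0 \<in> Omega_plus A0 \<phi>"
    and "Omega_plus A0 \<phi> \<subseteq> {z. Re z < 0} \<union> {0}"
    and "totally_monotonic \<phi>"
    and "\<forall>z\<in>resolvent_set A0. \<phi> z = char_poly_fun A0 0 / char_poly_fun A0 z"
  shows
    "(\<forall>x0\<in>lp_space p.
        (\<lambda>n. lp_norm p (cesaro_mean A0 A1 \<phi> x0 n)) \<in> O(\<lambda>n. 1 / real n) \<longrightarrow>
        (\<lambda>t. lp_norm p (T t x0)) \<in> O[at_top](\<lambda>t. t powr (-1/2))) \<and>
     (\<forall>x0\<in>lp_space p. \<exists>xdot.
        (\<forall>t\<ge>0. lp_has_derivative p (\<lambda>s. T s x0) (xdot t) t) \<and>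
        (\<lambda>t. lp_norm p (xdot t)) \<in> O[at_top](\<lambda>t. t powr (-1/2))) \<and>
     (\<forall>r :: real \<Rightarrow> real. r \<in> o[at_top](\<lambda>t. t powr (-1/2)) \<longrightarrow>
        (\<exists>x0\<in>lp_space p.
           (\<lambda>n. lp_norm p (cesaro_mean A0 A1 \<phi> x0 n)) \<in> O(\<lambda>n. 1 / real n) \<and>
           (\<lambda>t. lp_norm p (T t x0)) \<notin> O[at_top](r))) \<and>
     (\<forall>r :: real \<Rightarrow> real. r \<in> o[at_top](\<lambda>t. t powr (-1/2)) \<longrightarrow>
        (\<exists>x0\<in>lp_space p. \<exists>xdot.
           (\<forall>t\<ge>0. lp_has_derivative p (\<lambda>s. T s x0) (xdot t) t) \<and>
           (\<lambda>t. lp_norm p (xdot t)) \<notin> O[at_top](r)))"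
proof -
  obtain \<epsilon> a where "0 < \<epsilon>" "\<And>n. 0 \<le> a n" "summable a"
    "\<And>z. 1 \<le> norm z \<Longrightarrow> (\<lambda>n. complex_of_real (a n) / z ^ (n + 1)) sums \<phi> ((z - 1) / of_real \<epsilon>)"
    using assms(10) unfolding totally_monotonic_def by blast
  moreover have "0 \<in> resolvent_set A0" using assms(8) by (simp add: Omega_plus_def)
  ultimately interpret monotone_semigroup A0 A1 \<phi> \<epsilon> a p T
    using assms by unfold_locales auto
  have rate: "(\<lambda>t. lp_norm p (T t (A z))) \<in> O[at_top](\<lambda>t. t powr (-1/2))" if z: "z \<in> lp_space p" for z
  proof -
    obtain C where C: "\<And>t x. \<lbrakk>0 < t; x \<in> lp_space p\<rbrakk> \<Longrightarrow> lp_norm p (T t (A x)) \<le> C / sqrt t * lp_norm p x"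
      using T_A_decay by blast
    show ?thesis
    proof (rule bigoI[where c = "C * lp_norm p z"])
      show "\<forall>\<^sub>F t in at_top. norm (lp_norm p (T t (A z))) \<le> C * lp_norm p z * norm (t powr (-1/2))"
        using eventually_gt_at_top[of 0]
      proof eventually_elim
        case (elim t)
        have "0 \<le> lp_norm p (T t (A z))"
          using elim by (intro lp_norm_nonneg T_space A_space z) simp
        then show ?case
          using C[OF elim z] elim by (simp add: powr_minus_divide powr_half_sqrt mult.commute)
      qed
    qed
  qed
  have deriv: "\<forall>t\<ge>0. lp_has_derivative p (\<lambda>s. T s x0) (T t (A x0)) t" if "x0 \<in> lp_space p" for x0
    using T_has_derivative[OF that] by blast
  show ?thesis
  proof (intro conjI allI ballI impI)
    fix x0 :: "'m cseq" assume "x0 \<in> lp_space p"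
      "(\<lambda>n. lp_norm p (cesaro_mean A0 A1 \<phi> x0 n)) \<in> O(\<lambda>n. 1 / real n)"
    then obtain z where "z \<in> lp_space p" "x0 = A z" using range_A_if_cesaro_mean by blast
    then show "(\<lambda>t. lp_norm p (T t x0)) \<in> O[at_top](\<lambda>t. t powr (-1/2))" using rate by simp
  next
    fix x0 :: "'m cseq" assume "x0 \<in> lp_space p"
    then show "\<exists>xdot. (\<forall>t\<ge>0. lp_has_derivative p (\<lambda>s. T s x0) (xdot t) t) \<and>
        (\<lambda>t. lp_norm p (xdot t)) \<in> O[at_top](\<lambda>t. t powr (-1/2))"
      using deriv rate by (intro exI[of _ "\<lambda>t. T t (A x0)"]) blast
  next
    fix r :: "real \<Rightarrow> real" assume "r \<in> o[at_top](\<lambda>t. t powr (-1/2))"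
    then obtain z where z: "z \<in> lp_space p" "(\<lambda>t. lp_norm p (T t (A z))) \<notin> O[at_top](r)"
      using T_A_rate_sharp by blast
    then show "\<exists>x0\<in>lp_space p.
        (\<lambda>n. lp_norm p (cesaro_mean A0 A1 \<phi> x0 n)) \<in> O(\<lambda>n. 1 / real n) \<and>
        (\<lambda>t. lp_norm p (T t x0)) \<notin> O[at_top](r)"
      using cesaro_mean_A A_space by (intro bexI[of _ "A z"]) auto
    show "\<exists>x0\<in>lp_space p. \<exists>xdot.
        (\<forall>t\<ge>0. lp_has_derivative p (\<lambda>s. T s x0) (xdot t) t) \<and>
        (\<lambda>t. lp_norm p (xdot t)) \<notin> O[at_top](r)"
      using z deriv[OF z(1)] by (intro bexI[of _ z] exI[of _ "\<lambda>t. T t (A z)"]) auto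
  qed
qed

end
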